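(* Let $T>0$ and let $a\in C^2(\mathbb R)$ be strictly convex. Let $u\in L^\infty([0,T]\times\mathbb R)$ be a weak solution of $u_t+[a(u)]_x=0$ in $\mathcal D'((0,T)\times\mathbb R)$ which has finite entropy production, i.e. $\mu_\eta$ is a locally finite Radon measure on $[0,T]\times\mathbb R$ for every $C^2$ entropy $\eta$. Let $I=[\inf u,\sup u]$. Then there is an absolute constant $C_0>0$ such that for every $C^2$ entropy $\eta$ (with any entropy flux $q$) and every open set $U\subset[0,T]\times\mathbb R$, $$|\mu_\eta|(U)\le C_0\cdot\sup_I|\eta''|\cdot\limsup_{\epsilon\to0}\sup_{|h|<\epsilon}\frac1{|h|}\iint_U\Delta\big(u(t,x),u(t,x+h)\big)\,dx\,dt.$$
   Context: An entropy is a function $\eta\colon\mathbb R\to\mathbb R$ (here $C^2$); an associated entropy flux is any $q\colon\mathbb R\to\mathbb R$ with $q'=\eta'a'$. The entropy production of $u$ is the distribution $\mu_\eta=[\eta(u)]_t+[q(u)]_x$ on $(0,T)\times\mathbb R$. A weak solution is a bounded measurable $u$ satisfying the equation in the sense of distributions. $\inf u,\sup u$ denote essential infimum and supremum. The regularity cost is $$\Delta(u_1,u_2)=\frac12\int_{u_1}^{u_2}\int_{u_1}^{u_2}|a'(v)-a'(w)|\,dv\,dw=\int_{[u_1,u_2]}(u_2-s)(s-u_1)\,a''(ds),$$ where $[u_1,u_2]$ denotes the closed segment between $u_1$ and $u_2$ regardless of order, and $a''$ is the (nonnegative) distributional second derivative of $a$, viewed as a measure. *)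

theory Defs
  imports "HOL-Analysis.Analysis"
begin

definition C2 :: "(real \<Rightarrow> real) \<Rightarrow> bool" where
  "C2 f \<longleftrightarrow> (\<forall>x. f differentiable at x) \<and> (\<forall>x. deriv f differentiable at x)
            \<and> continuous_on UNIV (deriv (deriv f))"

definition strictly_convex :: "(real \<Rightarrow> real) \<Rightarrow> bool" where
  "strictly_convex f \<longleftrightarrow> (\<forall>x y t. x \<noteq> y \<and> 0 < t \<and> t < 1 \<longrightarrow>
      f ((1 - t) * x + t * y) < (1 - t) * f x + t * f y)"

definition entropy_flux :: "(real \<Rightarrow> real) \<Rightarrow> (real \<Rightarrow> real) \<Rightarrow> (real \<Rightarrow> real) \<Rightarrow> bool" where
  "entropy_flux a \<eta> q \<longleftrightarrow> (\<forall>v. (q has_real_derivative (deriv \<eta> v * deriv a v)) (at v))"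

definition dt :: "(real \<Rightarrow> real \<Rightarrow> real) \<Rightarrow> real \<Rightarrow> real \<Rightarrow> real" where
  "dt \<phi> t x = deriv (\<lambda>s. \<phi> s x) t"

definition dx :: "(real \<Rightarrow> real \<Rightarrow> real) \<Rightarrow> real \<Rightarrow> real \<Rightarrow> real" where
  "dx \<phi> t x = deriv (\<lambda>y. \<phi> t y) x"

fun iter_partial :: "bool list \<Rightarrow> (real \<Rightarrow> real \<Rightarrow> real) \<Rightarrow> real \<Rightarrow> real \<Rightarrow> real" where
  "iter_partial [] \<phi> = \<phi>"
| "iter_partial (b # bs) \<phi> = (if b then dt else dx) (iter_partial bs \<phi>)"

definition smooth2 :: "(real \<Rightarrow> real \<Rightarrow> real) \<Rightarrow> bool" where
  "smooth2 \<phi> \<longleftrightarrow> (\<forall>ds.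
      continuous_on UNIV (\<lambda>p. iter_partial ds \<phi> (fst p) (snd p)) \<and>
      (\<forall>t x. (\<lambda>s. iter_partial ds \<phi> s x) differentiable at t \<and>
             (\<lambda>y. iter_partial ds \<phi> t y) differentiable at x))"

definition test_fun :: "real \<Rightarrow> (real \<Rightarrow> real \<Rightarrow> real) \<Rightarrow> bool" where
  "test_fun T \<phi> \<longleftrightarrow> smooth2 \<phi> \<and>
     (\<exists>K. compact K \<and> K \<subseteq> {0<..<T} \<times> UNIV \<and> (\<forall>t x. (t, x) \<notin> K \<longrightarrow> \<phi> t x = 0))"

definition weak_solution :: "real \<Rightarrow> (real \<Rightarrow> real) \<Rightarrow> (real \<Rightarrow> real \<Rightarrow> real) \<Rightarrow> bool" where
  "weak_solution T a u \<longleftrightarrow> (\<forall>\<phi>. test_fun T \<phi> \<longrightarrow>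
     (LINT p|lborel. u (fst p) (snd p) * dt \<phi> (fst p) (snd p)
                     + a (u (fst p) (snd p)) * dx \<phi> (fst p) (snd p)) = 0)"

definition Linf_strip :: "real \<Rightarrow> (real \<Rightarrow> real \<Rightarrow> real) \<Rightarrow> bool" where
  "Linf_strip T u \<longleftrightarrow>
     set_borel_measurable lborel ({0..T} \<times> UNIV) (\<lambda>p. u (fst p) (snd p)) \<and>
     (\<exists>M. AE p in lborel. p \<in> {0..T} \<times> UNIV \<longrightarrow> \<bar>u (fst p) (snd p)\<bar> \<le> M)"

definition ess_sup_strip :: "real \<Rightarrow> (real \<Rightarrow> real \<Rightarrow> real) \<Rightarrow> real" where
  "ess_sup_strip T u = Inf {M. AE p in lborel. p \<in> {0..T} \<times> UNIV \<longrightarrow> u (fst p) (snd p) \<le> M}"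

definition ess_inf_strip :: "real \<Rightarrow> (real \<Rightarrow> real \<Rightarrow> real) \<Rightarrow> real" where
  "ess_inf_strip T u = Sup {m. AE p in lborel. p \<in> {0..T} \<times> UNIV \<longrightarrow> m \<le> u (fst p) (snd p)}"

(* (mu_p, mu_n) is the Jordan decomposition of a signed locally finite Radon measure
   mu = mu_p - mu_n on R^2 which represents the entropy production distribution
   mu_eta = [eta(u)]_t + [q(u)]_x on (0,T) x R; its total variation is mu_p + mu_n. *)
definition entropy_production_repr ::
  "real \<Rightarrow> (real \<Rightarrow> real \<Rightarrow> real) \<Rightarrow> (real \<Rightarrow> real) \<Rightarrow> (real \<Rightarrow> real)
   \<Rightarrow> (real \<times> real) measure \<Rightarrow> (real \<times> real) measure \<Rightarrow> bool" where
  "entropy_production_repr T u \<eta> q \<mu>p \<mu>n \<longleftrightarrow>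
     sets \<mu>p = sets borel \<and> sets \<mu>n = sets borel \<and>
     (\<forall>K. compact K \<longrightarrow> emeasure \<mu>p K < \<infinity> \<and> emeasure \<mu>n K < \<infinity>) \<and>
     (\<exists>S \<in> sets borel. emeasure \<mu>p S = 0 \<and> emeasure \<mu>n (- S) = 0) \<and>
     (\<forall>\<phi>. test_fun T \<phi> \<longrightarrow>
        - (LINT p|lborel. \<eta> (u (fst p) (snd p)) * dt \<phi> (fst p) (snd p)
                          + q (u (fst p) (snd p)) * dx \<phi> (fst p) (snd p))
        = (LINT p|\<mu>p. \<phi> (fst p) (snd p)) - (LINT p|\<mu>n. \<phi> (fst p) (snd p)))"

definition Delta :: "(real \<Rightarrow> real) \<Rightarrow> real \<Rightarrow> real \<Rightarrow> real" where
  "Delta a u1 u2 = 1/2 * (LBINT w=u1..u2. (LBINT v=u1..u2. \<bar>deriv a v - deriv a w\<bar>))"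

end

theory Submission
  imports Defs
begin

text \<open>
  Clip \<open>u\<close> to its essential range and mollify, with time scale \<open>d\<close> much smaller than the space
  scale \<open>e\<close>, to get \<open>w = u * k\<close> and \<open>A = a(u) * k\<close> with \<open>w\<^sub>t + A\<^sub>x = 0\<close>. Then the entropy
  production of \<open>w\<close> is, up to a term that vanishes in the limit, at most
  \<open>sup |\<eta>''|\<close> times the integral of \<open>|w\<^sub>x| (A - a(w))\<close>. Both factors are averages over a
  box: with \<open>X\<close> the value of \<open>u\<close> at a uniform point of the box, \<open>|w\<^sub>x|\<close> is at most a constant
  over \<open>e\<close> times \<open>E|X - m|\<close>, and \<open>A - a(w)\<close> at most a constant times the Jensen gap
  \<open>E a(X) - a(m)\<close>, where \<open>m = E X\<close>. The product of these two is at most \<open>E E' \<Delta>(X, X')\<close> for an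
  independent copy \<open>X'\<close>, by the trapezoidal rule for convex functions. As \<open>d \<rightarrow> 0\<close> before \<open>e\<close>,
  only differences in \<open>x\<close> of size at most \<open>2 e\<close> remain, which the right hand side controls.
\<close>

section \<open>Smooth bump functions\<close>

text \<open>The right hand side is of third order in the oscillation of \<open>u\<close>, although
  no derivative of \<open>u\<close> is controlled. The gain comes from one identity: with the
  corrected flux \<open>q(w) + \<eta>'(w) (A - a(w))\<close>, the balance for
  \<open>\<eta>(w)\<close> has the source \<open>\<eta>''(w) w_x (A - a(w))\<close>, a first order
  factor times a second order one. The correction itself carries no derivative after integration by
  parts and vanishes in L^1. The obstacle is time: two points of the box also differ in time, and
  the right hand side says nothing about such differences. The Lipschitz bound for
  \<open>Delta\<close> moves both points to equal times at the price of an L^1 translation error. A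
  factor \<open>1/e\<close> stands in front, so this error is required to be at most
  \<open>e^2\<close>; mere continuity of translations then suffices, because \<open>d\<close> may be
  chosen after \<open>e\<close>. The constant \<open>2 C^2\<close> is the product of
  \<open>C / e\<close> (bound on the x-derivative of the kernel), \<open>C\<close> (bound on the
  kernel) and \<open>2 e\<close> (largest spatial difference in the box).\<close>

definition flat :: "nat \<Rightarrow> real \<Rightarrow> real" where
  "flat n z = (if z > 0 then (1 / z) ^ n * exp (- 1 / z) else 0)"

lemma flat_mult: "z * flat (Suc n) z = flat n z"
  by (simp add: flat_def)

lemma flat_tendsto_0: "(flat n \<longlongrightarrow> 0) (at_right 0)"
proof -
  have "((\<lambda>z::real. (1 / z) ^ n * exp (- 1 / z)) \<longlongrightarrow> 0) (at_right 0)"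
  proof -
    have "((\<lambda>y::real. y ^ n / exp y) \<longlongrightarrow> 0) at_top"
      by (rule tendsto_power_div_exp_0)
    then have "((\<lambda>z::real. inverse z ^ n / exp (inverse z)) \<longlongrightarrow> 0) (at_right 0)"
      using filterlim_compose filterlim_inverse_at_top_right by blast
    then show ?thesis by (simp add: divide_inverse exp_minus power_inverse)
  qed
  moreover have "eventually (\<lambda>z::real. (1 / z) ^ n * exp (- 1 / z) = flat n z) (at_right 0)"
    unfolding eventually_at_right_field by (auto simp: flat_def intro!: exI[of _ 1])
  ultimately show ?thesis by (rule Lim_transform_eventually)
qed

text \<open>The delicate point is 0, where the difference quotient \<open>flat n y / y\<close> is
  \<open>flat (Suc n) y\<close>, again a member of the family, and tends to 0. The index exists for
  this: all derivatives of \<open>exp (- 1 / z)\<close> stay in the linear span of the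
  family.\<close>

lemma flat_has_derivative:
  "(flat n has_real_derivative (flat (n + 2) z - real n * flat (Suc n) z)) (at z)"
proof -
  consider "z > 0" | "z < 0" | "z = 0" by linarith
  then show ?thesis
  proof cases
    case 1
    have "((\<lambda>z. (1 / z) ^ n * exp (- 1 / z)) has_real_derivative
        (flat (n + 2) z - real n * flat (Suc n) z)) (at z)"
    proof -
      have i: "((\<lambda>z. 1 / z) has_real_derivative - ((1 / z)\<^sup>2)) (at z)"
        using 1 by (auto intro!: derivative_eq_intros simp: power2_eq_square)
      have p: "((\<lambda>z. (1 / z) ^ n) has_real_derivative - (real n * (1 / z) ^ Suc n)) (at z)"
        using DERIV_power[OF i, of n] by (cases n) (simp_all add: power2_eq_square mult_ac)
      have e: "((\<lambda>z. exp (- 1 / z)) has_real_derivative (1 / z)\<^sup>2 * exp (- 1 / z)) (at z)"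
        using 1 by (auto intro!: derivative_eq_intros simp: power2_eq_square)
      show ?thesis using DERIV_mult[OF p e] 1
        by (simp add: flat_def power_add power2_eq_square algebra_simps)
    qed
    moreover have "eventually (\<lambda>y. (1 / y) ^ n * exp (- 1 / y) = flat n y) (nhds z)"
      using eventually_nhds_in_open[of "{0<..}" z] 1
      by (auto simp: flat_def elim!: eventually_mono)
    ultimately show ?thesis
      by (subst DERIV_cong_ev[OF refl _ refl, of "flat n" "\<lambda>z. (1 / z) ^ n * exp (- 1 / z)"])
        (auto elim!: eventually_mono)
  next
    case 2
    have "eventually (\<lambda>y. flat n y = 0) (nhds z)"
      using eventually_nhds_in_open[of "{..<0}" z] 2
      by (auto simp: flat_def elim!: eventually_mono)
    then show ?thesis using 2
      by (subst DERIV_cong_ev[OF refl _ refl, of "flat n" "\<lambda>_. 0"]) (auto simp: flat_def)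
  next
    case 3
    have "((\<lambda>y. flat n y / y) \<longlongrightarrow> 0) (at 0)"
    proof (rule filterlim_split_at)
      have "eventually (\<lambda>y. 0 = flat n y / y) (at_left 0)"
        unfolding eventually_at_left_field by (auto simp: flat_def intro!: exI[of _ "-1"])
      then show "((\<lambda>y. flat n y / y) \<longlongrightarrow> 0) (at_left 0)"
        by (rule Lim_transform_eventually[OF tendsto_const])
      have "eventually (\<lambda>y. flat (Suc n) y = flat n y / y) (at_right 0)"
        unfolding eventually_at_right_field
        by (auto simp: flat_mult[of _ n, symmetric] intro!: exI[of _ 1])
      then show "((\<lambda>y. flat n y / y) \<longlongrightarrow> 0) (at_right 0)"
        by (rule Lim_transform_eventually[OF flat_tendsto_0])
    qed
    then show ?thesis using 3 by (simp add: has_field_derivative_iff flat_def)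
  qed
qed

text \<open>Smooth functions supported in \<open>{-1..1}\<close>; \<open>bump 1 0\<close> is the
  usual \<open>exp (- 1 / (1 - x^2))\<close>. Polynomial and index are parameters so that the
  derivative of a bump is again a single bump.\<close>

definition bump :: "real poly \<Rightarrow> nat \<Rightarrow> real \<Rightarrow> real" where
  "bump p n x = poly p x * flat n (1 - x\<^sup>2)"

lemma bump_has_derivative:
  "\<exists>p' n'. \<forall>x. (bump p n has_real_derivative bump p' n' x) (at x)"
proof -
  let ?z = "[:1, 0, -1:] :: real poly"
  let ?p' = "pderiv p * ?z\<^sup>2 + [:0, -2:] * p * (1 - smult (real n) ?z)"
  have z: "poly ?z x = 1 - x\<^sup>2" for x by (simp add: power2_eq_square)
  have "(bump p n has_real_derivative bump ?p' (n + 2) x) (at x)" for x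
  proof -
    have f: "((\<lambda>x. flat n (1 - x\<^sup>2)) has_real_derivative
        (flat (n + 2) (1 - x\<^sup>2) - real n * flat (Suc n) (1 - x\<^sup>2)) * (- 2 * x)) (at x)"
      by (rule DERIV_chain'[OF _ flat_has_derivative]) (auto intro!: derivative_eq_intros)
    have d: "((\<lambda>x. poly p x * flat n (1 - x\<^sup>2)) has_real_derivative
        poly p x * ((flat (n + 2) (1 - x\<^sup>2) - real n * flat (Suc n) (1 - x\<^sup>2)) * (- 2 * x))
          + poly (pderiv p) x * flat n (1 - x\<^sup>2)) (at x)"
      using DERIV_mult[OF poly_DERIV f] by (simp add: algebra_simps)
    \<comment> \<open>The lower indices are polynomial multiples of \<open>flat (n + 2)\<close>, so
      the product rule collapses to the single polynomial \<open>?p'\<close>.\<close>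
    have s1: "flat (Suc n) (1 - x\<^sup>2) = (1 - x\<^sup>2) * flat (n + 2) (1 - x\<^sup>2)"
      using flat_mult[of "1 - x\<^sup>2" "Suc n"] by simp
    have s2: "flat n (1 - x\<^sup>2) = (1 - x\<^sup>2) * ((1 - x\<^sup>2) * flat (n + 2) (1 - x\<^sup>2))"
      using flat_mult[of "1 - x\<^sup>2" "Suc n"] flat_mult[of "1 - x\<^sup>2" n] by simp
    have s3: "bump ?p' (n + 2) x = (poly (pderiv p) x * (1 - x\<^sup>2)\<^sup>2 +
        (- 2 * x) * poly p x * (1 - real n * (1 - x\<^sup>2))) * flat (n + 2) (1 - x\<^sup>2)"
      unfolding bump_def by (simp add: z del: mult_pCons_left mult_pCons_right) (simp add: power2_eq_square algebra_simps)
    show ?thesis unfolding s3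
      unfolding bump_def[abs_def]
      by (rule DERIV_cong[OF d]) (simp only: s1 s2, algebra)
  qed
  then show ?thesis by blast
qed

lemma bump_eq_0: "\<bar>x\<bar> \<ge> 1 \<Longrightarrow> bump p n x = 0"
  by (simp add: bump_def flat_def abs_le_square_iff[of 1 x, simplified] not_less)

lemma continuous_on_bump [continuous_intros]:
  "continuous_on S f \<Longrightarrow> continuous_on S (\<lambda>x. bump p n (f x))"
proof -
  have "continuous_on UNIV (bump p n)"
    using bump_has_derivative[of p n] by (meson DERIV_isCont continuous_at_imp_continuous_on)
  then show "continuous_on S f \<Longrightarrow> continuous_on S (\<lambda>x. bump p n (f x))"
    using continuous_on_compose2 by blast
qed

lemma bump_bounded: "\<exists>C>0. \<forall>x. \<bar>bump p n x\<bar> \<le> C"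
proof -
  have "compact (bump p n ` {-1..1})"
    by (intro compact_continuous_image continuous_intros) auto
  then obtain C where C: "C > 0" "\<forall>x\<in>{-1..1}. \<bar>bump p n x\<bar> \<le> C"
    by (metis (no_types, lifting) bounded_pos compact_imp_bounded image_eqI real_norm_def)
  have "\<bar>bump p n x\<bar> \<le> C" for x
  proof (cases "\<bar>x\<bar> \<ge> 1")
    case False
    then have "x \<in> {-1..1}" by auto
    then show ?thesis using C by blast
  qed (use C bump_eq_0[of x p n] in auto)
  then show ?thesis using C by blast
qed

text \<open>\<open>smooth2\<close> asks about every word of partial derivatives. A class of
  continuous functions closed under both first partials contains all of them, so each application
  only has to exhibit one step of differentiation.\<close>

lemma smooth2_coinduct:
  assumes "\<phi> \<in> F"
    and cont: "\<And>\<phi>. \<phi> \<in> F \<Longrightarrow> continuous_on UNIV (\<lambda>p. \<phi> (fst p) (snd p))"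
    and t: "\<And>\<phi>. \<phi> \<in> F \<Longrightarrow> \<exists>\<psi>\<in>F. \<forall>t x. ((\<lambda>s. \<phi> s x) has_real_derivative \<psi> t x) (at t)"
    and x: "\<And>\<phi>. \<phi> \<in> F \<Longrightarrow> \<exists>\<psi>\<in>F. \<forall>t x. ((\<lambda>y. \<phi> t y) has_real_derivative \<psi> t x) (at x)"
  shows "smooth2 \<phi>"
proof -
  have dt: "dt \<phi> \<in> F" if F: "\<phi> \<in> F" for \<phi>
  proof -
    obtain \<psi> where \<psi>: "\<psi> \<in> F" "\<forall>t x. ((\<lambda>s. \<phi> s x) has_real_derivative \<psi> t x) (at t)"
      using t[OF F] by blast
    have "dt \<phi> = \<psi>" by (intro ext) (simp add: dt_def DERIV_imp_deriv \<psi>)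
    then show ?thesis using \<psi> by simp
  qed
  have dx: "dx \<phi> \<in> F" if F: "\<phi> \<in> F" for \<phi>
  proof -
    obtain \<psi> where \<psi>: "\<psi> \<in> F" "\<forall>t x. ((\<lambda>y. \<phi> t y) has_real_derivative \<psi> t x) (at x)"
      using x[OF F] by blast
    have "dx \<phi> = \<psi>" by (intro ext) (simp add: dx_def DERIV_imp_deriv \<psi>)
    then show ?thesis using \<psi> by simp
  qed
  have "iter_partial ds \<phi> \<in> F" for ds
    by (induction ds) (auto simp: assms(1) dt dx)
  note F = this
  have "(\<lambda>s. iter_partial ds \<phi> s x) differentiable at t" for ds t x
    using t[OF F[of ds]] real_differentiable_def by blast
  moreover have "(\<lambda>y. iter_partial ds \<phi> t y) differentiable at x" for ds t x
    using x[OF F[of ds]] real_differentiable_def by blast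
  ultimately show ?thesis
    unfolding smooth2_def using cont[OF F] by blast
qed

section \<open>Convolution with compactly supported kernels\<close>

definition conv :: "(real \<times> real \<Rightarrow> real) \<Rightarrow> (real \<times> real \<Rightarrow> real) \<Rightarrow> real \<times> real \<Rightarrow> real" where
  "conv f g p = (LINT z|lborel. f z * g (p - z))"

lemma bounded_compact_support_integrable:
  fixes f :: "real \<times> real \<Rightarrow> real"
  assumes "f \<in> borel_measurable lborel" "\<And>z. \<bar>f z\<bar> \<le> M" "\<And>z. R < norm (z - p) \<Longrightarrow> f z = 0"
  shows "integrable lborel f"
proof (rule Bochner_Integration.integrable_bound)
  show "integrable lborel (\<lambda>z. M * indicator (cball p R) z)"
    using emeasure_lborel_cball_finite[of p R]
    by (intro integrable_mult_right integrable_real_indicator) auto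
  show "AE z in lborel. norm (f z) \<le> norm (M * indicator (cball p R) z)"
    using assms(2) assms(3) by (intro AE_I2)
      (auto simp: indicator_def dist_norm norm_minus_commute not_le intro: order_trans[OF _ abs_ge_self])
qed fact

locale compact_kernel =
  fixes g :: "real \<times> real \<Rightarrow> real" and R :: real
  assumes cont: "continuous_on UNIV g"
    and supp: "\<And>z. R < norm z \<Longrightarrow> g z = 0"
begin

lemma meas [measurable]: "g \<in> borel_measurable borel"
  using cont by (rule borel_measurable_continuous_onI)

lemma bounded: "\<exists>C>0. \<forall>z. \<bar>g z\<bar> \<le> C"
proof -
  have "compact (g ` cball 0 R)"
    by (intro compact_continuous_image continuous_on_subset[OF cont]) auto
  then obtain C where C: "C > 0" "\<forall>z\<in>cball 0 R. \<bar>g z\<bar> \<le> C"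
    by (metis (no_types, lifting) bounded_pos compact_imp_bounded image_eqI real_norm_def)
  have "\<bar>g z\<bar> \<le> C" for z
    using C supp[of z] by (cases "R < norm z") auto
  then show ?thesis using C by blast
qed

lemma integrable: "integrable lborel g"
proof -
  obtain C where "\<forall>z. \<bar>g z\<bar> \<le> C" using bounded by blast
  then show ?thesis
    by (intro bounded_compact_support_integrable[of g C R 0]) (auto simp: supp)
qed

lemma integrable_conv:
  assumes f [measurable]: "f \<in> borel_measurable borel" and M: "\<And>z. \<bar>f z\<bar> \<le> M"
  shows "integrable lborel (\<lambda>z. f z * g (p - z))"
proof -
  obtain C where C: "C > 0" "\<And>z. \<bar>g z\<bar> \<le> C" using bounded by blast
  show ?thesis
  proof (rule bounded_compact_support_integrable[of _ "M * C" R p])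
    show "\<bar>f z * g (p - z)\<bar> \<le> M * C" for z
      using C(1) C(2)[of "p - z"] M[of z] by (auto simp: abs_mult intro!: mult_mono)
    show "R < norm (z - p) \<Longrightarrow> f z * g (p - z) = 0" for z
      by (simp add: supp norm_minus_commute)
  qed measurable
qed

text \<open>Dominated convergence along a sequence: a convergent sequence is bounded, so all the
  shifted kernels live in one ball, whose indicator dominates.\<close>

lemma continuous_on_conv:
  assumes f [measurable]: "f \<in> borel_measurable borel" and M: "\<And>z. \<bar>f z\<bar> \<le> M"
  shows "continuous_on UNIV (conv f g)"
  unfolding continuous_on_sequentially
proof (intro allI ballI impI, elim conjE)
  fix P :: "nat \<Rightarrow> real \<times> real" and p assume P: "P \<longlonglongrightarrow> p"
  obtain C where C: "C > 0" "\<And>z. \<bar>g z\<bar> \<le> C" using bounded by blast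
  obtain K where K: "\<And>n. norm (P n) \<le> K"
    using convergent_imp_Bseq[OF convergentI[OF P]] by (auto simp: Bseq_def)
  have "(\<lambda>n. LINT z|lborel. f z * g (P n - z)) \<longlonglongrightarrow> (LINT z|lborel. f z * g (p - z))"
  proof (rule integral_dominated_convergence[where w="\<lambda>z. (M * C) * indicator (cball 0 (R + K)) z"])
    show "integrable lborel (\<lambda>z. (M * C) * indicator (cball (0::real\<times>real) (R + K)) z :: real)"
      using emeasure_lborel_cball_finite[of "0::real\<times>real" "R + K"]
      by (intro integrable_mult_right integrable_real_indicator) auto
    show "AE z in lborel. (\<lambda>n. f z * g (P n - z)) \<longlonglongrightarrow> f z * g (p - z)"
      by (intro AE_I2 tendsto_intros continuous_on_tendsto_compose[OF cont] P) auto
    show "AE z in lborel. norm (f z * g (P n - z)) \<le> M * C * indicator (cball 0 (R + K)) z" for n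
    proof (intro AE_I2)
      fix z :: "real \<times> real"
      show "norm (f z * g (P n - z)) \<le> M * C * indicator (cball 0 (R + K)) z"
      proof (cases "norm z \<le> R + K")
        case True
        then show ?thesis using C(1) C(2)[of "P n - z"] M[of z] by (auto simp: abs_mult intro!: mult_mono)
      next
        case False
        then have "R < norm (P n - z)"
          using K[of n] norm_triangle_ineq2[of z "P n"] by (simp add: norm_minus_commute)
        then show ?thesis using supp False by simp
      qed
    qed
  qed measurable
  then show "((conv f g) \<circ> P) \<longlonglongrightarrow> conv f g p" by (simp add: conv_def o_def)
qed

end

text \<open>As \<open>f\<close> is merely bounded and measurable, the derivative must fall on the
  kernel. Its difference quotients are bounded by the bound of \<open>g'\<close> (mean value theorem
  along \<open>b\<close>) and are supported in one ball, which permits dominated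
  convergence.\<close>

lemma conv_has_partial_derivative:
  assumes g: "compact_kernel g R" and g': "compact_kernel g' R"
    and d: "\<And>p. ((\<lambda>s. g (p + s *\<^sub>R b)) has_real_derivative g' p) (at 0)" and b: "norm b = 1"
    and f [measurable]: "f \<in> borel_measurable borel" and M: "\<And>z. \<bar>f z\<bar> \<le> M"
  shows "((\<lambda>s. conv f g (p + s *\<^sub>R b)) has_real_derivative conv f g' p) (at 0)"
proof -
  interpret g: compact_kernel g R by fact
  interpret g': compact_kernel g' R by fact
  have d': "((\<lambda>s. g (p + s *\<^sub>R b)) has_real_derivative g' (p + t *\<^sub>R b)) (at t)" for p t
  proof -
    have "((\<lambda>s. g ((p + t *\<^sub>R b) + s *\<^sub>R b)) has_real_derivative g' (p + t *\<^sub>R b)) (at 0)" by (rule d)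
    then have "((\<lambda>s. g (p + (s + t) *\<^sub>R b)) has_real_derivative g' (p + t *\<^sub>R b)) (at 0)"
      by (simp add: algebra_simps)
    then show ?thesis using DERIV_shift[of "\<lambda>s. g (p + s *\<^sub>R b)" _ 0 t] by simp
  qed
  obtain C where C: "C > 0" "\<And>z. \<bar>g' z\<bar> \<le> C" using g'.bounded by blast
  have lip: "\<bar>g (p + h *\<^sub>R b) - g p\<bar> \<le> C * \<bar>h\<bar>" for p h
    using field_differentiable_bound[of UNIV "\<lambda>s. g (p + s *\<^sub>R b)" "\<lambda>t. g' (p + t *\<^sub>R b)" C h 0] d' C
    by (simp add: has_field_derivative_at_within)
  have "(\<lambda>n. (conv f g (p + X n *\<^sub>R b) - conv f g p) / X n) \<longlonglongrightarrow> conv f g' p"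
    if X: "\<And>n. X n \<noteq> 0" "X \<longlonglongrightarrow> 0" for X :: "nat \<Rightarrow> real"
  proof -
    obtain K where K: "K \<ge> 0" "\<And>n. \<bar>X n\<bar> \<le> K"
      using convergent_imp_Bseq[OF convergentI[OF X(2)]] by (auto simp: Bseq_def) (meson less_imp_le)
    have "(\<lambda>n. LINT z|lborel. f z * ((g (p + X n *\<^sub>R b - z) - g (p - z)) / X n))
        \<longlonglongrightarrow> (LINT z|lborel. f z * g' (p - z))"
    proof (rule integral_dominated_convergence[where w="\<lambda>z. (M * C) * indicator (cball p (R + K)) z"])
      show "integrable lborel (\<lambda>z. (M * C) * indicator (cball p (R + K)) z :: real)"
        using emeasure_lborel_cball_finite[of p "R + K"]
        by (intro integrable_mult_right integrable_real_indicator) auto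
      have "(\<lambda>n. (g (q + X n *\<^sub>R b) - g q) / X n) \<longlonglongrightarrow> g' q" for q
        using d[of q] X unfolding has_field_derivative_iff tendsto_at_iff_sequentially
        by (auto simp: o_def)
      from this[of "p - z" for z]
      show "AE z in lborel. (\<lambda>n. f z * ((g (p + X n *\<^sub>R b - z) - g (p - z)) / X n)) \<longlonglongrightarrow> f z * g' (p - z)"
        by (intro AE_I2 tendsto_intros) (simp add: algebra_simps)
      show "AE z in lborel. norm (f z * ((g (p + X n *\<^sub>R b - z) - g (p - z)) / X n))
          \<le> M * C * indicator (cball p (R + K)) z" for n
      proof (intro AE_I2)
        fix z :: "real \<times> real"
        show "norm (f z * ((g (p + X n *\<^sub>R b - z) - g (p - z)) / X n)) \<le> M * C * indicator (cball p (R + K)) z"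
        proof (cases "norm (z - p) \<le> R + K")
          case True
          have "\<bar>(g (p - z + X n *\<^sub>R b) - g (p - z)) / X n\<bar> \<le> C"
            using lip[of "p - z" "X n"] X(1)[of n] by (simp add: abs_divide divide_le_eq)
          then have "\<bar>f z\<bar> * \<bar>(g (p - z + X n *\<^sub>R b) - g (p - z)) / X n\<bar> \<le> M * C"
            using M[of z] by (intro mult_mono) auto
          then show ?thesis using True
            by (simp add: abs_mult dist_norm norm_minus_commute diff_add_eq)
        next
          case False
          then have "R < norm (p - z)" using K by (simp add: norm_minus_commute)
          moreover have "R < norm (p + X n *\<^sub>R b - z)"
            using norm_triangle_ineq2[of "p - z" "- X n *\<^sub>R b"] False K(2)[of n] b
            by (simp add: norm_minus_commute algebra_simps)
          ultimately show ?thesis using g.supp False by (simp add: dist_norm norm_minus_commute)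
        qed
      qed
    qed measurable
    moreover have "(conv f g (p + X n *\<^sub>R b) - conv f g p) / X n
        = (LINT z|lborel. f z * ((g (p + X n *\<^sub>R b - z) - g (p - z)) / X n))" for n
    proof -
      have "conv f g (p + X n *\<^sub>R b) - conv f g p
          = (LINT z|lborel. f z * g (p + X n *\<^sub>R b - z) - f z * g (p - z))"
        unfolding conv_def using g.integrable_conv[OF f M] by simp
      then show ?thesis by (simp add: right_diff_distrib[symmetric] flip: integral_divide_zero)
    qed
    ultimately show ?thesis unfolding conv_def[of f g' p] by presburger
  qed
  then show ?thesis
    unfolding has_field_derivative_iff tendsto_at_iff_sequentially by (auto simp: o_def)
qed

text \<open>Both partials become directional derivatives at 0, so one differentiation lemma serves
  time and space.\<close>

lemma partial_derivative_iff:
  "((\<lambda>s. f (s, x)) has_real_derivative D) (at t) \<longleftrightarrow>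
     ((\<lambda>s. f ((t, x) + s *\<^sub>R (1, 0))) has_real_derivative D) (at 0)"
  "((\<lambda>y. f (t, y)) has_real_derivative D) (at x) \<longleftrightarrow>
     ((\<lambda>s. f ((t, x) + s *\<^sub>R (0, 1))) has_real_derivative D) (at 0)"
  using DERIV_shift[of "\<lambda>s. f (s, x)" D 0 t] DERIV_shift[of "\<lambda>y. f (t, y)" D 0 x]
  by (simp_all add: add.commute)

text \<open>The free constant and the free bump parameters make this set closed under both partial
  derivatives and under negation, which is the closure that \<open>smooth2_coinduct\<close> asks
  for.\<close>

definition kernels :: "real \<Rightarrow> real \<Rightarrow> (real \<times> real \<Rightarrow> real) set" where
  "kernels d e = {\<lambda>z. c * bump p n (fst z / d) * bump p' n' (snd z / e) | c p n p' n'. True}"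

lemma kernelsI: "(\<lambda>z. c * bump p n (fst z / d) * bump p' n' (snd z / e)) \<in> kernels d e"
  unfolding kernels_def by blast

lemma kernels_compact_kernel:
  assumes "g \<in> kernels d e" "d > 0" "e > 0"
  shows "compact_kernel g (d + e)"
proof
  obtain c p n p' n' where g: "g = (\<lambda>z. c * bump p n (fst z / d) * bump p' n' (snd z / e))"
    using assms(1) by (auto simp: kernels_def)
  show "continuous_on UNIV g" unfolding g using assms by (intro continuous_intros) auto
  fix z :: "real \<times> real" assume "d + e < norm z"
  then have "d + e < \<bar>fst z\<bar> + \<bar>snd z\<bar>"
    using norm_Pair_le[of "fst z" "snd z"] by simp
  then have "d \<le> \<bar>fst z\<bar> \<or> e \<le> \<bar>snd z\<bar>" by linarith
  then show "g z = 0" using assms by (auto simp: g bump_eq_0)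
qed

lemma kernels_eq_0:
  assumes "g \<in> kernels d e" "d > 0" "e > 0" "d \<le> \<bar>fst z\<bar> \<or> e \<le> \<bar>snd z\<bar>"
  shows "g z = 0"
  using assms by (auto simp: kernels_def bump_eq_0)

lemma kernels_uminus: "g \<in> kernels d e \<Longrightarrow> (\<lambda>z. - g z) \<in> kernels d e"
proof -
  assume "g \<in> kernels d e"
  then obtain c p n p' n' where "g = (\<lambda>z. c * bump p n (fst z / d) * bump p' n' (snd z / e))"
    by (auto simp: kernels_def)
  then show ?thesis using kernelsI[of "- c" p n d p' n' e] by simp
qed

lemma bump_scaled_has_derivative:
  "d > 0 \<Longrightarrow> \<exists>p' n'. \<forall>x. ((\<lambda>x. bump p n (x / d)) has_real_derivative (1 / d) * bump p' n' (x / d)) (at x)"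
proof -
  assume d: "d > 0"
  obtain p' n' where p': "\<And>x. (bump p n has_real_derivative bump p' n' x) (at x)"
    using bump_has_derivative by blast
  have "((\<lambda>x. bump p n (x / d)) has_real_derivative (1 / d) * bump p' n' (x / d)) (at x)" for x
    by (rule DERIV_cong[OF DERIV_chain2[OF p' DERIV_cdivide[OF DERIV_ident]]]) simp
  then show ?thesis by blast
qed

lemma kernels_dt:
  assumes "g \<in> kernels d e" "d > 0" "e > 0"
  shows "\<exists>g'\<in>kernels d e. \<forall>t x. ((\<lambda>s. g (s, x)) has_real_derivative g' (t, x)) (at t)"
proof -
  obtain c p n p' n' where g: "g = (\<lambda>z. c * bump p n (fst z / d) * bump p' n' (snd z / e))"
    using assms(1) by (auto simp: kernels_def)
  obtain p2 n2 where p2: "\<And>x. ((\<lambda>x. bump p n (x / d)) has_real_derivative (1 / d) * bump p2 n2 (x / d)) (at x)"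
    using bump_scaled_has_derivative[OF assms(2)] by blast
  have "((\<lambda>s. g (s, x)) has_real_derivative (c / d) * bump p2 n2 (t / d) * bump p' n' (x / e)) (at t)" for t x
    unfolding g fst_conv snd_conv by (rule derivative_eq_intros p2 refl | simp)+
  then show ?thesis
    by (intro bexI[of _ "\<lambda>z. (c / d) * bump p2 n2 (fst z / d) * bump p' n' (snd z / e)"])
       (simp, rule kernelsI)
qed

lemma kernels_dx:
  assumes "g \<in> kernels d e" "d > 0" "e > 0"
  shows "\<exists>g'\<in>kernels d e. \<forall>t x. ((\<lambda>y. g (t, y)) has_real_derivative g' (t, x)) (at x)"
proof -
  obtain c p n p' n' where g: "g = (\<lambda>z. c * bump p n (fst z / d) * bump p' n' (snd z / e))"
    using assms(1) by (auto simp: kernels_def)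
  obtain p2 n2 where p2: "\<And>x. ((\<lambda>x. bump p' n' (x / e)) has_real_derivative (1 / e) * bump p2 n2 (x / e)) (at x)"
    using bump_scaled_has_derivative[OF assms(3)] by blast
  have "((\<lambda>y. g (t, y)) has_real_derivative (c / e) * bump p n (t / d) * bump p2 n2 (x / e)) (at x)" for t x
    unfolding g fst_conv snd_conv by (rule derivative_eq_intros p2 refl | simp)+
  then show ?thesis
    by (intro bexI[of _ "\<lambda>z. (c / e) * bump p n (fst z / d) * bump p2 n2 (snd z / e)"])
       (simp, rule kernelsI)
qed

lemma conv_kernels_partial:
  assumes "g \<in> kernels d e" "g' \<in> kernels d e" "d > 0" "e > 0"
    and f [measurable]: "f \<in> borel_measurable borel" and M: "\<And>z. \<bar>f z\<bar> \<le> M"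
  shows "(\<And>t x. ((\<lambda>s. g (s, x)) has_real_derivative g' (t, x)) (at t)) \<Longrightarrow>
      ((\<lambda>s. conv f g (s, x)) has_real_derivative conv f g' (t, x)) (at t)"
    and "(\<And>t x. ((\<lambda>y. g (t, y)) has_real_derivative g' (t, x)) (at x)) \<Longrightarrow>
      ((\<lambda>y. conv f g (t, y)) has_real_derivative conv f g' (t, x)) (at x)"
proof -
  note D = conv_has_partial_derivative[OF kernels_compact_kernel[OF assms(1,3,4)]
        kernels_compact_kernel[OF assms(2,3,4)] _ _ f M]
  show "((\<lambda>s. conv f g (s, x)) has_real_derivative conv f g' (t, x)) (at t)"
    if "\<And>t x. ((\<lambda>s. g (s, x)) has_real_derivative g' (t, x)) (at t)"
  proof -
    have "((\<lambda>s. g (p + s *\<^sub>R (1, 0))) has_real_derivative g' p) (at 0)" for p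
      using that[of "snd p" "fst p"] partial_derivative_iff(1)[of g "snd p" "g' p" "fst p"] by simp
    from D[OF this, of "(t, x)"] show ?thesis unfolding partial_derivative_iff by simp
  qed
  show "((\<lambda>y. conv f g (t, y)) has_real_derivative conv f g' (t, x)) (at x)"
    if "\<And>t x. ((\<lambda>y. g (t, y)) has_real_derivative g' (t, x)) (at x)"
  proof -
    have "((\<lambda>s. g (p + s *\<^sub>R (0, 1))) has_real_derivative g' p) (at 0)" for p
      using that[of "fst p" "snd p"] partial_derivative_iff(2)[of g "fst p" "g' p" "snd p"] by simp
    from D[OF this, of "(t, x)"] show ?thesis unfolding partial_derivative_iff by simp
  qed
qed

lemma smooth2_conv:
  assumes g: "g \<in> kernels d e" and de: "d > 0" "e > 0"
    and f: "f \<in> borel_measurable borel" "\<And>z. \<bar>f z\<bar> \<le> M"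
  shows "smooth2 (\<lambda>t x. conv f g (t, x))"
proof (rule smooth2_coinduct[where F="{\<lambda>t x. conv f g (t, x) | g. g \<in> kernels d e}"])
  show "(\<lambda>t x. conv f g (t, x)) \<in> {\<lambda>t x. conv f g (t, x) | g. g \<in> kernels d e}"
    using g by blast
next
  fix \<phi> assume "\<phi> \<in> {\<lambda>t x. conv f g (t, x) | g. g \<in> kernels d e}"
  then obtain g where \<phi>: "\<phi> = (\<lambda>t x. conv f g (t, x))" and g: "g \<in> kernels d e" by blast
  show "continuous_on UNIV (\<lambda>p. \<phi> (fst p) (snd p))"
    using compact_kernel.continuous_on_conv[OF kernels_compact_kernel[OF g de] f] by (simp add: \<phi>)
  obtain g' where g': "g' \<in> kernels d e" "\<And>t x. ((\<lambda>s. g (s, x)) has_real_derivative g' (t, x)) (at t)"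
    using kernels_dt[OF g de] by blast
  show "\<exists>\<psi>\<in>{\<lambda>t x. conv f g (t, x) | g. g \<in> kernels d e}.
      \<forall>t x. ((\<lambda>s. \<phi> s x) has_real_derivative \<psi> t x) (at t)"
    using conv_kernels_partial(1)[OF g g'(1) de f g'(2)] g'(1) by (auto simp: \<phi>)
  obtain g' where g': "g' \<in> kernels d e" "\<And>t x. ((\<lambda>y. g (t, y)) has_real_derivative g' (t, x)) (at x)"
    using kernels_dx[OF g de] by blast
  show "\<exists>\<psi>\<in>{\<lambda>t x. conv f g (t, x) | g. g \<in> kernels d e}.
      \<forall>t x. ((\<lambda>y. \<phi> t y) has_real_derivative \<psi> t x) (at x)"
    using conv_kernels_partial(2)[OF g g'(1) de f g'(2)] g'(1) by (auto simp: \<phi>)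
qed

text \<open>Testing the weak equation with this function of \<open>(s, y)\<close> produces the
  mollified equation at \<open>(t, x)\<close>. Reflection changes the sign of each derivative, and
  the class absorbs it by \<open>kernels_uminus\<close>.\<close>

lemma smooth2_reflected_kernel:
  assumes g: "g \<in> kernels d e" and de: "d > 0" "e > 0"
  shows "smooth2 (\<lambda>s y. g (t - s, x - y))"
proof (rule smooth2_coinduct[where F="{\<lambda>s y. g (t - s, x - y) | g. g \<in> kernels d e}"])
  show "(\<lambda>s y. g (t - s, x - y)) \<in> {\<lambda>s y. g (t - s, x - y) | g. g \<in> kernels d e}"
    using g by blast
next
  fix \<phi> assume "\<phi> \<in> {\<lambda>s y. g (t - s, x - y) | g. g \<in> kernels d e}"
  then obtain g where \<phi>: "\<phi> = (\<lambda>s y. g (t - s, x - y))" and g: "g \<in> kernels d e" by blast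
  have "continuous_on UNIV g"
    using kernels_compact_kernel[OF g de] by (simp add: compact_kernel_def)
  then show "continuous_on UNIV (\<lambda>p. \<phi> (fst p) (snd p))"
    unfolding \<phi> by (rule continuous_on_compose2) (auto intro!: continuous_intros)
  have minus: "((\<lambda>s. F (c - s)) has_real_derivative - D) (at r)"
    if "(F has_real_derivative D) (at (c - r))" for F c D r
    by (rule DERIV_cong[OF DERIV_chain2[where f=F and g="\<lambda>s. c - s", OF that]]) (auto intro!: derivative_eq_intros)
  obtain g' where g': "g' \<in> kernels d e" "\<And>t x. ((\<lambda>s. g (s, x)) has_real_derivative g' (t, x)) (at t)"
    using kernels_dt[OF g de] by blast
  have "((\<lambda>s. g (t - s, x - y)) has_real_derivative - g' (t - r, x - y)) (at r)" for r y
    using minus[OF g'(2)] .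
  then show "\<exists>\<psi>\<in>{\<lambda>s y. g (t - s, x - y) | g. g \<in> kernels d e}.
      \<forall>t x. ((\<lambda>s. \<phi> s x) has_real_derivative \<psi> t x) (at t)"
    using kernels_uminus[OF g'(1)] unfolding \<phi> by (intro bexI[of _ "\<lambda>s y. - g' (t - s, x - y)"]) auto
  obtain g' where g': "g' \<in> kernels d e" "\<And>t x. ((\<lambda>y. g (t, y)) has_real_derivative g' (t, x)) (at x)"
    using kernels_dx[OF g de] by blast
  have "((\<lambda>y. g (t - r, x - y)) has_real_derivative - g' (t - r, x - y)) (at y)" for r y
    using minus[OF g'(2)] .
  then show "\<exists>\<psi>\<in>{\<lambda>s y. g (t - s, x - y) | g. g \<in> kernels d e}.
      \<forall>t x. ((\<lambda>y. \<phi> t y) has_real_derivative \<psi> t x) (at x)"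
    using kernels_uminus[OF g'(1)] unfolding \<phi> by (intro bexI[of _ "\<lambda>s y. - g' (t - s, x - y)"]) auto
qed

section \<open>Mollifiers\<close>

lemma distr_lborel_reflect: "distr lborel borel (\<lambda>z. p - z) = (lborel :: 'a::euclidean_space measure)"
  using lborel_affine[of "-1" p] by (simp add: density_1)

lemma distr_lborel_shift: "distr lborel borel (\<lambda>z. z - p) = (lborel :: 'a::euclidean_space measure)"
  using lborel_affine[of 1 "- p"] by (simp add: density_1)

lemma conv_eq_reflect:
  assumes [measurable]: "f \<in> borel_measurable borel" "g \<in> borel_measurable borel"
  shows "conv f g p = (LINT z|lborel. f (p - z) * g z)"
proof -
  have "conv f g p = (LINT z|distr lborel borel (\<lambda>z. p - z). f z * g (p - z))"
    by (simp add: distr_lborel_reflect conv_def)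
  also have "\<dots> = (LINT z|lborel. f (p - z) * g z)"
    by (subst integral_distr) auto
  finally show ?thesis .
qed

section \<open>Integrals of partial derivatives of compactly supported functions\<close>

lemma compact_support_partial_eq_0:
  assumes g: "\<And>z. R < norm z \<Longrightarrow> g z = 0" and z: "R < norm z"
    and d: "((\<lambda>s. g (z + s *\<^sub>R b)) has_real_derivative D) (at 0)"
  shows "D = 0"
proof -
  have "((\<lambda>s::real. norm (z + s *\<^sub>R b)) \<longlongrightarrow> norm (z + 0 *\<^sub>R b)) (nhds 0)"
    by (intro tendsto_intros filterlim_ident)
  from order_tendstoD(1)[OF this, of R] z
  have "eventually (\<lambda>s. R < norm (z + s *\<^sub>R b)) (nhds 0)" by simp
  then have "eventually (\<lambda>s. g (z + s *\<^sub>R b) = 0) (nhds 0)"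
    by (rule eventually_mono) (rule g)
  then have "((\<lambda>s. 0) has_real_derivative D) (at 0)"
    using d by (subst (asm) DERIV_cong_ev[OF refl _ refl]) auto
  then show ?thesis using DERIV_unique DERIV_const by blast
qed

lemma line_integral_partial_eq_0:
  fixes f f' :: "real \<Rightarrow> real"
  assumes "\<And>x. (f has_real_derivative f' x) (at x)" "continuous_on UNIV f'"
    and "\<And>x. R < \<bar>x\<bar> \<Longrightarrow> f x = 0"
  shows "(LINT x|lborel. f' x) = 0"
proof -
  \<comment> \<open>The absolute value allows for negative \<open>R\<close>; the added 1 puts both
    endpoints strictly where \<open>f\<close> vanishes.\<close>
  let ?S = "\<bar>R\<bar> + 1"
  have z: "f' x = 0" if "\<bar>R\<bar> < \<bar>x\<bar>" for x
  proof -
    have "eventually (\<lambda>y. \<bar>R\<bar> < \<bar>y\<bar>) (nhds x)"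
      using that by (intro order_tendstoD(1)[of _ "\<bar>x\<bar>"] tendsto_intros filterlim_ident)
    then have "eventually (\<lambda>y. f y = 0) (nhds x)"
      by (rule eventually_mono) (use assms(3) in auto)
    then have "((\<lambda>_. 0) has_real_derivative f' x) (at x)"
      using assms(1)[of x] by (subst (asm) DERIV_cong_ev[OF refl _ refl]) auto
    then show ?thesis using DERIV_unique DERIV_const by blast
  qed
  have "(LINT x|lborel. f' x) = (LINT x|lborel. f' x * indicator {- ?S .. ?S} x)"
    by (intro Bochner_Integration.integral_cong) (auto simp: indicator_def intro!: z)
  also have "\<dots> = f ?S - f (- ?S)"
    using assms(1,2) by (intro integral_FTC_Icc_real)
      (auto simp: continuous_on_eq_continuous_at)
  also have "\<dots> = 0" by (simp add: assms(3))
  finally show ?thesis .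
qed

text \<open>Fubini with the inner integral taken along the direction of differentiation, where the
  fundamental theorem gives 0. Applied to products, this is the integration by parts of the whole
  proof; applied to \<open>k\<close>, it gives the kernel derivative mean zero.\<close>

lemma integral_partial_eq_0:
  fixes g g' :: "real \<times> real \<Rightarrow> real"
  assumes g: "\<And>z. R < norm z \<Longrightarrow> g z = 0" and g': "continuous_on UNIV g'"
  shows "(\<And>t x. ((\<lambda>s. g (s, x)) has_real_derivative g' (t, x)) (at t)) \<Longrightarrow>
      integrable lborel g' \<and> (LINT z|lborel. g' z) = 0" (is "PROP ?T \<Longrightarrow> _")
    and "(\<And>t x. ((\<lambda>y. g (t, y)) has_real_derivative g' (t, x)) (at x)) \<Longrightarrow>
      integrable lborel g' \<and> (LINT z|lborel. g' z) = 0" (is "PROP ?X \<Longrightarrow> _")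
proof -
  have abs_le: "\<bar>t\<bar> \<le> norm (t, x)" "\<bar>x\<bar> \<le> norm (t, x)" for t x :: real
    using norm_fst_le[of t x] norm_snd_le[of x t] by simp_all
  have c1: "continuous_on UNIV (\<lambda>t. g' (t, x))" "continuous_on UNIV (\<lambda>x. g' (t, x))" for t x
    by (rule continuous_on_compose2[OF g'], auto intro!: continuous_intros)+
  {
    assume T: "PROP ?T"
    have "g' z = 0" if "R < norm z" for z
      using compact_support_partial_eq_0[of R g z "(1, 0)" "g' z", OF g that]
        T[of "snd z" "fst z"] partial_derivative_iff(1)[of g "snd z" "g' z" "fst z"] by simp
    then have int: "integrable lborel g'"
      using g' by (intro compact_kernel.integrable[of _ R] compact_kernel.intro)
    then have "integrable (lborel \<Otimes>\<^sub>M lborel) (\<lambda>(x, y). g' (x, y))"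
      by (simp add: lborel_prod)
    from lborel_pair.integral_snd[OF this]
    have "(LINT z|lborel. g' z) = (LINT y|lborel. LINT x|lborel. g' (x, y))"
      by (simp add: lborel_prod)
    moreover have "(LINT x|lborel. g' (x, y)) = 0" for y
      by (rule line_integral_partial_eq_0[OF T c1(1), of R])
        (use g abs_le(1) order_less_le_trans in blast)
    ultimately show "integrable lborel g' \<and> (LINT z|lborel. g' z) = 0" using int by simp
  }
  {
    assume X: "PROP ?X"
    have "g' z = 0" if "R < norm z" for z
      using compact_support_partial_eq_0[of R g z "(0, 1)" "g' z", OF g that]
        X[of "fst z" "snd z"] partial_derivative_iff(2)[of g "fst z" "g' z" "snd z"] by simp
    then have int: "integrable lborel g'"
      using g' by (intro compact_kernel.integrable[of _ R] compact_kernel.intro)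
    then have "integrable (lborel \<Otimes>\<^sub>M lborel) (\<lambda>(x, y). g' (x, y))"
      by (simp add: lborel_prod)
    from lborel_pair.integral_fst[OF this]
    have "(LINT z|lborel. g' z) = (LINT x|lborel. LINT y|lborel. g' (x, y))"
      by (simp add: lborel_prod)
    moreover have "(LINT y|lborel. g' (x, y)) = 0" for x
      by (rule line_integral_partial_eq_0[OF X c1(2), of R])
        (use g abs_le(2) order_less_le_trans in blast)
    ultimately show "integrable lborel g' \<and> (LINT z|lborel. g' z) = 0" using int by simp
  }
qed

text \<open>The factor \<open>4 * d * e\<close> is the area of the box with half sides
  \<open>d\<close> and \<open>e\<close>. Hence \<open>4 * d * e * k\<close> is the density of the
  kernel with respect to the uniform probability on that box: it is bounded by \<open>C\<close>, and
  one x-derivative costs \<open>1 / e\<close>. Both bounds will be used with a \<open>C\<close>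
  independent of the scales.\<close>

locale mollifier =
  fixes C d e :: real and k kt kx :: "real \<times> real \<Rightarrow> real"
  assumes pos: "C > 0" "d > 0" "e > 0"
    and kernels: "k \<in> kernels d e" "kt \<in> kernels d e" "kx \<in> kernels d e"
    and kt: "\<And>t x. ((\<lambda>s. k (s, x)) has_real_derivative kt (t, x)) (at t)"
    and kx: "\<And>t x. ((\<lambda>y. k (t, y)) has_real_derivative kx (t, x)) (at x)"
    and k_nonneg: "\<And>z. 0 \<le> k z"
    and k_le: "\<And>z. 4 * d * e * k z \<le> C"
    and kx_le: "\<And>z. 4 * d * e * \<bar>kx z\<bar> \<le> C / e"
    and integral_k: "(LINT z|lborel. k z) = 1"
    and integral_kx: "(LINT z|lborel. kx z) = 0"

lemma bump_1_0:
  "0 \<le> bump 1 0 x" "bump 1 0 x \<le> 1" "\<bar>x\<bar> \<le> 1/2 \<Longrightarrow> exp (- 4 / 3) \<le> bump 1 0 x"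
proof -
  show "0 \<le> bump 1 0 x" "bump 1 0 x \<le> 1" by (simp_all add: bump_def flat_def)
  assume "\<bar>x\<bar> \<le> 1/2"
  then have "x\<^sup>2 \<le> (1/2)\<^sup>2" by (metis abs_ge_zero power2_abs power_mono)
  then have "1 - x\<^sup>2 \<ge> 3 / 4" by (simp add: power2_eq_square)
  then show "exp (- 4 / 3) \<le> bump 1 0 x" by (simp add: bump_def flat_def field_simps)
qed

lemma mollifier_exists: "\<exists>C>0. \<forall>d>0. \<forall>e>0. \<exists>k kt kx. mollifier C d e k kt kx"
proof -
  obtain p' n' where p': "\<And>x. (bump 1 0 has_real_derivative bump p' n' x) (at x)"
    using bump_has_derivative by blast
  obtain C1 where C1: "C1 > 0" "\<And>x. \<bar>bump p' n' x\<bar> \<le> C1" using bump_bounded by blast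
  \<comment> \<open>\<open>exp (8 / 3)\<close> bounds \<open>d * e\<close> over the mass of the raw
    kernel, 4 restores the area of the box, and \<open>max 1 C1\<close> covers both the bump and its
    derivative.\<close>
  define C where "C = 4 * (exp (8 / 3) * max 1 C1)"
  have "\<exists>k kt kx. mollifier C d e k kt kx" if de: "d > 0" "e > 0" for d e
  proof -
    define k0 where "k0 z = 1 * bump 1 0 (fst z / d) * bump 1 0 (snd z / e)" for z :: "real \<times> real"
    have k0: "k0 \<in> kernels d e" unfolding k0_def[abs_def] by (rule kernelsI)
    interpret k0: compact_kernel k0 "d + e" using kernels_compact_kernel[OF k0 de] .
    define N where "N = (LINT z|lborel. k0 z)"
    \<comment> \<open>On the concentric box with half the side lengths, of area
      \<open>d * e\<close>, each of the two factors is at least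
      \<open>exp (- 4 / 3)\<close>.\<close>
    have N: "exp (- 8 / 3) * (d * e) \<le> N"
    proof -
      let ?b = "cbox (- d / 2, - e / 2) (d / 2, e / 2)"
      have "exp (- 8 / 3) * (d * e) = (LINT z|lborel. exp (- 8 / 3) * indicator ?b z)"
        using de by (simp add: content_Pair)
      also have "\<dots> \<le> N" unfolding N_def
      proof (rule integral_mono)
        show "integrable lborel (\<lambda>z. exp (- 8 / 3) * indicat_real ?b z)"
          using emeasure_lborel_cbox_finite[of "(- d / 2, - e / 2)" "(d / 2, e / 2)"]
          by (intro integrable_mult_right integrable_real_indicator) auto
        show "integrable lborel k0" by (rule k0.integrable)
        fix z :: "real \<times> real"
        show "exp (- 8 / 3) * indicat_real ?b z \<le> k0 z"
        proof (cases "z \<in> ?b")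
          case True
          then have "\<bar>fst z / d\<bar> \<le> 1 / 2" "\<bar>snd z / e\<bar> \<le> 1 / 2"
            using de by (cases z; auto simp: cbox_Pair_eq abs_le_iff field_simps)+
          then have "exp (- 4 / 3) * exp (- 4 / 3) \<le> bump 1 0 (fst z / d) * bump 1 0 (snd z / e)"
            by (intro mult_mono bump_1_0) auto
          then show ?thesis using True by (simp add: k0_def exp_add[symmetric])
        qed (simp add: k0_def bump_1_0)
      qed
      finally show ?thesis .
    qed
    have Npos: "N > 0" using N de by (smt (verit) exp_gt_zero mult_pos_pos)
    have Ninv: "d * e / N \<le> exp (8 / 3)"
    proof -
      have "d * e = exp (8 / 3) * (exp (- 8 / 3) * (d * e))" by (simp add: exp_minus)
      also have "\<dots> \<le> exp (8 / 3) * N" using N by (intro mult_left_mono) auto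
      finally show ?thesis using Npos by (simp add: divide_le_eq)
    qed
    define k where "k z = (1 / N) * bump 1 0 (fst z / d) * bump 1 0 (snd z / e)" for z :: "real \<times> real"
    have k_k0: "k z = k0 z / N" for z by (simp add: k_def k0_def)
    have k: "k \<in> kernels d e" unfolding k_def[abs_def] by (rule kernelsI)
    define kx where "kx z = (1 / (N * e)) * bump 1 0 (fst z / d) * bump p' n' (snd z / e)" for z :: "real \<times> real"
    have kx: "kx \<in> kernels d e" unfolding kx_def[abs_def] by (rule kernelsI)
    obtain kt where kt: "kt \<in> kernels d e" "\<And>t x. ((\<lambda>s. k (s, x)) has_real_derivative kt (t, x)) (at t)"
      using kernels_dt[OF k de] by blast
    have kx_deriv: "((\<lambda>y. k (t, y)) has_real_derivative kx (t, x)) (at x)" for t x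
    proof -
      have "((\<lambda>x. bump 1 0 (x / e)) has_real_derivative bump p' n' (x / e) * (1 / e)) (at x)"
        by (rule DERIV_chain2[OF p' DERIV_cdivide[OF DERIV_ident]])
      from DERIV_cmult[OF this, of "(1 / N) * bump 1 0 (t / d)"]
      show ?thesis by (simp add: k_def kx_def mult_ac)
    qed
    have "mollifier C d e k kt kx"
    proof
      show "C > 0" unfolding C_def by (intro mult_pos_pos) auto
      show "4 * d * e * k z \<le> C" for z
      proof -
        have "k0 z \<le> 1" unfolding k0_def using bump_1_0 by (simp add: mult_le_one)
        then have "4 * d * e * k z \<le> 4 * (d * e / N)"
          using de Npos by (simp add: k_k0 field_simps mult_left_le)
        also have "\<dots> \<le> 4 * (max 1 C1 * exp (8 / 3))"
        proof -
          have "1 * exp (8 / 3) \<le> max 1 C1 * exp (8 / 3)" by (intro mult_right_mono) auto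
          then show ?thesis using Ninv by linarith
        qed
        finally show ?thesis by (simp add: C_def mult_ac)
      qed
      show "4 * d * e * \<bar>kx z\<bar> \<le> C / e" for z
      proof -
        have "\<bar>bump 1 0 (fst z / d) * bump p' n' (snd z / e)\<bar> \<le> 1 * C1"
          unfolding abs_mult using bump_1_0 C1 by (intro mult_mono) auto
        then have "\<bar>bump 1 0 (fst z / d) * bump p' n' (snd z / e)\<bar> \<le> max 1 C1" by simp
        then have "(d * e / N) * \<bar>bump 1 0 (fst z / d) * bump p' n' (snd z / e)\<bar> \<le> exp (8 / 3) * max 1 C1"
          using Ninv de Npos by (intro mult_mono) auto
        moreover have "e * (4 * d * e * \<bar>kx z\<bar>) = 4 * ((d * e / N) * \<bar>bump 1 0 (fst z / d) * bump p' n' (snd z / e)\<bar>)"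
          using de Npos by (simp add: kx_def abs_mult field_simps)
        ultimately have "e * (4 * d * e * \<bar>kx z\<bar>) \<le> C" unfolding C_def by linarith
        then show ?thesis using de by (simp add: le_divide_eq mult_ac)
      qed
      show "0 \<le> k z" for z using Npos by (simp add: k_def bump_1_0)
      show "(LINT z|lborel. k z) = 1" using Npos by (simp add: k_k0 N_def[symmetric])
      interpret kx: compact_kernel kx "d + e" using kernels_compact_kernel[OF kx de] .
      interpret k: compact_kernel k "d + e" using kernels_compact_kernel[OF k de] .
      show "(LINT z|lborel. kx z) = 0"
        using integral_partial_eq_0(2)[OF k.supp kx.cont kx_deriv] by blast
    qed (fact de k kx kt kx_deriv)+
    then show ?thesis by blast
  qed
  moreover have "C > 0" unfolding C_def by (intro mult_pos_pos) auto
  ultimately show ?thesis by blast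
qed

section \<open>The regularity cost and the Jensen gap\<close>

lemma abs_integral_le:
  fixes f g :: "'a \<Rightarrow> real"
  assumes "integrable M f" "integrable M g" "\<And>x. \<bar>f x\<bar> \<le> g x"
  shows "\<bar>LINT x|M. f x\<bar> \<le> (LINT x|M. g x)"
  using assms by (intro order_trans[OF integral_abs_bound integral_mono]) auto

text \<open>The primitive \<open>B\<close> is a parameter because it gives a closed form for the
  cost: \<open>Delta a x y\<close> is twice the error of the trapezoidal rule for \<open>a\<close>
  between \<open>x\<close> and \<open>y\<close>.\<close>

locale convex_flux =
  fixes a B :: "real \<Rightarrow> real"
  assumes a: "\<And>x. (a has_real_derivative deriv a x) (at x)"
    and cont_deriv: "continuous_on UNIV (deriv a)"
    and mono_deriv: "mono (deriv a)"
    and B: "\<And>x. (B has_real_derivative a x) (at x)"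
begin

lemma cont_a: "continuous_on UNIV a"
  using a by (meson DERIV_isCont continuous_at_imp_continuous_on)

lemma cont_B: "continuous_on UNIV B"
  using B by (meson DERIV_isCont continuous_at_imp_continuous_on)

lemma tangent: "a x + deriv a x * (y - x) \<le> a y"
proof -
  consider "x < y" | "y < x" | "x = y" by linarith
  then show ?thesis
  proof cases
    case 1
    obtain z where z: "x < z" "a y - a x = (y - x) * deriv a z"
      using MVT2[OF 1, of a "deriv a"] a by auto
    then show ?thesis
      using mult_left_mono[OF monoD[OF mono_deriv, of x z], of "y - x"] 1 by (simp add: algebra_simps)
  next
    case 2
    obtain z where z: "z < x" "a x - a y = (x - y) * deriv a z"
      using MVT2[OF 2, of a "deriv a"] a by auto
    then show ?thesis
      using mult_left_mono[OF monoD[OF mono_deriv, of z x], of "x - y"] 2 by (simp add: algebra_simps)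
  qed simp
qed

text \<open>As a function of the right endpoint \<open>s\<close>, the excess vanishes at
  \<open>x\<close>, and its derivative is the height of \<open>a x\<close> above the tangent at
  \<open>s\<close>.\<close>

lemma trapezoid:
  assumes "x \<le> y"
  shows "2 * (B y - B x) \<le> (y - x) * (a x + a y)"
proof -
  let ?h = "\<lambda>s. (s - x) * (a x + a s) - 2 * (B s - B x)"
  have "?h x \<le> ?h y"
  proof (rule DERIV_nonneg_imp_nondecreasing[OF assms])
    fix s assume "x \<le> s"
    have "(?h has_real_derivative (a x + a s) + (s - x) * deriv a s - 2 * a s) (at s)"
      by (auto intro!: derivative_eq_intros a B simp: algebra_simps)
    moreover have "0 \<le> (a x + a s) + (s - x) * deriv a s - 2 * a s"
      using tangent[of s x] by (simp add: algebra_simps)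
    ultimately show "\<exists>D. (?h has_real_derivative D) (at s) \<and> 0 \<le> D" by blast
  qed
  then show ?thesis by simp
qed

lemma Delta_commute: "Delta a x y = Delta a y x"
  unfolding Delta_def
  by (subst interval_integral_endpoints_reverse, subst (2) interval_integral_endpoints_reverse)
    (simp add: interval_lebesgue_integral_uminus)

lemma Delta_le_eq:
  assumes xy: "x \<le> y"
  shows "Delta a x y = (a x + a y) * (y - x) - 2 * (B y - B x)"
proof -
  \<comment> \<open>Splitting at \<open>v = w\<close> resolves the absolute value by monotonicity of
    \<open>deriv a\<close>; each piece has the explicit primitive \<open>deriv a w * v - a v\<close>
    up to sign.\<close>
  have inner: "(LBINT v=x..y. \<bar>deriv a v - deriv a w\<bar>)
      = (2 * w - x - y) * deriv a w - 2 * a w + (a x + a y)" if w: "x \<le> w" "w \<le> y" for w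
  proof -
    have "((\<lambda>v. \<bar>deriv a v - deriv a w\<bar>) has_integral
        (deriv a w * w - a w) - (deriv a w * x - a x)) {x..w}"
    proof (rule has_integral_eq)
      show "((\<lambda>v. deriv a w - deriv a v) has_integral (deriv a w * w - a w) - (deriv a w * x - a x)) {x..w}"
        using w by (intro fundamental_theorem_of_calculus)
          (auto intro!: derivative_eq_intros a[THEN has_field_derivative_at_within]
            simp: has_real_derivative_iff_has_vector_derivative[symmetric])
      show "deriv a w - deriv a v = \<bar>deriv a v - deriv a w\<bar>" if "v \<in> {x..w}" for v
        using monoD[OF mono_deriv, of v w] that by simp
    qed
    moreover have "((\<lambda>v. \<bar>deriv a v - deriv a w\<bar>) has_integral
        (a y - deriv a w * y) - (a w - deriv a w * w)) {w..y}"
    proof (rule has_integral_eq)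
      show "((\<lambda>v. deriv a v - deriv a w) has_integral (a y - deriv a w * y) - (a w - deriv a w * w)) {w..y}"
        using w by (intro fundamental_theorem_of_calculus)
          (auto intro!: derivative_eq_intros a[THEN has_field_derivative_at_within]
            simp: has_real_derivative_iff_has_vector_derivative[symmetric])
      show "deriv a v - deriv a w = \<bar>deriv a v - deriv a w\<bar>" if "v \<in> {w..y}" for v
        using monoD[OF mono_deriv, of w v] that by simp
    qed
    ultimately have "((\<lambda>v. \<bar>deriv a v - deriv a w\<bar>) has_integral
        (deriv a w * w - a w) - (deriv a w * x - a x)
        + ((a y - deriv a w * y) - (a w - deriv a w * w))) {x..y}"
      using w by (intro has_integral_combine[of x w y])
    moreover have "set_integrable lborel {x..y} (\<lambda>v. \<bar>deriv a v - deriv a w\<bar>)"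
      by (intro borel_integrable_atLeastAtMost' continuous_intros continuous_on_subset[OF cont_deriv]) auto
    ultimately show ?thesis
      by (subst interval_integral_eq_integral[OF xy]) (auto simp: algebra_simps dest!: integral_unique)
  qed
  let ?f = "\<lambda>w. (2 * w - x - y) * deriv a w - 2 * a w + (a x + a y)"
  have "(LBINT w=x..y. (LBINT v=x..y. \<bar>deriv a v - deriv a w\<bar>)) = (LBINT w=x..y. ?f w)"
    using xy by (intro interval_integral_cong inner) (auto simp: einterval_iff)
  also have "\<dots> = integral {x..y} ?f"
    by (intro interval_integral_eq_integral[OF xy] borel_integrable_atLeastAtMost' continuous_intros
        continuous_on_subset[OF cont_deriv] continuous_on_subset[OF cont_a]) auto
  also have "(?f has_integral ((2 * y - x - y) * a y - 4 * B y + (a x + a y) * y)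
      - ((2 * x - x - y) * a x - 4 * B x + (a x + a y) * x)) {x..y}"
    using xy by (intro fundamental_theorem_of_calculus)
      (auto intro!: derivative_eq_intros a[THEN has_field_derivative_at_within]
            B[THEN has_field_derivative_at_within]
            simp: has_real_derivative_iff_has_vector_derivative[symmetric] algebra_simps)
  then have "integral {x..y} ?f = ((2 * y - x - y) * a y - 4 * B y + (a x + a y) * y)
      - ((2 * x - x - y) * a x - 4 * B x + (a x + a y) * x)" by (rule integral_unique)
  finally show ?thesis by (simp add: Delta_def algebra_simps)
qed

lemma Delta_nonneg: "0 \<le> Delta a x y"
proof -
  have "0 \<le> Delta a x y" if "x \<le> y" for x y
    using trapezoid[OF that] Delta_le_eq[OF that] by (simp add: mult.commute)
  then show ?thesis by (metis Delta_commute linear)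
qed

text \<open>The expression inside the absolute value is antisymmetric, whereas \<open>Delta\<close>
  is symmetric and nonnegative. In this form continuity and Lipschitz bounds need no case
  distinction on the order of \<open>x\<close> and \<open>y\<close>.\<close>

lemma Delta_eq: "Delta a x y = \<bar>(a x + a y) * (y - x) - 2 * (B y - B x)\<bar>"
proof (cases "x \<le> y")
  case True
  then show ?thesis using Delta_le_eq[OF True] Delta_nonneg[of x y] by simp
next
  case False
  then have "Delta a x y = (a y + a x) * (x - y) - 2 * (B x - B y)"
    using Delta_le_eq[of y x] Delta_commute[of x y] by simp
  then show ?thesis using Delta_nonneg[of x y] by (simp add: abs_if algebra_simps)
qed

lemma Delta_self: "Delta a x x = 0"
  by (simp add: Delta_eq)

lemma continuous_on_Delta: "continuous_on UNIV (\<lambda>p. Delta a (fst p) (snd p))"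
  unfolding Delta_eq
  by (intro continuous_intros continuous_on_compose2[OF cont_a] continuous_on_compose2[OF cont_B]) auto

lemma measurable_Delta [measurable (raw)]:
  assumes "f \<in> borel_measurable M" "g \<in> borel_measurable M"
  shows "(\<lambda>z. Delta a (f z) (g z)) \<in> borel_measurable M"
  using borel_measurable_continuous_on[OF continuous_on_Delta borel_measurable_Pair[OF assms]] by simp

text \<open>The mean value theorem applies to the closed form without the absolute value, and taking
  the absolute value does not increase distances.\<close>

lemma Delta_lipschitz:
  "\<exists>L\<ge>0. \<forall>x\<in>{-R..R}. \<forall>y\<in>{-R..R}. \<forall>y'\<in>{-R..R}. \<bar>Delta a x y - Delta a x y'\<bar> \<le> L * \<bar>y - y'\<bar>"
proof -
  have "compact (a ` {-R..R})" "compact (deriv a ` {-R..R})"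
    by (intro compact_continuous_image continuous_on_subset[OF cont_a] continuous_on_subset[OF cont_deriv]; auto)+
  then obtain K1 K2 where K: "\<forall>x\<in>{-R..R}. \<bar>a x\<bar> \<le> K1" "\<forall>x\<in>{-R..R}. \<bar>deriv a x\<bar> \<le> K2"
    by (metis (no_types, lifting) bounded_iff compact_imp_bounded image_eqI real_norm_def)
  define L where "L = \<bar>4 * K1 + 2 * R * K2\<bar>"
  have "\<bar>Delta a x y - Delta a x y'\<bar> \<le> L * \<bar>y - y'\<bar>"
    if x: "x \<in> {-R..R}" and y: "y \<in> {-R..R}" "y' \<in> {-R..R}" for x y y'
  proof -
    let ?h = "\<lambda>y. (a x + a y) * (y - x) - 2 * (B y - B x)"
    let ?h' = "\<lambda>y. (a x + a y) + deriv a y * (y - x) - 2 * a y"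
    have "\<bar>?h y - ?h y'\<bar> \<le> L * \<bar>y - y'\<bar>"
    proof -
      have "norm (?h y - ?h y') \<le> L * norm (y - y')"
      proof (rule field_differentiable_bound[of "{-R..R}" ?h ?h'])
        show "(?h has_field_derivative ?h' z) (at z within {-R..R})" for z
          by (rule has_field_derivative_at_within) (auto intro!: derivative_eq_intros a B simp: algebra_simps)
        fix z assume z: "z \<in> {-R..R}"
        have "\<bar>deriv a z * (z - x)\<bar> \<le> K2 * (2 * R)"
          unfolding abs_mult using K z x by (intro mult_mono) (auto intro: order_trans[OF abs_ge_zero])
        then show "norm (?h' z) \<le> L"
          using bspec[OF K(1) z] bspec[OF K(1) x] by (simp add: L_def algebra_simps abs_le_iff; linarith)
      qed (use y in auto)
      then show ?thesis by simp
    qed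
    then show ?thesis unfolding Delta_eq by (smt (verit) abs_triangle_ineq3)
  qed
  moreover have "L \<ge> 0" by (simp add: L_def)
  ultimately show ?thesis by blast
qed

text \<open>The Bregman divergence of \<open>a\<close>. If \<open>m\<close> is the mean of
  \<open>X\<close>, the linear term averages to 0 and the mean of \<open>gap m X\<close> is the
  Jensen gap.\<close>

definition gap :: "real \<Rightarrow> real \<Rightarrow> real" where
  "gap m x = a x - a m - deriv a m * (x - m)"

lemma gap_nonneg: "0 \<le> gap m x"
  using tangent[of m x] by (simp add: gap_def)

lemma continuous_on_gap: "continuous_on UNIV (gap m)"
  unfolding gap_def by (intro continuous_intros cont_a)

(* Multiplying out the positive and negative parts of X - m and X' - m reduces the product bound
   to this pointwise inequality, which is the trapezoidal rule on either side of m. *)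
lemma gap_split:
  "max 0 (m - y) * (if m \<le> x then gap m x else 0) + max 0 (x - m) * (if y < m then gap m y else 0)
   + max 0 (m - x) * (if m \<le> y then gap m y else 0) + max 0 (y - m) * (if x < m then gap m x else 0)
   \<le> Delta a x y"
proof -
  have *: "(m - y) * gap m x + (x - m) * gap m y \<le> Delta a y x" if "y \<le> m" "m \<le> x" for x y
    using trapezoid[OF that(1)] trapezoid[OF that(2)] Delta_le_eq[of y x] that
    by (simp add: gap_def algebra_simps)
  consider "m \<le> x" "m \<le> y" | "x < m" "y < m" | "m \<le> x" "y < m" | "x < m" "m \<le> y" by linarith
  then show ?thesis
  proof cases
    case 3
    then show ?thesis using *[of y x] Delta_commute[of x y] by simp
  next
    case 4
    then show ?thesis using *[of x y] by (simp add: algebra_simps)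
  qed (auto simp: Delta_nonneg)
qed

end

section \<open>Jensen gaps under a probability measure\<close>

locale unit_measure = finite_measure +
  assumes measure_space_1: "measure M (space M) = 1"
begin

lemma bounded_integrable:
  fixes f :: "'a \<Rightarrow> real"
  assumes "f \<in> borel_measurable M" "\<And>z. \<bar>f z\<bar> \<le> K"
  shows "integrable M f"
  using assms by (intro integrable_const_bound[of _ K]) auto

end

locale convex_average = convex_flux + unit_measure +
  fixes X :: "'a \<Rightarrow> real" and R :: real
  assumes X [measurable]: "X \<in> borel_measurable M" and X_bound: "\<And>z. \<bar>X z\<bar> \<le> R"
begin

lemma bounded_comp:
  fixes f :: "real \<Rightarrow> real"
  assumes "continuous_on UNIV f"
  shows "\<exists>K\<ge>0. \<forall>z. \<bar>f (X z)\<bar> \<le> K"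
proof -
  have "compact (f ` {-R..R})"
    by (intro compact_continuous_image continuous_on_subset[OF assms]) auto
  then obtain K where "K > 0" "\<forall>x\<in>{-R..R}. \<bar>f x\<bar> \<le> K"
    by (metis (no_types, lifting) bounded_pos compact_imp_bounded image_eqI real_norm_def)
  moreover have "X z \<in> {-R..R}" for z using X_bound[of z] by (simp add: abs_le_iff)
  ultimately show ?thesis by (intro exI[of _ K]) auto
qed

lemma measurable_a [measurable]: "a \<in> borel_measurable borel"
  by (rule borel_measurable_continuous_onI[OF cont_a])

lemma integrable_comp:
  fixes f :: "real \<Rightarrow> real"
  assumes "continuous_on UNIV f" and b [measurable]: "b \<in> borel_measurable M" "\<And>z. \<bar>b z\<bar> \<le> C"
  shows "integrable M (\<lambda>z. b z * f (X z))" "integrable M (\<lambda>z. f (X z))"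
proof -
  obtain K where K: "K \<ge> 0" "\<And>z. \<bar>f (X z)\<bar> \<le> K" using bounded_comp[OF assms(1)] by blast
  have [measurable]: "f \<in> borel_measurable borel"
    by (rule borel_measurable_continuous_onI[OF assms(1)])
  show "integrable M (\<lambda>z. f (X z))"
    using K by (intro bounded_integrable[of _ K]) auto
  have "\<bar>b z * f (X z)\<bar> \<le> C * K" for z
    using K(2)[of z] b(2)[of z] by (auto simp: abs_mult intro!: mult_mono)
  then show "integrable M (\<lambda>z. b z * f (X z))"
    by (intro bounded_integrable[of _ "C * K"]) auto
qed

lemma Delta_X_bound: "\<exists>K\<ge>0. \<forall>z z'. \<bar>Delta a (X z) (X z')\<bar> \<le> K"
proof -
  have "compact ((\<lambda>p. Delta a (fst p) (snd p)) ` ({-R..R} \<times> {-R..R}))"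
    by (intro compact_continuous_image continuous_on_subset[OF continuous_on_Delta] compact_Times) auto
  then obtain K where K: "K > 0" "\<forall>p\<in>{-R..R} \<times> {-R..R}. \<bar>Delta a (fst p) (snd p)\<bar> \<le> K"
    by (metis (no_types, lifting) bounded_pos compact_imp_bounded image_eqI real_norm_def)
  then have "\<bar>Delta a (X z) (X z')\<bar> \<le> K" for z z'
    using X_bound[of z] X_bound[of z'] K(2)[rule_format, of "(X z, X z')"] by (simp add: abs_le_iff)
  then show ?thesis using K by (intro exI[of _ K]) auto
qed

text \<open>Since \<open>X - m\<close> has mean 0, its positive part \<open>P\<close> and negative
  part \<open>N\<close> have equal means, so \<open>E|X - m| = 2 E N = 2 E P\<close>. With
  \<open>E N\<close> used against the gap \<open>G\<close> above \<open>m\<close>, and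
  \<open>E P\<close> against the gap \<open>H\<close> below \<open>m\<close>, the product becomes a
  double average in which every term pairs values on opposite sides of \<open>m\<close>. These are
  the pairs that \<open>gap_split\<close> controls; products of parts on the same side never
  arise.\<close>

lemma jensen_gap_product:
  defines "m \<equiv> (LINT z|M. X z)"
  shows "(LINT z|M. \<bar>X z - m\<bar>) * (LINT z|M. gap m (X z)) \<le> (LINT z|M. LINT z'|M. Delta a (X z) (X z'))"
proof -
  define P where "P z = max 0 (X z - m)" for z
  define N where "N z = max 0 (m - X z)" for z
  define G where "G z = (if m \<le> X z then gap m (X z) else 0)" for z
  define H where "H z = (if X z < m then gap m (X z) else 0)" for z
  have meas [measurable]: "P \<in> borel_measurable M" "N \<in> borel_measurable M"
      "G \<in> borel_measurable M" "H \<in> borel_measurable M"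
    unfolding P_def N_def G_def H_def gap_def by measurable
  obtain K where K: "K \<ge> 0" "\<And>z. \<bar>gap m (X z)\<bar> \<le> K" using bounded_comp[OF continuous_on_gap] by blast
  have int: "integrable M P" "integrable M N" "integrable M G" "integrable M H" "integrable M X"
  proof -
    have "\<bar>P z\<bar> \<le> R + \<bar>m\<bar>" "\<bar>N z\<bar> \<le> R + \<bar>m\<bar>" "\<bar>G z\<bar> \<le> K" "\<bar>H z\<bar> \<le> K" for z
      using X_bound[of z] K(2)[of z] K(1) by (auto simp: P_def N_def G_def H_def)
    note bounds = this
    show "integrable M P" by (rule bounded_integrable[OF meas(1) bounds(1)])
    show "integrable M N" by (rule bounded_integrable[OF meas(2) bounds(2)])
    show "integrable M G" by (rule bounded_integrable[OF meas(3) bounds(3)])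
    show "integrable M H" by (rule bounded_integrable[OF meas(4) bounds(4)])
    show "integrable M X" by (rule bounded_integrable[OF X X_bound])
  qed
  have PN: "(LINT z|M. P z) = (LINT z|M. N z)"
  proof -
    have "(LINT z|M. P z) - (LINT z|M. N z) = (LINT z|M. P z - N z)" using int by simp
    also have "\<dots> = (LINT z|M. X z - m)"
      by (intro Bochner_Integration.integral_cong) (auto simp: P_def N_def)
    also have "\<dots> = 0" using int measure_space_1 by (simp add: m_def)
    finally show ?thesis by simp
  qed
  have abs: "(LINT z|M. \<bar>X z - m\<bar>) = 2 * (LINT z|M. N z)"
  proof -
    have "(LINT z|M. \<bar>X z - m\<bar>) = (LINT z|M. P z + N z)"
      by (intro Bochner_Integration.integral_cong) (auto simp: P_def N_def)
    then show ?thesis using int PN by simp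
  qed
  have gap: "(LINT z|M. gap m (X z)) = (LINT z|M. G z) + (LINT z|M. H z)"
  proof -
    have "(LINT z|M. gap m (X z)) = (LINT z|M. G z + H z)"
      by (intro Bochner_Integration.integral_cong) (auto simp: G_def H_def)
    then show ?thesis using int by simp
  qed
  obtain K2 where K2: "K2 \<ge> 0" "\<And>z z'. \<bar>Delta a (X z) (X z')\<bar> \<le> K2" using Delta_X_bound by blast
  have "(LINT z|M. \<bar>X z - m\<bar>) * (LINT z|M. gap m (X z))
      = (LINT z|M. LINT z'|M. N z' * G z + P z * H z' + N z * G z' + P z' * H z)"
    using int by (simp add: abs gap PN algebra_simps)
  also have "\<dots> \<le> (LINT z|M. LINT z'|M. Delta a (X z) (X z'))"
  proof (intro integral_mono)
    show "integrable M (\<lambda>z. LINT z'|M. N z' * G z + P z * H z' + N z * G z' + P z' * H z)"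
      using int by simp
    have iD: "integrable M (\<lambda>z'. Delta a (X z) (X z'))" for z
      by (rule bounded_integrable[OF _ K2(2)]) measurable
    have "\<bar>LINT z'|M. Delta a (X z) (X z')\<bar> \<le> (LINT z'|M. K2)" for z
      by (rule abs_integral_le[OF iD _ K2(2)]) simp
    then have "\<bar>LINT z'|M. Delta a (X z) (X z')\<bar> \<le> K2" for z
      using measure_space_1 by simp
    then show "integrable M (\<lambda>z. LINT z'|M. Delta a (X z) (X z'))"
      by (rule bounded_integrable[rotated]) measurable
    show "integrable M (\<lambda>z'. Delta a (X z) (X z'))" for z by (rule iD)
    show "integrable M (\<lambda>z'. N z' * G z + P z * H z' + N z * G z' + P z' * H z)" for z
      using int by simp
    show "N z' * G z + P z * H z' + N z * G z' + P z' * H z \<le> Delta a (X z) (X z')" for z z'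
      using gap_split[of m "X z'" "X z"] by (simp add: P_def N_def G_def H_def)
  qed
  finally show ?thesis .
qed

text \<open>Reduces the weights \<open>b\<close> (a bounded density) and \<open>c\<close> (mean
  zero) to the plain average: the weights are bounded, the gap and \<open>|X - m|\<close> are
  nonnegative, so both weights can be replaced by their bounds once the expressions are centred at
  the unweighted mean \<open>m\<close>.\<close>

lemma weighted_commutator_bound:
  assumes b [measurable]: "b \<in> borel_measurable M" "\<And>z. 0 \<le> b z" "\<And>z. b z \<le> C" "(LINT z|M. b z) = 1"
    and c [measurable]: "c \<in> borel_measurable M" "\<And>z. \<bar>c z\<bar> \<le> C'" "(LINT z|M. c z) = 0"
  defines "w \<equiv> (LINT z|M. b z * X z)"
  shows "0 \<le> (LINT z|M. b z * a (X z)) - a w"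
    and "\<bar>LINT z|M. c z * X z\<bar> * ((LINT z|M. b z * a (X z)) - a w)
      \<le> C' * C * (LINT z|M. LINT z'|M. Delta a (X z) (X z'))"
proof -
  have b_abs: "\<bar>b z\<bar> \<le> C" for z using b by simp
  have C: "0 \<le> C" "0 \<le> C'" using b(2,3) c(2) by (meson order_trans abs_ge_zero)+
  have ib: "integrable M b" "integrable M c"
    by (rule bounded_integrable[OF b(1) b_abs], rule bounded_integrable[OF c(1,2)])
  have iX: "integrable M (\<lambda>z. b z * X z)" "integrable M (\<lambda>z. c z * X z)" "integrable M X"
    using integrable_comp[OF continuous_on_id b(1) b_abs] integrable_comp[OF continuous_on_id c(1,2)] by auto
  have ia: "integrable M (\<lambda>z. b z * a (X z))" "integrable M (\<lambda>z. a (X z))"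
    using integrable_comp[OF cont_a b(1) b_abs] by auto
  have ig: "integrable M (\<lambda>z. gap m (X z))" "integrable M (\<lambda>z. b z * gap m (X z))" for m
    using integrable_comp[OF continuous_on_gap b(1) b_abs] by auto
  have gap_eq: "(LINT z|M. b z * gap m (X z)) = (LINT z|M. b z * a (X z)) - a m - deriv a m * (w - m)" for m
  proof -
    have "(LINT z|M. b z * gap m (X z))
        = (LINT z|M. b z * a (X z) - a m * b z - deriv a m * (b z * X z) + deriv a m * m * b z)"
      by (intro Bochner_Integration.integral_cong) (auto simp: gap_def algebra_simps)
    also have "\<dots> = (LINT z|M. b z * a (X z)) - a m - deriv a m * w + deriv a m * m"
      using ia iX ib b(4) by (simp add: w_def)
    finally show ?thesis by (simp add: algebra_simps)
  qed
  have "0 \<le> (LINT z|M. b z * gap w (X z))"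
    using b gap_nonneg by (intro integral_nonneg_AE) auto
  then show nonneg: "0 \<le> (LINT z|M. b z * a (X z)) - a w" using gap_eq[of w] by simp
  define m where "m = (LINT z|M. X z)"
  \<comment> \<open>The mean under \<open>b\<close> is \<open>w\<close>, not \<open>m\<close>. By
    \<open>gap_eq\<close>, the \<open>b\<close>-average of \<open>gap m X\<close> exceeds the left
    side by \<open>a w\<close> minus the tangent at \<open>m\<close> evaluated at \<open>w\<close>,
    which is nonnegative.\<close>
  have "(LINT z|M. b z * a (X z)) - a w \<le> (LINT z|M. b z * gap m (X z))"
    using gap_eq[of m] tangent[of m w] by simp
  also have "\<dots> \<le> (LINT z|M. C * gap m (X z))"
    using ig b gap_nonneg by (intro integral_mono mult_right_mono) auto
  finally have le1: "(LINT z|M. b z * a (X z)) - a w \<le> C * (LINT z|M. gap m (X z))" by simp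
  \<comment> \<open>Because \<open>c\<close> has mean zero, subtracting the constant
    \<open>m\<close> from \<open>X\<close> is free.\<close>
  have "(LINT z|M. c z * X z) = (LINT z|M. c z * X z - m * c z)"
    using iX ib c(3) by simp
  moreover have "\<bar>LINT z|M. c z * X z - m * c z\<bar> \<le> (LINT z|M. C' * \<bar>X z - m\<bar>)"
  proof (rule abs_integral_le)
    fix z
    have "\<bar>c z * (X z - m)\<bar> \<le> C' * \<bar>X z - m\<bar>" unfolding abs_mult using c by (intro mult_right_mono) auto
    then show "\<bar>c z * X z - m * c z\<bar> \<le> C' * \<bar>X z - m\<bar>" by (simp add: algebra_simps)
  qed (use iX ib in auto)
  ultimately have le2: "\<bar>LINT z|M. c z * X z\<bar> \<le> C' * (LINT z|M. \<bar>X z - m\<bar>)" by simp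
  have "\<bar>LINT z|M. c z * X z\<bar> * ((LINT z|M. b z * a (X z)) - a w)
      \<le> (C' * (LINT z|M. \<bar>X z - m\<bar>)) * (C * (LINT z|M. gap m (X z)))"
    using le1 le2 nonneg C by (intro mult_mono) auto
  also have "\<dots> = C' * C * ((LINT z|M. \<bar>X z - m\<bar>) * (LINT z|M. gap m (X z)))" by simp
  also have "\<dots> \<le> C' * C * (LINT z|M. LINT z'|M. Delta a (X z) (X z'))"
    using jensen_gap_product C unfolding m_def by (intro mult_left_mono) auto
  finally show "\<bar>LINT z|M. c z * X z\<bar> * ((LINT z|M. b z * a (X z)) - a w)
      \<le> C' * C * (LINT z|M. LINT z'|M. Delta a (X z) (X z'))" .
qed

end

section \<open>Averages over the box of the mollifier\<close>

text \<open>Exchanges the average over offsets \<open>z\<close> with the integral over base points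
  \<open>p\<close>, so that estimates for each fixed offset carry over to the average. Only almost
  every \<open>z\<close> matters, since \<open>Q\<close> is carried by the box.\<close>

lemma integral_average_le:
  fixes F :: "'a \<Rightarrow> 'b \<Rightarrow> real"
  assumes M1: "finite_measure M1" and M2: "unit_measure M2"
    and F [measurable]: "case_prod F \<in> borel_measurable (M1 \<Otimes>\<^sub>M M2)" and K: "\<And>p z. \<bar>F p z\<bar> \<le> K"
    and b: "AE z in M2. (LINT p|M1. F p z) \<le> b"
  shows "(LINT p|M1. LINT z|M2. F p z) \<le> b"
proof -
  interpret M1: finite_measure M1 by fact
  interpret M2: unit_measure M2 by fact
  interpret P: pair_sigma_finite M1 M2 ..
  interpret PP: finite_measure "M1 \<Otimes>\<^sub>M M2"
    by (rule finite_measure_pair_measure) unfold_locales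
  have int: "integrable (M1 \<Otimes>\<^sub>M M2) (case_prod F)"
    using K by (intro PP.integrable_const_bound[of _ K]) (auto simp: split_beta)
  have "(LINT p|M1. LINT z|M2. F p z) = (LINT z|M2. LINT p|M1. F p z)"
    using P.Fubini_integral[OF int] by simp
  also have "\<dots> \<le> (LINT z|M2. b)"
    using b P.integrable_snd[OF int] by (intro integral_mono_AE) auto
  also have "\<dots> = b" using M2.measure_space_1 by simp
  finally show ?thesis .
qed

text \<open>A density rather than a restricted space: the space stays \<open>UNIV\<close> and the
  sets stay \<open>borel\<close>, so Borel functions of \<open>p - z\<close> remain measurable
  without further argument.\<close>

definition local_lebesgue :: "(real \<times> real) set \<Rightarrow> (real \<times> real) measure" where
  "local_lebesgue K = density lborel (\<lambda>p. ennreal (indicat_real K p))"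

lemma local_lebesgue_simps [simp, measurable_cong]:
  "sets (local_lebesgue K) = sets borel" "space (local_lebesgue K) = UNIV"
  by (simp_all add: local_lebesgue_def)

lemma integral_local_lebesgue:
  assumes "K \<in> sets borel" "f \<in> borel_measurable borel"
  shows "(LINT p|local_lebesgue K. f p) = (LINT p|lborel. indicator K p * (f p :: real))"
  using assms unfolding local_lebesgue_def by (subst integral_density) auto

lemma finite_measure_local_lebesgue:
  assumes "compact K"
  shows "finite_measure (local_lebesgue K)"
proof
  have "K \<in> sets borel" using assms by (simp add: borel_compact)
  then have "emeasure (local_lebesgue K) UNIV = emeasure lborel K"
    unfolding local_lebesgue_def by (subst emeasure_density) (auto simp: ennreal_indicator)
  then show "emeasure (local_lebesgue K) (space (local_lebesgue K)) \<noteq> \<infinity>"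
    using emeasure_compact_finite[OF assms] by simp
qed

lemma AE_local_lebesgue: "K \<in> sets borel \<Longrightarrow> AE p in local_lebesgue K. p \<in> K"
  unfolding local_lebesgue_def by (subst AE_density) (auto simp: indicator_def)

section \<open>Kernels as densities against the uniform probability on the box\<close>

context mollifier
begin

sublocale k: compact_kernel k "d + e"
  by (rule kernels_compact_kernel[OF kernels(1) pos(2,3)])

sublocale kt: compact_kernel kt "d + e"
  by (rule kernels_compact_kernel[OF kernels(2) pos(2,3)])

sublocale kx: compact_kernel kx "d + e"
  by (rule kernels_compact_kernel[OF kernels(3) pos(2,3)])

definition box where "box = cbox (- d, - e) (d, e)"

definition Q where "Q = density lborel (\<lambda>z. ennreal (indicat_real box z / (4 * d * e)))"

lemma box_sets [measurable]: "box \<in> sets borel"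
  by (simp add: box_def)

lemma mem_box: "z \<in> box \<longleftrightarrow> \<bar>fst z\<bar> \<le> d \<and> \<bar>snd z\<bar> \<le> e"
  by (cases z) (auto simp: box_def cbox_Pair_eq abs_le_iff)

lemma Q_simps [simp, measurable_cong]: "sets Q = sets borel" "space Q = UNIV"
  by (simp_all add: Q_def)

lemma AE_Q: "AE z in Q. z \<in> box"
  unfolding Q_def by (subst AE_density) (auto simp: indicator_def)

lemma integral_Q:
  assumes [measurable]: "f \<in> borel_measurable borel"
  shows "(LINT z|Q. f z) = (LINT z|lborel. indicat_real box z / (4 * d * e) * f z)"
  using pos unfolding Q_def by (subst integral_density) auto

lemma unit_measure_Q: "unit_measure Q"
proof -
  have m: "emeasure lborel box = ennreal (4 * d * e)"
  proof -
    have "emeasure lborel box < \<infinity>" unfolding box_def by (rule emeasure_lborel_cbox_finite)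
    then have "emeasure lborel box = ennreal (measure lborel box)"
      by (simp add: emeasure_eq_ennreal_measure less_top)
    also have "measure lborel box = 4 * d * e" using pos by (simp add: box_def content_Pair)
    finally show ?thesis .
  qed
  have "emeasure Q (space Q) = (\<integral>\<^sup>+z. ennreal (1 / (4 * d * e)) * indicator box z \<partial>lborel)"
    unfolding Q_def space_density
    by (subst emeasure_density) (auto intro!: nn_integral_cong simp: indicator_def)
  also have "\<dots> = ennreal (1 / (4 * d * e)) * ennreal (4 * d * e)"
    by (subst nn_integral_cmult_indicator) (auto simp: m)
  also have "\<dots> = 1" using pos by (subst ennreal_mult[symmetric]) auto
  finally have 1: "emeasure Q (space Q) = 1" .
  show ?thesis
  proof (intro unit_measure.intro unit_measure_axioms.intro finite_measureI)
    show "emeasure Q (space Q) \<noteq> \<infinity>" unfolding 1 by simp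
    show "measure Q (space Q) = 1" unfolding measure_def 1 by simp
  qed
qed

text \<open>A convolution becomes an average of the values \<open>f (p - z)\<close>,
  \<open>z\<close> in the box, which is the setting of \<open>convex_average\<close>. It holds
  because kernels vanish outside the box.\<close>

lemma kernel_integral_eq:
  assumes g: "g \<in> kernels d e" and [measurable]: "f \<in> borel_measurable borel"
  shows "conv f g p = (LINT z|Q. (4 * d * e * g z) * f (p - z))"
proof -
  interpret g: compact_kernel g "d + e"
    by (rule kernels_compact_kernel[OF g pos(2,3)])
  have "g z = 0" if "z \<notin> box" for z
    using kernels_eq_0[OF g pos(2,3), of z] that by (auto simp: mem_box)
  then have "f (p - z) * g z = indicat_real box z / (4 * d * e) * ((4 * d * e * g z) * f (p - z))" for z
    using pos by (cases "z \<in> box") simp_all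
  then show ?thesis by (simp add: conv_eq_reflect integral_Q)
qed

lemma integral_Q_kernel:
  assumes g: "g \<in> kernels d e"
  shows "(LINT z|Q. 4 * d * e * g z) = (LINT z|lborel. g z)"
proof -
  interpret g: compact_kernel g "d + e"
    by (rule kernels_compact_kernel[OF g pos(2,3)])
  have "g z = 0" if "z \<notin> box" for z
    using kernels_eq_0[OF g pos(2,3), of z] that by (auto simp: mem_box)
  then have *: "indicat_real box z / (4 * d * e) * (4 * d * e * g z) = g z" for z
    using pos by (cases "z \<in> box") simp_all
  show ?thesis unfolding integral_Q[OF borel_measurable_times[OF borel_measurable_const g.meas]] * ..
qed

text \<open>\<open>k\<close> is a probability density, so mollifying does not leave the range. This
  is why a bound on \<open>\<eta>''\<close> over the essential range of \<open>u\<close> suffices at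
  the mollified values.\<close>

lemma mean_bounds:
  assumes [measurable]: "v \<in> borel_measurable borel" and v: "\<And>z. lo \<le> v z" "\<And>z. v z \<le> hi"
  shows "lo \<le> conv v k p" "conv v k p \<le> hi"
proof -
  interpret Q: unit_measure Q by (rule unit_measure_Q)
  have k_abs: "\<bar>4 * d * e * k z\<bar> \<le> C" for z using k_nonneg[of z] k_le[of z] pos by simp
  have ik: "integrable Q (\<lambda>z. 4 * d * e * k z)"
    using k_abs by (rule Q.bounded_integrable[rotated]) measurable
  have "\<bar>(4 * d * e * k z) * v (p - z)\<bar> \<le> C * (\<bar>lo\<bar> + \<bar>hi\<bar>)" for z
    unfolding abs_mult[of _ "v _"] using k_abs[of z] v[of "p - z"] by (intro mult_mono) auto
  then have iv: "integrable Q (\<lambda>z. (4 * d * e * k z) * v (p - z))"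
    by (rule Q.bounded_integrable[rotated]) measurable
  have nn: "0 \<le> 4 * d * e * k z" for z using k_nonneg[of z] pos by simp
  have "lo = (LINT z|Q. (4 * d * e * k z) * lo)"
    using ik integral_Q_kernel[OF kernels(1)] integral_k by simp
  also have "\<dots> \<le> conv v k p" unfolding kernel_integral_eq[OF kernels(1) assms(1)]
    using iv ik v nn by (intro integral_mono mult_left_mono) auto
  finally show "lo \<le> conv v k p" .
  have "conv v k p \<le> (LINT z|Q. (4 * d * e * k z) * hi)" unfolding kernel_integral_eq[OF kernels(1) assms(1)]
    using iv ik v nn by (intro integral_mono mult_left_mono) auto
  also have "\<dots> = hi"
    using ik integral_Q_kernel[OF kernels(1)] integral_k by simp
  finally show "conv v k p \<le> hi" .
qed

lemma mean_deviation:
  assumes v [measurable]: "v \<in> borel_measurable borel" and R: "\<And>z. \<bar>v z\<bar> \<le> R"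
  shows "\<bar>conv v k p - c\<bar> \<le> C * (LINT z|Q. \<bar>v (p - z) - c\<bar>)"
proof -
  interpret Q: unit_measure Q by (rule unit_measure_Q)
  have k_abs: "\<bar>4 * d * e * k z\<bar> \<le> C" for z using k_nonneg[of z] k_le[of z] pos by simp
  have ik: "integrable Q (\<lambda>z. 4 * d * e * k z)"
    using k_abs by (rule Q.bounded_integrable[rotated]) measurable
  have "\<bar>(4 * d * e * k z) * v (p - z)\<bar> \<le> C * R" for z
    unfolding abs_mult[of _ "v _"] using k_abs[of z] R[of "p - z"] by (intro mult_mono) auto
  then have iv: "integrable Q (\<lambda>z. (4 * d * e * k z) * v (p - z))"
    by (rule Q.bounded_integrable[rotated]) measurable
  have iv': "integrable Q (\<lambda>z. v (p - z))"
    using R by (rule Q.bounded_integrable[rotated]) measurable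
  have "conv v k p - c = (LINT z|Q. (4 * d * e * k z) * v (p - z) - (4 * d * e * k z) * c)"
    using ik iv integral_Q_kernel[OF kernels(1)] integral_k
    by (simp add: kernel_integral_eq[OF kernels(1) v])
  moreover have "\<bar>LINT z|Q. (4 * d * e * k z) * v (p - z) - (4 * d * e * k z) * c\<bar>
      \<le> (LINT z|Q. C * \<bar>v (p - z) - c\<bar>)"
  proof (rule abs_integral_le)
    fix z
    have "\<bar>4 * d * e * k z\<bar> * \<bar>v (p - z) - c\<bar> \<le> C * \<bar>v (p - z) - c\<bar>"
      by (intro mult_right_mono k_abs) auto
    then show "\<bar>(4 * d * e * k z) * v (p - z) - (4 * d * e * k z) * c\<bar> \<le> C * \<bar>v (p - z) - c\<bar>"
      by (simp only: abs_mult[symmetric] right_diff_distrib)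
  qed (use iv ik iv' in auto)
  ultimately show ?thesis by simp
qed

text \<open>\<open>weighted_commutator_bound\<close> for \<open>X z = v (p - z)\<close> under
  \<open>Q\<close>, with weights \<open>4 * d * e * k\<close> and \<open>4 * d * e * kx\<close>; the
  second has mean zero by \<open>integral_kx\<close>.\<close>

lemma commutator_pointwise:
  assumes "convex_flux a B" and v [measurable]: "v \<in> borel_measurable borel" and R: "\<And>z. \<bar>v z\<bar> \<le> R"
  shows "0 \<le> conv (\<lambda>z. a (v z)) k p - a (conv v k p)"
    and "\<bar>conv v kx p\<bar> * (conv (\<lambda>z. a (v z)) k p - a (conv v k p))
      \<le> C / e * C * (LINT z|Q. LINT z'|Q. Delta a (v (p - z)) (v (p - z')))"
proof -
  interpret convex_flux a B by fact
  interpret Q: unit_measure Q by (rule unit_measure_Q)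
  interpret convex_average a B Q "\<lambda>z. v (p - z)" R
    by unfold_locales (use R in auto)
  have av: "(\<lambda>z. a (v z)) \<in> borel_measurable borel" by measurable
  note W = weighted_commutator_bound[of "\<lambda>z. 4 * d * e * k z" C "\<lambda>z. 4 * d * e * kx z" "C / e"]
  have k: "(\<lambda>z. 4 * d * e * k z) \<in> borel_measurable Q" "(\<lambda>z. 4 * d * e * kx z) \<in> borel_measurable Q"
    "0 \<le> 4 * d * e * k z" "4 * d * e * k z \<le> C" "\<bar>4 * d * e * kx z\<bar> \<le> C / e"
    "(LINT z|Q. 4 * d * e * k z) = 1" "(LINT z|Q. 4 * d * e * kx z) = 0" for z
    using k_nonneg[of z] k_le[of z] kx_le[of z] pos integral_Q_kernel[OF kernels(1)] integral_k
      integral_Q_kernel[OF kernels(3)] integral_kx by (simp_all add: abs_mult)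
  show "0 \<le> conv (\<lambda>z. a (v z)) k p - a (conv v k p)"
    unfolding kernel_integral_eq[OF kernels(1) v] kernel_integral_eq[OF kernels(1) av]
    by (rule W(1)[OF k(1,3,4,6,2,5,7)])
  show "\<bar>conv v kx p\<bar> * (conv (\<lambda>z. a (v z)) k p - a (conv v k p))
      \<le> C / e * C * (LINT z|Q. LINT z'|Q. Delta a (v (p - z)) (v (p - z')))"
    unfolding kernel_integral_eq[OF kernels(1) v] kernel_integral_eq[OF kernels(1) av]
      kernel_integral_eq[OF kernels(3) v]
    by (rule W(2)[OF k(1,3,4,6,2,5,7)])
qed

end

section \<open>Continuity of translations in mean\<close>

text \<open>\<open>measurable_on\<close> is by definition an approximation by continuous functions
  off a negligible set; the proof passes to the Lebesgue completion to reach it and comes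
  back.\<close>

lemma borel_pointwise_limit_continuous:
  fixes v :: "real \<times> real \<Rightarrow> real"
  assumes "v \<in> borel_measurable borel"
  obtains g where "\<And>n::nat. continuous_on UNIV (g n)" "AE x in lborel. (\<lambda>n. g n x) \<longlonglongrightarrow> v x"
proof -
  have "v \<in> borel_measurable lebesgue"
    using assms by (intro measurable_completion) auto
  then have "v measurable_on UNIV"
    by (intro lebesgue_measurable_imp_measurable_on) (auto simp: lebesgue_on_UNIV_eq)
  then obtain N g where N: "negligible N" "\<And>n. continuous_on UNIV (g n)"
      "\<And>x. x \<notin> N \<Longrightarrow> (\<lambda>n. g n x) \<longlonglongrightarrow> v x"
    unfolding measurable_on_def by auto
  have "AE x in lebesgue. x \<notin> N"
    using N(1) by (simp add: AE_not_in negligible_iff_null_sets)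
  then have "AE x in lborel. x \<notin> N" by (simp add: AE_completion_iff)
  then have "AE x in lborel. (\<lambda>n. g n x) \<longlonglongrightarrow> v x" by eventually_elim (rule N(3))
  then show ?thesis using that N(2) by blast
qed

lemma L1_approx_continuous:
  fixes v :: "real \<times> real \<Rightarrow> real"
  assumes v [measurable]: "v \<in> borel_measurable borel" and R: "\<And>z. \<bar>v z\<bar> \<le> R"
    and K: "compact K" and "\<epsilon> > 0"
  obtains g where "continuous_on UNIV g" "\<And>z. \<bar>g z\<bar> \<le> R" "(LINT p|local_lebesgue K. \<bar>v p - g p\<bar>) < \<epsilon>"
proof -
  have R0: "R \<ge> 0" using R abs_ge_zero order_trans by blast
  have [measurable]: "K \<in> sets borel" using K by (simp add: borel_compact)
  interpret finite_measure "local_lebesgue K" by (rule finite_measure_local_lebesgue[OF K])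
  obtain g0 where g0: "\<And>n::nat. continuous_on UNIV (g0 n)" "AE x in lborel. (\<lambda>n. g0 n x) \<longlonglongrightarrow> v x"
    using borel_pointwise_limit_continuous[OF v] by blast
  \<comment> \<open>Truncating at the bound of \<open>v\<close> keeps continuity and the limit, and
    supplies the constant dominating function on the finite measure.\<close>
  define g where "g n x = max (- R) (min R (g0 n x))" for n x
  have g: "continuous_on UNIV (g n)" for n unfolding g_def by (intro continuous_intros g0)
  have [measurable]: "g n \<in> borel_measurable borel" for n
    by (rule borel_measurable_continuous_onI[OF g])
  have gR: "\<bar>g n z\<bar> \<le> R" for n z using R0 by (auto simp: g_def)
  have lim: "(\<lambda>n. g n x) \<longlonglongrightarrow> v x" if "(\<lambda>n. g0 n x) \<longlonglongrightarrow> v x" for x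
  proof -
    have "(\<lambda>n. max (- R) (min R (g0 n x))) \<longlonglongrightarrow> max (- R) (min R (v x))"
      by (intro tendsto_intros that)
    moreover have "max (- R) (min R (v x)) = v x" using R[of x] by auto
    ultimately show ?thesis by (simp add: g_def)
  qed
  have "(\<lambda>n. LINT p|local_lebesgue K. \<bar>v p - g n p\<bar>) \<longlonglongrightarrow> (LINT p|local_lebesgue K. 0)"
  proof (rule integral_dominated_convergence[where w="\<lambda>_. 2 * R"])
    have "AE x in lborel. (\<lambda>n. \<bar>v x - g n x\<bar>) \<longlonglongrightarrow> 0"
      using g0(2)
    proof eventually_elim
      case (elim x)
      have "(\<lambda>n. \<bar>v x - g n x\<bar>) \<longlonglongrightarrow> \<bar>v x - v x\<bar>" by (intro tendsto_intros lim elim)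
      then show ?case by simp
    qed
    then show "AE x in local_lebesgue K. (\<lambda>n. \<bar>v x - g n x\<bar>) \<longlonglongrightarrow> 0"
      unfolding local_lebesgue_def by (subst AE_density) auto
    show "AE x in local_lebesgue K. norm \<bar>v x - g n x\<bar> \<le> 2 * R" for n
    proof (rule AE_I2)
      fix x show "norm \<bar>v x - g n x\<bar> \<le> 2 * R" using R[of x] gR[of n x] by simp
    qed
  qed auto
  then have "eventually (\<lambda>n. (LINT p|local_lebesgue K. \<bar>v p - g n p\<bar>) < \<epsilon>) sequentially"
    using \<open>\<epsilon> > 0\<close> by (intro order_tendstoD(2)) auto
  then obtain n where "(LINT p|local_lebesgue K. \<bar>v p - g n p\<bar>) < \<epsilon>"
    using eventually_happens sequentially_bot by blast
  then show ?thesis using that[of "g n"] g gR by blast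
qed

lemma local_integral_shift_le:
  fixes f :: "real \<times> real \<Rightarrow> real"
  assumes f [measurable]: "f \<in> borel_measurable borel" and f_bd: "\<And>z. 0 \<le> f z" "\<And>z. f z \<le> b"
    and K: "compact K" "compact K'" "\<And>p. p \<in> K \<Longrightarrow> p - z \<in> K'"
  shows "(LINT p|local_lebesgue K. f (p - z)) \<le> (LINT p|local_lebesgue K'. f p)"
proof -
  have [measurable]: "K \<in> sets borel" "K' \<in> sets borel" using K by (simp_all add: borel_compact)
  have int: "integrable lborel (\<lambda>p. indicat_real K' p * f p)"
  proof -
    obtain r where r: "\<And>p. p \<in> K' \<Longrightarrow> norm p \<le> r"
      using compact_imp_bounded[OF K(2)] by (auto simp: bounded_iff)
    have "\<bar>indicat_real K' p * f p\<bar> \<le> \<bar>b\<bar>" for p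
      using f_bd[of p] by (auto simp: indicator_def)
    moreover have "indicat_real K' p * f p = 0" if "r < norm (p - 0)" for p
      using that r[of p] by (auto simp: indicator_def)
    ultimately show ?thesis
      by (intro bounded_compact_support_integrable[of _ "\<bar>b\<bar>" r 0]) auto
  qed
  have "(LINT p|local_lebesgue K. f (p - z)) = (LINT p|lborel. indicator K p * f (p - z))"
    by (rule integral_local_lebesgue) measurable
  also have "\<dots> \<le> (LINT p|lborel. indicator K' (p - z) * f (p - z))"
  proof (rule integral_mono')
    show "integrable lborel (\<lambda>p. indicat_real K' (p - z) * f (p - z))"
      using int by (subst (asm) distr_lborel_shift[of z, symmetric], subst (asm) integrable_distr_eq) auto
    show "indicat_real K p * f (p - z) \<le> indicat_real K' (p - z) * f (p - z)" for p
      using K(3)[of p] f_bd(1)[of "p - z"] by (auto simp: indicator_def)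
    show "0 \<le> indicat_real K' (p - z) * f (p - z)" for p using f_bd(1) by simp
  qed
  also have "\<dots> = (LINT p|distr lborel borel (\<lambda>p. p - z). indicator K' p * f p)"
    by (subst integral_distr) auto
  also have "\<dots> = (LINT p|local_lebesgue K'. f p)"
    by (simp add: distr_lborel_shift integral_local_lebesgue)
  finally show ?thesis .
qed

text \<open>Approximation in L^1 by a continuous \<open>g\<close>, uniformly continuous on the
  larger compact set \<open>K'\<close>. That set contains \<open>K\<close> and all its translates of
  length at most 1, so the approximation error is also small after the shift.\<close>

lemma L1_translation_continuous:
  fixes v :: "real \<times> real \<Rightarrow> real"
  assumes v [measurable]: "v \<in> borel_measurable borel" and R: "\<And>z. \<bar>v z\<bar> \<le> R"
    and K: "compact K" and "\<epsilon> > 0"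
  obtains r where "r > 0" "\<And>z. norm z \<le> r \<Longrightarrow> (LINT p|local_lebesgue K. \<bar>v (p - z) - v p\<bar>) \<le> \<epsilon>"
proof -
  obtain \<rho> where \<rho>: "\<And>p. p \<in> K \<Longrightarrow> norm p \<le> \<rho>"
    using compact_imp_bounded[OF K] by (auto simp: bounded_iff)
  define K' where "K' = cball (0::real\<times>real) (\<rho> + 1)"
  have K': "compact K'" by (simp add: K'_def)
  have shift: "p - z \<in> K'" if "p \<in> K" "norm z \<le> 1" for p z
    using \<rho>[OF that(1)] that(2) norm_triangle_ineq4[of p z] by (simp add: K'_def)
  interpret finite_measure "local_lebesgue K" by (rule finite_measure_local_lebesgue[OF K])
  obtain g where g: "continuous_on UNIV g" "\<And>z. \<bar>g z\<bar> \<le> R" "(LINT p|local_lebesgue K'. \<bar>v p - g p\<bar>) < \<epsilon> / 3"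
    using L1_approx_continuous[OF v R K', of "\<epsilon> / 3"] \<open>\<epsilon> > 0\<close> by auto
  have [measurable]: "g \<in> borel_measurable borel" by (rule borel_measurable_continuous_onI[OF g(1)])
  have [measurable]: "K \<in> sets borel" using K by (simp add: borel_compact)
  define m where "m = measure (local_lebesgue K) UNIV"
  have m: "m \<ge> 0" by (simp add: m_def)
  \<comment> \<open>The middle term integrates to \<open>\<gamma> * m\<close>; the added 1 covers
    the case that \<open>K\<close> has measure 0.\<close>
  define \<gamma> where "\<gamma> = \<epsilon> / (3 * (m + 1))"
  have \<gamma>: "\<gamma> > 0" "\<gamma> * m \<le> \<epsilon> / 3" using m \<open>\<epsilon> > 0\<close> by (auto simp: \<gamma>_def field_simps)
  have "uniformly_continuous_on K' g"
    using compact_uniformly_continuous[OF continuous_on_subset[OF g(1)] K'] by simp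
  then obtain r0 where r0: "r0 > 0" "\<And>x y. x \<in> K' \<Longrightarrow> y \<in> K' \<Longrightarrow> dist y x < r0 \<Longrightarrow> dist (g y) (g x) < \<gamma>"
    using \<gamma>(1) unfolding uniformly_continuous_on_def by blast
  define r where "r = min 1 (r0 / 2)"
  have vg: "\<bar>v p - g p\<bar> \<le> 2 * R" for p using R[of p] g(2)[of p] by simp
  have int: "integrable (local_lebesgue K) (\<lambda>p. \<bar>v (p - z) - g (p - z)\<bar>)" for z
    using vg[of "p - z" for p] by (intro integrable_const_bound[of _ "2 * R"]) auto
  have "(LINT p|local_lebesgue K. \<bar>v (p - z) - v p\<bar>) \<le> \<epsilon>" if z: "norm z \<le> r" for z
  proof -
    have z1: "norm z \<le> 1" "norm z < r0" using z r0(1) by (auto simp: r_def)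
    \<comment> \<open>Writing the unshifted term with \<open>p - 0\<close> lets the same shift
      estimate bound both outer terms.\<close>
    have "(LINT p|local_lebesgue K. \<bar>v (p - z) - v p\<bar>)
        \<le> (LINT p|local_lebesgue K. \<bar>v (p - z) - g (p - z)\<bar> + \<gamma> + \<bar>v (p - 0) - g (p - 0)\<bar>)"
    proof (rule integral_mono_AE)
      have "\<bar>v (p - z) - v p\<bar> \<le> 2 * R" for p using R[of "p - z"] R[of p] by simp
      then show "integrable (local_lebesgue K) (\<lambda>p. \<bar>v (p - z) - v p\<bar>)"
        by (intro integrable_const_bound[of _ "2 * R"]) auto
      show "integrable (local_lebesgue K) (\<lambda>p. \<bar>v (p - z) - g (p - z)\<bar> + \<gamma> + \<bar>v (p - 0) - g (p - 0)\<bar>)"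
        by (intro Bochner_Integration.integrable_add int) simp
      show "AE p in local_lebesgue K. \<bar>v (p - z) - v p\<bar> \<le> \<bar>v (p - z) - g (p - z)\<bar> + \<gamma> + \<bar>v (p - 0) - g (p - 0)\<bar>"
        using AE_local_lebesgue[of K]
      proof (rule AE_mp[OF _ AE_I2], goal_cases)
        case (2 p)
        show ?case
        proof
          assume p: "p \<in> K"
          have "dist (p - z) p < r0" using z1 by (simp add: dist_norm)
          then have "dist (g (p - z)) (g p) < \<gamma>"
            using shift[OF p z1(1)] shift[OF p, of 0] by (intro r0(2)) auto
          then show "\<bar>v (p - z) - v p\<bar> \<le> \<bar>v (p - z) - g (p - z)\<bar> + \<gamma> + \<bar>v (p - 0) - g (p - 0)\<bar>"
            by (simp add: dist_real_def)
        qed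
      qed simp
    qed
    also have "\<dots> = (LINT p|local_lebesgue K. \<bar>v (p - z) - g (p - z)\<bar>) + \<gamma> * m
        + (LINT p|local_lebesgue K. \<bar>v (p - 0) - g (p - 0)\<bar>)"
      using int[of z] int[of 0] by (simp add: m_def)
    also have "\<dots> \<le> \<epsilon> / 3 + \<epsilon> / 3 + \<epsilon> / 3"
    proof -
      have "(LINT p|local_lebesgue K. \<bar>v (p - z) - g (p - z)\<bar>) \<le> (LINT p|local_lebesgue K'. \<bar>v p - g p\<bar>)"
        if "norm z \<le> 1" for z
        using shift that vg by (intro local_integral_shift_le[OF _ _ _ K K']) auto
      from this[of z] this[of 0] g(3) \<gamma>(2) z1 show ?thesis by (intro add_mono) auto
    qed
    finally show ?thesis by simp
  qed
  moreover have "r > 0" using r0(1) by (simp add: r_def)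
  ultimately show ?thesis using that by blast
qed

text \<open>The second point is moved from time \<open>s'\<close> to the time \<open>s\<close> of
  the first, which costs \<open>L\<close> times a pure time translation. What remains is a pure
  space difference \<open>y - y'\<close>, the only kind the hypothesis of the theorem
  measures.\<close>

lemma Delta_two_point_estimate:
  fixes v :: "real \<times> real \<Rightarrow> real"
  assumes "convex_flux a B" and v [measurable]: "v \<in> borel_measurable borel" and R: "\<And>z. \<bar>v z\<bar> \<le> R"
    and L: "L \<ge> 0" "\<And>x y y'. \<bar>x\<bar> \<le> R \<Longrightarrow> \<bar>y\<bar> \<le> R \<Longrightarrow> \<bar>y'\<bar> \<le> R \<Longrightarrow> \<bar>Delta a x y - Delta a x y'\<bar> \<le> L * \<bar>y - y'\<bar>"
    and K: "compact K" "compact K'" "\<And>p. p \<in> K \<Longrightarrow> p - (s, y) \<in> K'" "\<And>p. p \<in> K \<Longrightarrow> p - (s, y') \<in> K'"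
  shows "(LINT p|local_lebesgue K. Delta a (v (p - (s, y))) (v (p - (s', y'))))
    \<le> (LINT p|local_lebesgue K'. Delta a (v p) (v (p + (0, y - y'))))
      + L * (LINT p|local_lebesgue K'. \<bar>v (p - (s' - s, 0)) - v p\<bar>)"
proof -
  interpret convex_flux a B by fact
  interpret finite_measure "local_lebesgue K" by (rule finite_measure_local_lebesgue[OF K(1)])
  have eq: "p - (s, y) + (0, y - y') = p - (s, y')" "p - (s, y') - (s' - s, 0) = p - (s', y')" for p :: "real \<times> real"
    by (simp_all add: prod_eq_iff)
  have v2: "\<bar>v p - v q\<bar> \<le> 2 * R" for p q using R[of p] R[of q] by simp
  have DR: "Delta a (v p) (v q) \<le> L * (2 * R)" for p q
  proof -
    have "\<bar>Delta a (v p) (v q) - Delta a (v p) (v p)\<bar> \<le> L * \<bar>v q - v p\<bar>"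
      by (intro L(2) R)
    also have "\<dots> \<le> L * (2 * R)" by (intro mult_left_mono v2 L)
    finally show ?thesis using Delta_self by simp
  qed
  have intD: "integrable (local_lebesgue K) (\<lambda>p. Delta a (v (p - z)) (v (p - z')))" for z z'
    using DR Delta_nonneg by (intro integrable_const_bound[of _ "L * (2 * R)"]) auto
  have intv: "integrable (local_lebesgue K) (\<lambda>p. \<bar>v (p - z) - v (p - z')\<bar>)" for z z'
    using v2 by (intro integrable_const_bound[of _ "2 * R"]) auto
  have "(LINT p|local_lebesgue K. Delta a (v (p - (s, y))) (v (p - (s', y'))))
    \<le> (LINT p|local_lebesgue K. Delta a (v (p - (s, y))) (v (p - (s, y'))) + L * \<bar>v (p - (s', y')) - v (p - (s, y'))\<bar>)"
  proof (rule integral_mono)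
    show "Delta a (v (p - (s, y))) (v (p - (s', y')))
      \<le> Delta a (v (p - (s, y))) (v (p - (s, y'))) + L * \<bar>v (p - (s', y')) - v (p - (s, y'))\<bar>" for p
      using L(2)[OF R R R, of "p - (s, y)" "p - (s', y')" "p - (s, y')"] by linarith
  qed (intro intD intv Bochner_Integration.integrable_add integrable_mult_right)+
  also have "\<dots> = (LINT p|local_lebesgue K. Delta a (v (p - (s, y))) (v (p - (s, y'))))
     + L * (LINT p|local_lebesgue K. \<bar>v (p - (s', y')) - v (p - (s, y'))\<bar>)"
    using intD intv by simp
  also have "(LINT p|local_lebesgue K. Delta a (v (p - (s, y))) (v (p - (s, y'))))
      = (LINT p|local_lebesgue K. Delta a (v (p - (s, y))) (v (p - (s, y) + (0, y - y'))))"
    unfolding eq ..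
  also have "\<dots> \<le> (LINT p|local_lebesgue K'. Delta a (v p) (v (p + (0, y - y'))))"
    by (rule local_integral_shift_le[where f="\<lambda>p. Delta a (v p) (v (p + (0, y - y')))", OF _ Delta_nonneg DR K(1,2,3)]) measurable
  also have "(LINT p|local_lebesgue K. \<bar>v (p - (s', y')) - v (p - (s, y'))\<bar>)
      = (LINT p|local_lebesgue K. \<bar>v (p - (s, y') - (s' - s, 0)) - v (p - (s, y'))\<bar>)"
    unfolding eq ..
  also have "\<dots> \<le> (LINT p|local_lebesgue K'. \<bar>v (p - (s' - s, 0)) - v p\<bar>)"
    by (rule local_integral_shift_le[where f="\<lambda>p. \<bar>v (p - (s' - s, 0)) - v p\<bar>", OF _ abs_ge_zero v2 K(1,2,4)]) measurable
  finally show ?thesis using L(1) by (simp add: mult_left_mono)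
qed

section \<open>The mollified entropy balance\<close>

locale test_function =
  fixes f ft fx :: "real \<times> real \<Rightarrow> real" and K :: "(real \<times> real) set"
  assumes cont: "continuous_on UNIV f" "continuous_on UNIV ft" "continuous_on UNIV fx"
    and deriv_t: "\<And>t x. ((\<lambda>s. f (s, x)) has_real_derivative ft (t, x)) (at t)"
    and deriv_x: "\<And>t x. ((\<lambda>y. f (t, y)) has_real_derivative fx (t, x)) (at x)"
    and compact: "compact K"
    and supp: "\<And>p. p \<notin> K \<Longrightarrow> f p = 0" "\<And>p. p \<notin> K \<Longrightarrow> ft p = 0" "\<And>p. p \<notin> K \<Longrightarrow> fx p = 0"
begin

lemma K_sets [measurable]: "K \<in> sets borel"
  using compact by (simp add: borel_compact)

lemma meas [measurable]:
  "f \<in> borel_measurable borel" "ft \<in> borel_measurable borel" "fx \<in> borel_measurable borel"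
  by (intro borel_measurable_continuous_onI cont)+

lemma compact_kernel_mult:
  assumes "continuous_on UNIV g" "continuous_on UNIV h" "\<And>p. p \<notin> K \<Longrightarrow> g p = 0"
  shows "\<exists>r. compact_kernel (\<lambda>p. g p * h p) r"
proof -
  obtain r where "\<And>p. p \<in> K \<Longrightarrow> norm p \<le> r"
    using compact_imp_bounded[OF compact] by (auto simp: bounded_iff)
  then have "g p * h p = 0" if "r < norm p" for p
    using assms(3)[of p] that by fastforce
  then show ?thesis
    by (intro exI[of _ r] compact_kernel.intro continuous_intros assms)
qed

lemma integrable_mult:
  fixes g h :: "real \<times> real \<Rightarrow> real"
  assumes "continuous_on UNIV g" "continuous_on UNIV h" "\<And>p. p \<notin> K \<Longrightarrow> g p = 0"
  shows "integrable lborel (\<lambda>p. g p * h p)"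
  using compact_kernel_mult[OF assms] compact_kernel.integrable by blast

lemma integral_eq_local:
  assumes "g \<in> borel_measurable borel" "\<And>p. p \<notin> K \<Longrightarrow> g p = 0"
  shows "(LINT p|lborel. g p) = (LINT p|local_lebesgue K. (g p :: real))"
  unfolding integral_local_lebesgue[OF K_sets assms(1)]
  by (intro Bochner_Integration.integral_cong) (auto simp: indicator_def assms(2))

end

text \<open>\<open>K\<close> may be any compact set off which \<open>\<phi>\<close> vanishes, not
  just the one from \<open>test_fun\<close>. Its complement is open, so \<open>\<phi>\<close>
  vanishes along short segments there and the derivatives vanish too.\<close>

lemma test_fun_test_function:
  assumes "test_fun T \<phi>" and K: "compact K" "\<And>p. p \<notin> K \<Longrightarrow> \<phi> (fst p) (snd p) = 0"
  shows "test_function (\<lambda>p. \<phi> (fst p) (snd p)) (\<lambda>p. dt \<phi> (fst p) (snd p)) (\<lambda>p. dx \<phi> (fst p) (snd p)) K"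
proof
  have s: "smooth2 \<phi>" using assms by (simp add: test_fun_def)
  have c: "continuous_on UNIV (\<lambda>p. iter_partial ds \<phi> (fst p) (snd p))"
      "(\<lambda>s. iter_partial ds \<phi> s x) differentiable at t"
      "(\<lambda>y. iter_partial ds \<phi> t y) differentiable at x" for ds t x
    using s unfolding smooth2_def by blast+
  show "continuous_on UNIV (\<lambda>p. \<phi> (fst p) (snd p))" using c(1)[of "[]"] by simp
  show "continuous_on UNIV (\<lambda>p. dt \<phi> (fst p) (snd p))" using c(1)[of "[True]"] by simp
  show "continuous_on UNIV (\<lambda>p. dx \<phi> (fst p) (snd p))" using c(1)[of "[False]"] by simp
  show t: "((\<lambda>s. \<phi> (fst (s, x)) (snd (s, x))) has_real_derivative dt \<phi> (fst (t, x)) (snd (t, x))) (at t)" for t x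
    using c(2)[of "[]" x t] DERIV_deriv_iff_real_differentiable by (simp add: dt_def)
  show x: "((\<lambda>y. \<phi> (fst (t, y)) (snd (t, y))) has_real_derivative dx \<phi> (fst (t, x)) (snd (t, x))) (at x)" for t x
    using c(3)[of "[]" t x] DERIV_deriv_iff_real_differentiable by (simp add: dx_def)
  show "compact K" by fact
  show "p \<notin> K \<Longrightarrow> \<phi> (fst p) (snd p) = 0" for p by fact
  have z: "D = 0" if "p \<notin> K" and d: "((\<lambda>s. \<phi> (fst (p + s *\<^sub>R b)) (snd (p + s *\<^sub>R b))) has_real_derivative D) (at 0)"
    for p b D
  proof -
    have "open (- K)" using K by (simp add: compact_imp_closed open_Compl)
    then have "eventually (\<lambda>y. y \<in> - K) (nhds p)" using that(1) by (intro eventually_nhds_in_open) auto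
    moreover have "filterlim (\<lambda>s::real. p + s *\<^sub>R b) (nhds (p + 0 *\<^sub>R b)) (nhds 0)"
      by (intro tendsto_intros filterlim_ident)
    ultimately have "eventually (\<lambda>s::real. p + s *\<^sub>R b \<in> - K) (nhds 0)"
      using filterlim_iff[of "\<lambda>s::real. p + s *\<^sub>R b" "nhds p" "nhds 0"] by auto
    then have "eventually (\<lambda>s. \<phi> (fst (p + s *\<^sub>R b)) (snd (p + s *\<^sub>R b)) = 0) (nhds 0)"
      by (rule eventually_mono) (rule K(2), simp)
    then have "((\<lambda>s. 0) has_real_derivative D) (at 0)"
      using d by (subst (asm) DERIV_cong_ev[OF refl _ refl]) auto
    then show ?thesis using DERIV_unique DERIV_const by blast
  qed
  show "dt \<phi> (fst p) (snd p) = 0" if "p \<notin> K" for p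
    using z[OF that, of "(1, 0)"] t[of "snd p" "fst p"]
      partial_derivative_iff(1)[of "\<lambda>p. \<phi> (fst p) (snd p)" "snd p" "dt \<phi> (fst p) (snd p)" "fst p"] by simp
  show "dx \<phi> (fst p) (snd p) = 0" if "p \<notin> K" for p
    using z[OF that, of "(0, 1)"] x[of "fst p" "snd p"]
      partial_derivative_iff(2)[of "\<lambda>p. \<phi> (fst p) (snd p)" "fst p" "dx \<phi> (fst p) (snd p)" "snd p"] by simp
qed

context mollifier
begin

text \<open>The weak equation is tested with the kernel reflected about \<open>p\<close>. The margin
  \<open>d\<close> at both ends keeps its support inside the open strip; both derivatives acquire a
  minus sign, which is harmless.\<close>

lemma mollified_equation:
  assumes weak: "\<And>\<phi>. test_fun T \<phi> \<Longrightarrow>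
      (LINT p|lborel. v p * dt \<phi> (fst p) (snd p) + a (v p) * dx \<phi> (fst p) (snd p)) = 0"
    and [measurable]: "v \<in> borel_measurable borel" "(\<lambda>p. a (v p)) \<in> borel_measurable borel"
    and bd: "\<And>p. \<bar>v p\<bar> \<le> R" "\<And>p. \<bar>a (v p)\<bar> \<le> R'"
    and p: "d < fst p" "fst p < T - d"
  shows "conv v kt p + conv (\<lambda>z. a (v z)) kx p = 0"
proof -
  obtain t x where tx: "p = (t, x)" by (cases p)
  define \<phi> where "\<phi> s y = k (t - s, x - y)" for s y
  have minus: "((\<lambda>s. F (c - s)) has_real_derivative - D) (at r)"
    if "(F has_real_derivative D) (at (c - r))" for F c D r
    by (rule DERIV_cong[OF DERIV_chain2[where f=F and g="\<lambda>s. c - s", OF that]]) (auto intro!: derivative_eq_intros)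
  have dt: "dt \<phi> s y = - kt (t - s, x - y)" for s y
    unfolding dt_def \<phi>_def by (rule DERIV_imp_deriv[OF minus[OF kt]])
  have dx: "dx \<phi> s y = - kx (t - s, x - y)" for s y
    unfolding dx_def \<phi>_def by (rule DERIV_imp_deriv[OF minus[OF kx]])
  have "test_fun T \<phi>" unfolding test_fun_def
  proof (intro conjI exI[of _ "{t - d..t + d} \<times> {x - e..x + e}"] allI impI)
    show "smooth2 \<phi>" unfolding \<phi>_def using smooth2_reflected_kernel[OF kernels(1) pos(2,3)] .
    show "compact ({t - d..t + d} \<times> {x - e..x + e})" by (intro compact_Times) auto
    show "{t - d..t + d} \<times> {x - e..x + e} \<subseteq> {0<..<T} \<times> UNIV" using p tx by auto
    fix s y assume "(s, y) \<notin> {t - d..t + d} \<times> {x - e..x + e}"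
    then show "\<phi> s y = 0" unfolding \<phi>_def
      by (intro kernels_eq_0[OF kernels(1) pos(2,3)]) auto
  qed
  from weak[OF this]
  have "(LINT z|lborel. - (v z * kt (p - z)) - a (v z) * kx (p - z)) = 0"
    by (simp add: dt dx tx minus_prod_def split_beta)
  moreover have "integrable lborel (\<lambda>z. v z * kt (p - z))"
    by (rule kt.integrable_conv) (auto intro: bd)
  moreover have "integrable lborel (\<lambda>z. a (v z) * kx (p - z))"
    by (rule kx.integrable_conv) (auto intro: bd)
  ultimately show ?thesis by (simp add: conv_def)
qed

text \<open>By the chain rule and \<open>w_t = - A_x\<close>, the quantity
  \<open>\<eta>(w)_t + [q(w) + \<eta>'(w) (A - a(w))]_x\<close> equals
  \<open>\<eta>''(w) w_x (A - a(w))\<close>: the terms with \<open>A_x\<close> cancel, and so do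
  those with \<open>a'(w) w_x\<close>. Multiplying by \<open>f\<close> and integrating by parts
  gives the claim.\<close>

lemma entropy_identity:
  assumes test: "test_function f ft fx K"
    and a: "\<And>x. (a has_real_derivative a' x) (at x)" "continuous_on UNIV a'"
    and \<eta>: "\<And>x. (\<eta> has_real_derivative \<eta>' x) (at x)" "\<And>x. (\<eta>' has_real_derivative \<eta>'' x) (at x)"
      "continuous_on UNIV \<eta>''"
    and q: "\<And>x. (q has_real_derivative \<eta>' x * a' x) (at x)"
    and v: "v \<in> borel_measurable borel" "\<And>p. \<bar>v p\<bar> \<le> R"
    and av: "(\<lambda>z. a (v z)) \<in> borel_measurable borel" "\<And>p. \<bar>a (v p)\<bar> \<le> R'"
    and eq: "\<And>p. p \<in> K \<Longrightarrow> conv v kt p + conv (\<lambda>z. a (v z)) kx p = 0"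
  defines "w \<equiv> conv v k" and "A \<equiv> conv (\<lambda>z. a (v z)) k"
  shows "- (LINT p|lborel. \<eta> (w p) * ft p + q (w p) * fx p)
    = (LINT p|lborel. (fx p * \<eta>' (w p) + f p * \<eta>'' (w p) * conv v kx p) * (A p - a (w p)))"
    (is "- ?I = ?J")
proof -
  interpret test_function f ft fx K by fact
  have cont_of: "continuous_on UNIV g" if "\<And>x. (g has_real_derivative g' x) (at x)" for g g' :: "real \<Rightarrow> real"
    using that by (meson DERIV_isCont continuous_at_imp_continuous_on)
  have ce: "continuous_on UNIV a" "continuous_on UNIV \<eta>" "continuous_on UNIV \<eta>'" "continuous_on UNIV q"
    using cont_of[OF a(1)] cont_of[OF \<eta>(1)] cont_of[OF \<eta>(2)] cont_of[OF q] by auto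
  have cw: "continuous_on UNIV w" "continuous_on UNIV A" "continuous_on UNIV (conv v kt)"
      "continuous_on UNIV (conv v kx)" "continuous_on UNIV (conv (\<lambda>z. a (v z)) kx)"
    unfolding w_def A_def
    by (rule k.continuous_on_conv[OF v] k.continuous_on_conv[OF av] kt.continuous_on_conv[OF v]
        kx.continuous_on_conv[OF v] kx.continuous_on_conv[OF av])+
  have comp: "continuous_on UNIV (\<lambda>p. g (w p))" if "continuous_on UNIV g" for g :: "real \<Rightarrow> real"
    by (rule continuous_on_compose2[OF that cw(1)]) auto
  note [continuous_intros] = cw comp[OF ce(1)] comp[OF ce(2)] comp[OF ce(3)] comp[OF ce(4)]
    comp[OF a(2)] comp[OF \<eta>(3)] cont
  have wt: "((\<lambda>s. w (s, x)) has_real_derivative conv v kt (t, x)) (at t)" for t x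
    unfolding w_def by (rule conv_kernels_partial(1)[OF kernels(1,2) pos(2,3) v kt])
  have wx: "((\<lambda>y. w (t, y)) has_real_derivative conv v kx (t, x)) (at x)" for t x
    unfolding w_def by (rule conv_kernels_partial(2)[OF kernels(1,3) pos(2,3) v kx])
  have Ax: "((\<lambda>y. A (t, y)) has_real_derivative conv (\<lambda>z. a (v z)) kx (t, x)) (at x)" for t x
    unfolding A_def by (rule conv_kernels_partial(2)[OF kernels(1,3) pos(2,3) av kx])
  \<comment> \<open>\<open>Gt\<close> and \<open>Hx\<close> are the total derivatives of
    \<open>f\<close> times the density and of \<open>f\<close> times the corrected flux, so both
    integrate to 0.\<close>
  define Gt where "Gt p = f p * (\<eta>' (w p) * conv v kt p) + ft p * \<eta> (w p)" for p
  define Hx where "Hx p = f p * (\<eta>' (w p) * a' (w p) * conv v kx p +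
      (\<eta>' (w p) * (conv (\<lambda>z. a (v z)) kx p - a' (w p) * conv v kx p) + \<eta>'' (w p) * conv v kx p * (A p - a (w p))))
      + fx p * (q (w p) + \<eta>' (w p) * (A p - a (w p)))" for p
  obtain r1 where "compact_kernel (\<lambda>p. f p * \<eta> (w p)) r1"
    using compact_kernel_mult[OF cont(1) _ supp(1)] continuous_intros by metis
  then have z1: "\<And>p. r1 < norm p \<Longrightarrow> f p * \<eta> (w p) = 0" by (rule compact_kernel.supp)
  have cH: "continuous_on UNIV (\<lambda>p. q (w p) + \<eta>' (w p) * (A p - a (w p)))" by (intro continuous_intros)
  obtain r2 where "compact_kernel (\<lambda>p. f p * (q (w p) + \<eta>' (w p) * (A p - a (w p)))) r2"
    using compact_kernel_mult[OF cont(1) cH supp(1)] by metis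
  then have z2: "\<And>p. r2 < norm p \<Longrightarrow> f p * (q (w p) + \<eta>' (w p) * (A p - a (w p))) = 0"
    by (rule compact_kernel.supp)
  have I1: "integrable lborel Gt \<and> (LINT p|lborel. Gt p) = 0"
  proof (rule integral_partial_eq_0(1)[OF z1])
    show "continuous_on UNIV Gt" unfolding Gt_def by (intro continuous_intros)
    show "((\<lambda>s. f (s, x) * \<eta> (w (s, x))) has_real_derivative Gt (t, x)) (at t)" for t x
      unfolding Gt_def by (rule DERIV_mult'[OF deriv_t DERIV_chain2[OF \<eta>(1) wt]])
  qed
  have I2: "integrable lborel Hx \<and> (LINT p|lborel. Hx p) = 0"
  proof (rule integral_partial_eq_0(2)[OF z2])
    show "continuous_on UNIV Hx" unfolding Hx_def by (intro continuous_intros)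
    show "((\<lambda>y. f (t, y) * (q (w (t, y)) + \<eta>' (w (t, y)) * (A (t, y) - a (w (t, y))))) has_real_derivative Hx (t, x)) (at x)" for t x
      unfolding Hx_def
      by (intro DERIV_mult' deriv_x DERIV_add DERIV_diff DERIV_chain2[OF q wx] DERIV_chain2[OF \<eta>(2) wx]
          Ax DERIV_chain2[OF a(1) wx])
  qed
  have "Gt p + Hx p = (\<eta> (w p) * ft p + q (w p) * fx p)
      + (fx p * \<eta>' (w p) + f p * \<eta>'' (w p) * conv v kx p) * (A p - a (w p))" for p
  proof -
    \<comment> \<open>The mollified equation is available only on \<open>K\<close>; elsewhere
      \<open>f\<close> vanishes.\<close>
    have "f p * (\<eta>' (w p) * (conv v kt p + conv (\<lambda>z. a (v z)) kx p)) = 0"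
      using eq[of p] supp(1)[of p] by (cases "p \<in> K") auto
    then show ?thesis unfolding Gt_def Hx_def by (simp add: algebra_simps)
  qed
  then have "(LINT p|lborel. (\<eta> (w p) * ft p + q (w p) * fx p)
      + (fx p * \<eta>' (w p) + f p * \<eta>'' (w p) * conv v kx p) * (A p - a (w p))) = (LINT p|lborel. Gt p + Hx p)"
    by simp
  also have "\<dots> = 0" using I1 I2 by simp
  finally have sum: "(LINT p|lborel. (\<eta> (w p) * ft p + q (w p) * fx p)
      + (fx p * \<eta>' (w p) + f p * \<eta>'' (w p) * conv v kx p) * (A p - a (w p))) = 0" .
  have i1: "integrable lborel (\<lambda>p. \<eta> (w p) * ft p + q (w p) * fx p)"
  proof -
    have "integrable lborel (\<lambda>p. ft p * \<eta> (w p))"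
      using integrable_mult[OF cont(2) comp[OF ce(2)] supp(2)] by simp
    moreover have "integrable lborel (\<lambda>p. fx p * q (w p))"
      using integrable_mult[OF cont(3) comp[OF ce(4)] supp(3)] by simp
    ultimately show ?thesis by (simp add: mult.commute)
  qed
  have i2: "integrable lborel (\<lambda>p. (fx p * \<eta>' (w p) + f p * \<eta>'' (w p) * conv v kx p) * (A p - a (w p)))"
    by (rule integrable_mult) (auto intro!: continuous_intros simp: supp)
  show ?thesis using sum i1 i2 by simp
qed

end

section \<open>Estimate of the entropy production\<close>

lemma continuous_bounded_Icc:
  fixes g :: "real \<Rightarrow> real"
  assumes "continuous_on UNIV g"
  shows "\<exists>L\<ge>0. \<forall>x\<in>{lo..hi}. \<bar>g x\<bar> \<le> L"
proof -
  have "compact (g ` {lo..hi})"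
    by (intro compact_continuous_image continuous_on_subset[OF assms]) auto
  then obtain L where "L > 0" "\<forall>x\<in>{lo..hi}. \<bar>g x\<bar> \<le> L"
    by (metis (no_types, lifting) bounded_pos compact_imp_bounded image_eqI real_norm_def)
  then show ?thesis by (intro exI[of _ L]) auto
qed

lemma C1_lipschitz_Icc:
  fixes g :: "real \<Rightarrow> real"
  assumes "\<And>x. (g has_real_derivative g' x) (at x)" "continuous_on UNIV g'"
  shows "\<exists>L\<ge>0. \<forall>x\<in>{lo..hi}. \<forall>y\<in>{lo..hi}. \<bar>g x - g y\<bar> \<le> L * \<bar>x - y\<bar>"
proof -
  obtain L where L: "L \<ge> 0" "\<forall>x\<in>{lo..hi}. \<bar>g' x\<bar> \<le> L"
    using continuous_bounded_Icc[OF assms(2)] by blast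
  have "\<bar>g x - g y\<bar> \<le> L * \<bar>x - y\<bar>" if "x \<in> {lo..hi}" "y \<in> {lo..hi}" for x y
    using field_differentiable_bound[of "{lo..hi}" g g' L x y] that L assms(1)
    by (simp add: has_field_derivative_at_within)
  then show ?thesis using L(1) by blast
qed

text \<open>The situation after clipping: \<open>v\<close> is Borel and lies between
  \<open>lo\<close> and \<open>hi\<close> at every point, so bounds on \<open>v\<close> and on its
  means need no exceptional null set. A single test function \<open>f\<close> with values in
  \<open>{-1..1}\<close> is fixed.\<close>

locale entropy_setup = convex_flux a B + test_function f ft fx K
  for a B f ft fx K +
  fixes T S lo hi :: real and v :: "real \<times> real \<Rightarrow> real" and \<eta> \<eta>' \<eta>'' q :: "real \<Rightarrow> real"
  assumes v_meas [measurable]: "v \<in> borel_measurable borel"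
    and v_range: "\<And>p. lo \<le> v p" "\<And>p. v p \<le> hi"
    and weak: "\<And>\<phi>. test_fun T \<phi> \<Longrightarrow>
      (LINT p|lborel. v p * dt \<phi> (fst p) (snd p) + a (v p) * dx \<phi> (fst p) (snd p)) = 0"
    and \<eta>: "\<And>x. (\<eta> has_real_derivative \<eta>' x) (at x)" "\<And>x. (\<eta>' has_real_derivative \<eta>'' x) (at x)"
      "continuous_on UNIV \<eta>''"
    and q: "\<And>x. (q has_real_derivative \<eta>' x * deriv a x) (at x)"
    and S: "S \<ge> 0" "\<And>x. lo \<le> x \<Longrightarrow> x \<le> hi \<Longrightarrow> \<bar>\<eta>'' x\<bar> \<le> S"
    and f_le_1: "\<And>p. \<bar>f p\<bar> \<le> 1"
    and K_strip: "K \<subseteq> {0<..<T} \<times> UNIV"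
begin

definition R where "R = max \<bar>lo\<bar> \<bar>hi\<bar>"

lemma v_R: "\<bar>v p\<bar> \<le> R"
  using v_range[of p] by (auto simp: R_def)

lemma finite_K: "finite_measure (local_lebesgue K)"
  by (rule finite_measure_local_lebesgue[OF compact])

lemma meas_comp: "continuous_on UNIV g \<Longrightarrow> (\<lambda>p. g (v p)) \<in> borel_measurable borel" for g :: "real \<Rightarrow> real"
  by (rule borel_measurable_continuous_on[OF _ v_meas])

definition production :: real where
  "production = - (LINT p|lborel. \<eta> (v p) * ft p + q (v p) * fx p)"

lemma cont_entropy: "continuous_on UNIV \<eta>" "continuous_on UNIV \<eta>'" "continuous_on UNIV q"
  using \<eta> q by (meson DERIV_isCont continuous_at_imp_continuous_on)+

text \<open>The second condition on \<open>g\<close> expresses that \<open>g\<close> is a Lipschitz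
  function of \<open>v\<close>, so its translation error is \<open>L\<close> times that of
  \<open>v\<close>. It serves \<open>g = v\<close> and \<open>g = a(v)\<close>.\<close>

lemma L1_mean_le:
  assumes "mollifier C d e k kt kx"
    and \<omega>: "\<And>z. \<bar>fst z\<bar> \<le> d \<Longrightarrow> \<bar>snd z\<bar> \<le> e \<Longrightarrow> (LINT p|local_lebesgue K. \<bar>v (p - z) - v p\<bar>) \<le> \<omega>"
    and g [measurable]: "g \<in> borel_measurable borel" and g_bd: "\<And>p. \<bar>g p\<bar> \<le> b"
    and L: "L \<ge> 0" "\<And>p z. \<bar>g z - g p\<bar> \<le> L * \<bar>v z - v p\<bar>"
  shows "integrable (local_lebesgue K) (\<lambda>p. \<bar>conv g k p - g p\<bar>)"
    and "(LINT p|local_lebesgue K. \<bar>conv g k p - g p\<bar>) \<le> C * L * \<omega>"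
proof -
  interpret mollifier C d e k kt kx by fact
  interpret Q: unit_measure Q by (rule unit_measure_Q)
  interpret KM: finite_measure "local_lebesgue K" by (rule finite_K)
  have [measurable]: "conv g k \<in> borel_measurable borel"
    by (rule borel_measurable_continuous_onI[OF k.continuous_on_conv[OF g g_bd]])
  have gb: "- b \<le> g z" "g z \<le> b" for z using g_bd[of z] by auto
  have cb: "\<bar>conv g k p - g p\<bar> \<le> 2 * b" for p
    using mean_bounds[OF g gb, of p] gb[of p] by (simp add: abs_le_iff)
  show int: "integrable (local_lebesgue K) (\<lambda>p. \<bar>conv g k p - g p\<bar>)"
    using cb by (intro KM.integrable_const_bound[of _ "2 * b"]) auto
  have g2: "\<bar>g (p - z) - g p\<bar> \<le> 2 * b" for p z
    using gb[of "p - z"] gb[of p] by (simp add: abs_le_iff)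
  have "\<bar>LINT z|Q. \<bar>g (p - z) - g p\<bar>\<bar> \<le> 2 * b" for p
  proof -
    have "\<bar>LINT z|Q. \<bar>g (p - z) - g p\<bar>\<bar> \<le> (LINT z|Q. 2 * b)"
    proof (rule abs_integral_le)
      show "integrable Q (\<lambda>z. \<bar>g (p - z) - g p\<bar>)"
        using g2 by (intro Q.bounded_integrable[of _ "2 * b"]) auto
      show "\<bar>\<bar>g (p - z) - g p\<bar>\<bar> \<le> 2 * b" for z unfolding abs_idempotent by (rule g2)
    qed simp
    then show ?thesis using Q.measure_space_1 by simp
  qed
  then have int2: "integrable (local_lebesgue K) (\<lambda>p. LINT z|Q. \<bar>g (p - z) - g p\<bar>)"
    by (intro KM.integrable_const_bound[of _ "2 * b"]) auto
  have "(LINT p|local_lebesgue K. \<bar>conv g k p - g p\<bar>) \<le> (LINT p|local_lebesgue K. C * (LINT z|Q. \<bar>g (p - z) - g p\<bar>))"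
    using int int2 mean_deviation[OF g g_bd] by (intro integral_mono) auto
  also have "\<dots> = C * (LINT p|local_lebesgue K. LINT z|Q. \<bar>g (p - z) - g p\<bar>)" by simp
  also have "\<dots> \<le> C * (L * \<omega>)"
  proof (intro mult_left_mono integral_average_le[OF finite_K unit_measure_Q, where K="2 * b"])
    show "(\<lambda>(p, z). \<bar>g (p - z) - g p\<bar>) \<in> borel_measurable (local_lebesgue K \<Otimes>\<^sub>M Q)" by measurable
    show "AE z in Q. (LINT p|local_lebesgue K. \<bar>g (p - z) - g p\<bar>) \<le> L * \<omega>"
      using AE_Q
    proof eventually_elim
      case (elim z)
      have "\<bar>v (p - z) - v p\<bar> \<le> 2 * R" for p using v_R[of "p - z"] v_R[of p] by simp
      then have iv: "integrable (local_lebesgue K) (\<lambda>p. \<bar>v (p - z) - v p\<bar>)"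
        by (intro KM.integrable_const_bound[of _ "2 * R"]) auto
      have "integrable (local_lebesgue K) (\<lambda>p. \<bar>g (p - z) - g p\<bar>)"
        using g2 by (intro KM.integrable_const_bound[of _ "2 * b"]) auto
      then have "(LINT p|local_lebesgue K. \<bar>g (p - z) - g p\<bar>) \<le> (LINT p|local_lebesgue K. L * \<bar>v (p - z) - v p\<bar>)"
        using iv L(2) by (intro integral_mono) auto
      also have "\<dots> = L * (LINT p|local_lebesgue K. \<bar>v (p - z) - v p\<bar>)" by simp
      also have "\<dots> \<le> L * \<omega>" using elim \<omega> L(1) by (intro mult_left_mono) (auto simp: mem_box)
      finally show ?case .
    qed
  qed (use g2 pos in auto)
  finally show "(LINT p|local_lebesgue K. \<bar>conv g k p - g p\<bar>) \<le> C * L * \<omega>" by simp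
qed

lemma test_bounds: "\<exists>F\<ge>0. \<forall>p. \<bar>ft p\<bar> \<le> F \<and> \<bar>fx p\<bar> \<le> F"
proof -
  obtain r1 where "compact_kernel (\<lambda>p. ft p * 1) r1"
    using compact_kernel_mult[OF cont(2) _ supp(2), of "\<lambda>_. 1"] by auto
  then obtain F1 where F1: "F1 > 0" "\<And>p. \<bar>ft p\<bar> \<le> F1" using compact_kernel.bounded by force
  obtain r2 where "compact_kernel (\<lambda>p. fx p * 1) r2"
    using compact_kernel_mult[OF cont(3) _ supp(3), of "\<lambda>_. 1"] by auto
  then obtain F2 where F2: "F2 > 0" "\<And>p. \<bar>fx p\<bar> \<le> F2" using compact_kernel.bounded by force
  have "\<bar>ft p\<bar> \<le> F1 + F2 \<and> \<bar>fx p\<bar> \<le> F1 + F2" for p using F1(1) F2(1) F1(2)[of p] F2(2)[of p] by linarith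
  then show ?thesis using F1(1) F2(1) by (intro exI[of _ "F1 + F2"]) auto
qed

text \<open>\<open>M\<close> is chosen before the mollifier and depends on the test function and the
  nonlinearities only. Hence the first term tends to 0 with the L^1 translation error
  \<open>\<omega>\<close>, and only the commutator term, with the sharp factor \<open>S\<close>,
  survives.\<close>

lemma production_le_commutator:
  "\<exists>M\<ge>0. \<forall>C d e k kt kx \<omega>. mollifier C d e k kt kx \<longrightarrow> (\<forall>p\<in>K. d < fst p \<and> fst p < T - d) \<longrightarrow>
     (\<forall>z. \<bar>fst z\<bar> \<le> d \<longrightarrow> \<bar>snd z\<bar> \<le> e \<longrightarrow> (LINT p|local_lebesgue K. \<bar>v (p - z) - v p\<bar>) \<le> \<omega>) \<longrightarrow>
     production \<le> M * C * \<omega>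
       + S * (LINT p|local_lebesgue K. \<bar>conv v kx p\<bar> * (conv (\<lambda>z. a (v z)) k p - a (conv v k p)))"
proof -
  obtain F where F: "F \<ge> 0" "\<And>p. \<bar>ft p\<bar> \<le> F" "\<And>p. \<bar>fx p\<bar> \<le> F" using test_bounds by blast
  obtain La where La: "La \<ge> 0" "\<forall>x\<in>{lo..hi}. \<forall>y\<in>{lo..hi}. \<bar>a x - a y\<bar> \<le> La * \<bar>x - y\<bar>"
    using C1_lipschitz_Icc[OF a cont_deriv] by blast
  obtain L1 where L1: "L1 \<ge> 0" "\<forall>x\<in>{lo..hi}. \<forall>y\<in>{lo..hi}. \<bar>\<eta> x - \<eta> y\<bar> \<le> L1 * \<bar>x - y\<bar>"
    using C1_lipschitz_Icc[OF \<eta>(1) cont_entropy(2)] by blast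
  obtain L2 where L2: "L2 \<ge> 0" "\<forall>x\<in>{lo..hi}. \<forall>y\<in>{lo..hi}. \<bar>q x - q y\<bar> \<le> L2 * \<bar>x - y\<bar>"
    using C1_lipschitz_Icc[OF q] continuous_on_mult[OF cont_entropy(2) cont_deriv] by blast
  obtain E where E: "E \<ge> 0" "\<forall>x\<in>{lo..hi}. \<bar>\<eta>' x\<bar> \<le> E"
    using continuous_bounded_Icc[OF cont_entropy(2)] by blast
  obtain Ra where Ra: "Ra \<ge> 0" "\<forall>x\<in>{lo..hi}. \<bar>a x\<bar> \<le> Ra"
    using continuous_bounded_Icc[OF cont_a] by blast
  \<comment> \<open>The first summand comes from \<open>fx * \<eta>'(w)\<close> times the
    commutator, whose L^1 norm is at most \<open>2 * La * C * \<omega>\<close>; the second from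
    replacing \<open>v\<close> by \<open>w\<close> in \<open>\<eta>\<close> and
    \<open>q\<close>.\<close>
  define M where "M = F * E * (2 * La) + (L1 * F + L2 * F)"
  have "production \<le> M * C * \<omega>
       + S * (LINT p|local_lebesgue K. \<bar>conv v kx p\<bar> * (conv (\<lambda>z. a (v z)) k p - a (conv v k p)))"
    if moll: "mollifier C d e k kt kx" and dK: "\<forall>p\<in>K. d < fst p \<and> fst p < T - d"
      and \<omega>: "\<forall>z. \<bar>fst z\<bar> \<le> d \<longrightarrow> \<bar>snd z\<bar> \<le> e \<longrightarrow> (LINT p|local_lebesgue K. \<bar>v (p - z) - v p\<bar>) \<le> \<omega>"
    for C d e k kt kx \<omega>
  proof -
    interpret mollifier C d e k kt kx by fact
    interpret KM: finite_measure "local_lebesgue K" by (rule finite_K)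
    have av [measurable]: "(\<lambda>z. a (v z)) \<in> borel_measurable borel" by (rule meas_comp[OF cont_a])
    have vI: "v p \<in> {lo..hi}" for p using v_range[of p] by simp
    have avR: "\<bar>a (v p)\<bar> \<le> Ra" for p using Ra(2) vI by blast
    define w where "w = conv v k"
    define A where "A = conv (\<lambda>z. a (v z)) k"
    define g where "g p = A p - a (w p)" for p
    have wI: "w p \<in> {lo..hi}" for p unfolding w_def using mean_bounds[OF v_meas v_range, of p] by simp
    have cw: "continuous_on UNIV w" "continuous_on UNIV A" "continuous_on UNIV (conv v kx)"
      unfolding w_def A_def using k.continuous_on_conv[OF v_meas v_R] k.continuous_on_conv[OF av avR]
        kx.continuous_on_conv[OF v_meas v_R] by auto
    have comp: "continuous_on UNIV (\<lambda>p. h (w p))" if "continuous_on UNIV h" for h :: "real \<Rightarrow> real"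
      by (rule continuous_on_compose2[OF that cw(1)]) auto
    have cg: "continuous_on UNIV g" unfolding g_def by (intro continuous_intros cw comp cont_a)
    note m [measurable] = borel_measurable_continuous_onI[OF cw(1)] borel_measurable_continuous_onI[OF cw(2)]
      borel_measurable_continuous_onI[OF cw(3)] borel_measurable_continuous_onI[OF cg]
      borel_measurable_continuous_onI[OF comp[OF cont_entropy(1)]]
      borel_measurable_continuous_onI[OF comp[OF cont_entropy(2)]]
      borel_measurable_continuous_onI[OF comp[OF cont_entropy(3)]]
      borel_measurable_continuous_onI[OF comp[OF \<eta>(3)]]
      meas_comp[OF cont_entropy(1)] meas_comp[OF cont_entropy(3)]
    have g_nonneg: "0 \<le> g p" for p unfolding g_def w_def A_def
      by (rule commutator_pointwise(1)[OF convex_flux_axioms v_meas v_R])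
    have iv: "integrable (local_lebesgue K) (\<lambda>p. \<bar>w p - v p\<bar>)" "(LINT p|local_lebesgue K. \<bar>w p - v p\<bar>) \<le> C * 1 * \<omega>"
      unfolding w_def by (rule L1_mean_le[OF moll \<omega>[rule_format] v_meas v_R, of 1]; simp)+
    have ia: "integrable (local_lebesgue K) (\<lambda>p. \<bar>A p - a (v p)\<bar>)" "(LINT p|local_lebesgue K. \<bar>A p - a (v p)\<bar>) \<le> C * La * \<omega>"
      unfolding A_def using La vI by (intro L1_mean_le[OF moll \<omega>[rule_format] av avR, of La]; simp)+
    have g_le: "g p \<le> \<bar>A p - a (v p)\<bar> + La * \<bar>w p - v p\<bar>" for p
    proof -
      have "\<bar>a (w p) - a (v p)\<bar> \<le> La * \<bar>w p - v p\<bar>" using La(2) wI vI by blast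
      then show ?thesis unfolding g_def by linarith
    qed
    have bound_int: "integrable (local_lebesgue K) h" if "continuous_on UNIV h" for h :: "real \<times> real \<Rightarrow> real"
    proof -
      have "compact (h ` K)" by (rule compact_continuous_image[OF continuous_on_subset[OF that] compact]) simp
      then obtain b where "\<And>p. p \<in> K \<Longrightarrow> \<bar>h p\<bar> \<le> b"
        using compact_imp_bounded[THEN bounded_iff[THEN iffD1]] by (metis image_eqI real_norm_def)
      then have "AE p in local_lebesgue K. norm (h p) \<le> b"
        using AE_local_lebesgue[OF K_sets] by (auto elim!: eventually_mono)
      moreover have "h \<in> borel_measurable (local_lebesgue K)"
        using borel_measurable_continuous_onI[OF that] by simp
      ultimately show ?thesis by (rule KM.integrable_const_bound)
    qed
    have ig: "integrable (local_lebesgue K) g" by (rule bound_int[OF cg])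
    have iwg: "integrable (local_lebesgue K) (\<lambda>p. \<bar>conv v kx p\<bar> * g p)"
      by (intro bound_int continuous_intros cw cg)
    have g_int: "(LINT p|local_lebesgue K. g p) \<le> 2 * La * C * \<omega>"
    proof -
      have "(LINT p|local_lebesgue K. g p) \<le> (LINT p|local_lebesgue K. \<bar>A p - a (v p)\<bar> + La * \<bar>w p - v p\<bar>)"
        using ig iv ia g_le by (intro integral_mono) auto
      also have "\<dots> = (LINT p|local_lebesgue K. \<bar>A p - a (v p)\<bar>) + La * (LINT p|local_lebesgue K. \<bar>w p - v p\<bar>)"
        using iv ia by simp
      also have "\<dots> \<le> C * La * \<omega> + La * (C * 1 * \<omega>)" using ia(2) iv(2) La(1) by (intro add_mono mult_left_mono) auto
      finally show ?thesis by (simp add: algebra_simps)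
    qed
    \<comment> \<open>\<open>J\<close> is the integrand on the right of
      \<open>entropy_identity\<close>; \<open>D\<close> is the error of replacing \<open>v\<close>
      by \<open>w\<close> in the pairing.\<close>
    define J where "J p = (fx p * \<eta>' (w p) + f p * \<eta>'' (w p) * conv v kx p) * g p" for p
    define D where "D p = (\<eta> (w p) - \<eta> (v p)) * ft p + (q (w p) - q (v p)) * fx p" for p
    have [measurable]: "J \<in> borel_measurable borel" "D \<in> borel_measurable borel"
      unfolding J_def D_def by measurable
    have J_le: "\<bar>J p\<bar> \<le> F * E * g p + S * (\<bar>conv v kx p\<bar> * g p)" for p
    proof -
      have "\<bar>fx p * \<eta>' (w p)\<bar> \<le> F * E"
        unfolding abs_mult using E wI[of p] F(3)[of p] F(1) by (intro mult_mono) auto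
      moreover have "\<bar>f p * \<eta>'' (w p) * conv v kx p\<bar> \<le> 1 * S * \<bar>conv v kx p\<bar>"
        unfolding abs_mult using wI[of p] S(2)[of "w p"] f_le_1[of p]
        by (intro mult_right_mono mult_mono) auto
      ultimately have "\<bar>fx p * \<eta>' (w p) + f p * \<eta>'' (w p) * conv v kx p\<bar> \<le> F * E + 1 * S * \<bar>conv v kx p\<bar>"
        by linarith
      then have "\<bar>fx p * \<eta>' (w p) + f p * \<eta>'' (w p) * conv v kx p\<bar> * g p \<le> (F * E + 1 * S * \<bar>conv v kx p\<bar>) * g p"
        using g_nonneg by (rule mult_right_mono)
      then show ?thesis unfolding J_def abs_mult[of _ "g p"] using g_nonneg[of p] by (simp add: algebra_simps)
    qed
    have D_le: "\<bar>D p\<bar> \<le> (L1 * F + L2 * F) * \<bar>w p - v p\<bar>" for p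
    proof -
      have "\<bar>D p\<bar> \<le> (L1 * \<bar>w p - v p\<bar>) * F + (L2 * \<bar>w p - v p\<bar>) * F"
        unfolding D_def using L1 L2 wI[of p] vI[of p] F(2,3)[of p] F(1)
        by (intro order_trans[OF abs_triangle_ineq] add_mono) (auto simp: abs_mult intro!: mult_mono mult_nonneg_nonneg)
      then show ?thesis by (simp add: algebra_simps)
    qed
    have zero: "J p = 0" "D p = 0" if "p \<notin> K" for p using supp[OF that] by (simp_all add: J_def D_def)
    have iJ: "integrable (local_lebesgue K) J"
      by (rule Bochner_Integration.integrable_bound[where f="\<lambda>p. F * E * g p + S * (\<bar>conv v kx p\<bar> * g p)"])
        (use ig iwg J_le in \<open>auto intro!: AE_I2 order_trans[OF _ abs_ge_self]\<close>)
    have iD: "integrable (local_lebesgue K) D"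
      by (rule Bochner_Integration.integrable_bound[where f="\<lambda>p. (L1 * F + L2 * F) * \<bar>w p - v p\<bar>"])
        (use iv D_le in \<open>auto intro!: AE_I2 order_trans[OF _ abs_ge_self]\<close>)
    have J_int: "(LINT p|lborel. J p) \<le> F * E * (2 * La * C * \<omega>) + S * (LINT p|local_lebesgue K. \<bar>conv v kx p\<bar> * g p)"
    proof -
      have "(LINT p|lborel. J p) = (LINT p|local_lebesgue K. J p)" by (rule integral_eq_local) (auto simp: zero)
      also have "\<dots> \<le> (LINT p|local_lebesgue K. F * E * g p + S * (\<bar>conv v kx p\<bar> * g p))"
        using iJ ig iwg J_le abs_le_D1 by (intro integral_mono) auto
      also have "\<dots> = F * E * (LINT p|local_lebesgue K. g p) + S * (LINT p|local_lebesgue K. \<bar>conv v kx p\<bar> * g p)"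
        using ig iwg by simp
      also have "\<dots> \<le> F * E * (2 * La * C * \<omega>) + S * (LINT p|local_lebesgue K. \<bar>conv v kx p\<bar> * g p)"
        using g_int F(1) E(1) by (intro add_right_mono mult_left_mono) auto
      finally show ?thesis .
    qed
    have D_int: "(LINT p|lborel. D p) \<le> (L1 * F + L2 * F) * (C * \<omega>)"
    proof -
      have "(LINT p|lborel. D p) = (LINT p|local_lebesgue K. D p)" by (rule integral_eq_local) (auto simp: zero)
      also have "\<dots> \<le> (LINT p|local_lebesgue K. (L1 * F + L2 * F) * \<bar>w p - v p\<bar>)"
        using iD iv D_le abs_le_D1 by (intro integral_mono) auto
      also have "\<dots> = (L1 * F + L2 * F) * (LINT p|local_lebesgue K. \<bar>w p - v p\<bar>)" by simp
      also have "\<dots> \<le> (L1 * F + L2 * F) * (C * \<omega>)"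
        using iv(2) L1(1) L2(1) F(1) by (intro mult_left_mono) auto
      finally show ?thesis .
    qed
    have "production = - (LINT p|lborel. \<eta> (w p) * ft p + q (w p) * fx p) + (LINT p|lborel. D p)"
    proof -
      have 1: "integrable lborel (\<lambda>p. \<eta> (w p) * ft p + q (w p) * fx p)"
      proof -
        have "integrable lborel (\<lambda>p. ft p * \<eta> (w p))"
          using integrable_mult[OF cont(2) comp[OF cont_entropy(1)] supp(2)] by simp
        moreover have "integrable lborel (\<lambda>p. fx p * q (w p))"
          using integrable_mult[OF cont(3) comp[OF cont_entropy(3)] supp(3)] by simp
        ultimately show ?thesis by (simp add: mult.commute)
      qed
      have 2: "integrable lborel D"
      proof -
        have "integrable lborel (\<lambda>p. indicat_real K p *\<^sub>R D p)"
          using iD unfolding local_lebesgue_def by (subst (asm) integrable_density) auto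
        moreover have "(\<lambda>p. indicat_real K p *\<^sub>R D p) = D"
        proof
          fix p show "indicat_real K p *\<^sub>R D p = D p" using zero(2)[of p] by (cases "p \<in> K") auto
        qed
        ultimately show ?thesis by (simp only:)
      qed
      have "(LINT p|lborel. \<eta> (v p) * ft p + q (v p) * fx p)
          = (LINT p|lborel. (\<eta> (w p) * ft p + q (w p) * fx p) - D p)"
        by (intro Bochner_Integration.integral_cong) (auto simp: D_def algebra_simps)
      then show ?thesis using 1 2 unfolding production_def by simp
    qed
    also have "- (LINT p|lborel. \<eta> (w p) * ft p + q (w p) * fx p) = (LINT p|lborel. J p)"
      unfolding J_def g_def w_def A_def
    proof (rule entropy_identity[OF test_function_axioms a cont_deriv \<eta> q v_meas v_R av avR])
      fix p assume "p \<in> K"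
      then show "conv v kt p + conv (\<lambda>z. a (v z)) kx p = 0"
        using dK by (intro mollified_equation[OF weak v_meas av v_R avR]) auto
    qed
    finally have "production \<le> F * E * (2 * La * C * \<omega>) + S * (LINT p|local_lebesgue K. \<bar>conv v kx p\<bar> * g p)
        + (L1 * F + L2 * F) * (C * \<omega>)" using J_int D_int by linarith
    also have "\<dots> = M * C * \<omega> + S * (LINT p|local_lebesgue K. \<bar>conv v kx p\<bar> * g p)"
      by (simp add: M_def algebra_simps)
    finally show ?thesis unfolding g_def w_def A_def .
  qed
  moreover have "M \<ge> 0" using F E La L1 L2 by (auto simp: M_def)
  ultimately show ?thesis by blast
qed

end

section \<open>Choice of the scales and passage to the limit\<close>

context entropy_setup
begin

lemma time_margin: "\<exists>d0>0. \<forall>d<d0. \<forall>p\<in>K. d < fst p \<and> fst p < T - d"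
proof (cases "K = {}")
  case True
  then show ?thesis by (intro exI[of _ 1]) auto
next
  case False
  obtain p0 where p0: "p0 \<in> K" "\<forall>p\<in>K. min (fst p0) (T - fst p0) \<le> min (fst p) (T - fst p)"
  proof -
    have "continuous_on K (\<lambda>p. min (fst p) (T - fst p))" by (intro continuous_intros)
    from continuous_attains_inf[OF compact False this] show ?thesis using that by blast
  qed
  have "min (fst p0) (T - fst p0) > 0" using p0(1) K_strip by auto
  then show ?thesis using p0(2) by (intro exI[of _ "min (fst p0) (T - fst p0)"]) fastforce
qed

lemma norm_le_box: "\<bar>fst z\<bar> \<le> d \<Longrightarrow> \<bar>snd z\<bar> \<le> e \<Longrightarrow> norm (z :: real \<times> real) \<le> d + e"
  using norm_Pair_le[of "fst z" "snd z"] by simp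

text \<open>Treats entropies that are affine on the range separately. There the claimed bound is 0
  even if the difference quotients of the cost are unbounded, as \<open>0 * \<infinity> = 0\<close>
  for \<open>ennreal\<close>. No commutator has to be estimated, so one scale serves both
  directions.\<close>

lemma production_nonpos:
  assumes moll: "\<And>d e. d > 0 \<Longrightarrow> e > 0 \<Longrightarrow> \<exists>k kt kx. mollifier C d e k kt kx" and "C > 0"
    and S0: "S = 0"
  shows "production \<le> 0"
proof (rule field_le_epsilon)
  fix \<epsilon> :: real assume \<epsilon>: "\<epsilon> > 0"
  obtain M where M: "M \<ge> 0" "\<And>C d e k kt kx \<omega>. mollifier C d e k kt kx \<Longrightarrow> (\<forall>p\<in>K. d < fst p \<and> fst p < T - d) \<Longrightarrow>
     (\<forall>z. \<bar>fst z\<bar> \<le> d \<longrightarrow> \<bar>snd z\<bar> \<le> e \<longrightarrow> (LINT p|local_lebesgue K. \<bar>v (p - z) - v p\<bar>) \<le> \<omega>) \<Longrightarrow>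
     production \<le> M * C * \<omega>
       + S * (LINT p|local_lebesgue K. \<bar>conv v kx p\<bar> * (conv (\<lambda>z. a (v z)) k p - a (conv v k p)))"
    using production_le_commutator by blast
  define \<omega> where "\<omega> = \<epsilon> / (M * C + 1)"
  have MC: "M * C \<ge> 0" using M \<open>C > 0\<close> by simp
  have \<omega>: "\<omega> > 0" "M * C * \<omega> \<le> \<epsilon>" using MC \<epsilon> by (auto simp: \<omega>_def field_simps)
  obtain r where r: "r > 0" "\<And>z. norm z \<le> r \<Longrightarrow> (LINT p|local_lebesgue K. \<bar>v (p - z) - v p\<bar>) \<le> \<omega>"
    using L1_translation_continuous[OF v_meas v_R compact \<omega>(1)] by blast
  obtain d0 where d0: "d0 > 0" "\<forall>d<d0. \<forall>p\<in>K. d < fst p \<and> fst p < T - d" using time_margin by blast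
  define d where "d = min (r / 2) (d0 / 2)"
  have d: "d > 0" "d < d0" "d + d \<le> r" using r(1) d0(1) by (auto simp: d_def)
  obtain k kt kx where m: "mollifier C d d k kt kx" using moll[OF d(1) d(1)] by blast
  have "production \<le> M * C * \<omega>
       + S * (LINT p|local_lebesgue K. \<bar>conv v kx p\<bar> * (conv (\<lambda>z. a (v z)) k p - a (conv v k p)))"
    using d0(2) d norm_le_box[of _ d d] order_trans r(2) by (intro M(2)[OF m]) blast+
  then show "production \<le> 0 + \<epsilon>" using \<omega>(2) S0 by simp
qed

text \<open>The commutator integral is at most \<open>C / e * C\<close> times the cost averaged over
  pairs of offsets in the box. Each pair contributes at most \<open>\<Lambda> * 2 e\<close> for the
  space difference plus \<open>L * e^2\<close> for the time difference, leaving
  \<open>2 * C * C * \<Lambda>\<close> and a term linear in \<open>e\<close>.\<close>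

lemma production_le:
  assumes moll: "\<And>d e. d > 0 \<Longrightarrow> e > 0 \<Longrightarrow> \<exists>k kt kx. mollifier C d e k kt kx" and C: "C > 0"
    and K': "compact K'" and r0: "r0 > 0" "\<And>p z. p \<in> K \<Longrightarrow> norm z \<le> r0 \<Longrightarrow> p - z \<in> K'"
    and h0: "h0 > 0" "\<And>h. h \<noteq> 0 \<Longrightarrow> \<bar>h\<bar> < h0 \<Longrightarrow>
      (LINT p|local_lebesgue K'. Delta a (v p) (v (p + (0, h)))) \<le> \<Lambda> * \<bar>h\<bar>"
    and \<Lambda>: "\<Lambda> \<ge> 0"
  shows "production \<le> S * (2 * C * C * \<Lambda>)"
proof (rule field_le_epsilon)
  fix \<epsilon> :: real assume \<epsilon>: "\<epsilon> > 0"
  obtain M where M: "M \<ge> 0" "\<And>C d e k kt kx \<omega>. mollifier C d e k kt kx \<Longrightarrow> (\<forall>p\<in>K. d < fst p \<and> fst p < T - d) \<Longrightarrow>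
     (\<forall>z. \<bar>fst z\<bar> \<le> d \<longrightarrow> \<bar>snd z\<bar> \<le> e \<longrightarrow> (LINT p|local_lebesgue K. \<bar>v (p - z) - v p\<bar>) \<le> \<omega>) \<Longrightarrow>
     production \<le> M * C * \<omega>
       + S * (LINT p|local_lebesgue K. \<bar>conv v kx p\<bar> * (conv (\<lambda>z. a (v z)) k p - a (conv v k p)))"
    using production_le_commutator by blast
  obtain L where L: "L \<ge> 0" "\<And>x y y'. x \<in> {-R..R} \<Longrightarrow> y \<in> {-R..R} \<Longrightarrow> y' \<in> {-R..R} \<Longrightarrow>
      \<bar>Delta a x y - Delta a x y'\<bar> \<le> L * \<bar>y - y'\<bar>"
    using Delta_lipschitz[of R] by blast
  have L': "\<bar>Delta a x y - Delta a x y'\<bar> \<le> L * \<bar>y - y'\<bar>" if "\<bar>x\<bar> \<le> R" "\<bar>y\<bar> \<le> R" "\<bar>y'\<bar> \<le> R" for x y y'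
    using L(2)[of x y y'] that by (simp add: abs_le_iff)
  define \<omega> where "\<omega> = \<epsilon> / 2 / (M * C + 1)"
  have MC: "M * C \<ge> 0" using M C by simp
  have \<omega>: "\<omega> > 0" "M * C * \<omega> \<le> \<epsilon> / 2" using MC \<epsilon> by (auto simp: \<omega>_def field_simps)
  obtain r where r: "r > 0" "\<And>z. norm z \<le> r \<Longrightarrow> (LINT p|local_lebesgue K. \<bar>v (p - z) - v p\<bar>) \<le> \<omega>"
    using L1_translation_continuous[OF v_meas v_R compact \<omega>(1)] by blast
  obtain d0 where d0: "d0 > 0" "\<forall>d<d0. \<forall>p\<in>K. d < fst p \<and> fst p < T - d" using time_margin by blast
  define N where "N = S * (C * C * L)"
  have N: "N \<ge> 0" using S(1) C L(1) by (simp add: N_def)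
  \<comment> \<open>In order: offsets small enough for the translation error
    \<open>\<omega>\<close>; offsets that keep \<open>K\<close> inside \<open>K'\<close>; spatial
    differences \<open>2 e\<close> strictly below \<open>h0\<close>; a remainder
    \<open>N * e\<close> of at most half of \<open>\<epsilon>\<close>.\<close>
  define e where "e = min (min (r / 2) (r0 / 2)) (min (h0 / 3) (\<epsilon> / 2 / (N + 1)))"
  have e: "e > 0" "e + e \<le> r" "e + e \<le> r0" "e + e < h0" "N * e \<le> \<epsilon> / 2"
  proof -
    show "e > 0" using r r0 h0 \<epsilon> N by (auto simp: e_def)
    have "e \<le> r / 2" "e \<le> r0 / 2" "e \<le> h0 / 3" unfolding e_def by linarith+
    then show "e + e \<le> r" "e + e \<le> r0" "e + e < h0" using h0(1) by linarith+
    have "N * e \<le> N * (\<epsilon> / 2 / (N + 1))" using N by (intro mult_left_mono) (auto simp: e_def)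
    also have "\<dots> \<le> \<epsilon> / 2" using N \<epsilon> by (simp add: field_simps)
    finally show "N * e \<le> \<epsilon> / 2" .
  qed
  \<comment> \<open>The tolerance \<open>e * e\<close> beats the factor \<open>1 / e\<close> from
    the derivative of the kernel. Only after this is \<open>d\<close> chosen.\<close>
  obtain r2 where r2: "r2 > 0" "\<And>z. norm z \<le> r2 \<Longrightarrow> (LINT p|local_lebesgue K'. \<bar>v (p - z) - v p\<bar>) \<le> e * e"
    using L1_translation_continuous[OF v_meas v_R K', of "e * e"] e(1) by (metis mult_pos_pos)
  define d where "d = min (min e (r2 / 2)) (d0 / 2)"
  have d: "d > 0" "d < d0" "d \<le> e" "d + d \<le> r2" using r2(1) d0(1) e(1) by (auto simp: d_def)
  obtain k kt kx where m: "mollifier C d e k kt kx" using moll[OF d(1) e(1)] by blast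
  interpret mollifier C d e k kt kx by fact
  interpret Q: unit_measure Q by (rule unit_measure_Q)
  interpret KM: finite_measure "local_lebesgue K" by (rule finite_K)
  define b where "b = \<Lambda> * (e + e) + L * (e * e)"
  have DR: "\<bar>Delta a (v p) (v p')\<bar> \<le> L * (2 * R)" for p p'
  proof -
    have "\<bar>Delta a (v p) (v p') - Delta a (v p) (v p)\<bar> \<le> L * \<bar>v p' - v p\<bar>" by (intro L' v_R)
    also have "\<dots> \<le> L * (2 * R)" using v_R[of p] v_R[of p'] by (intro mult_left_mono L(1)) linarith
    finally show ?thesis using Delta_self by simp
  qed
  have two: "(LINT p|local_lebesgue K. Delta a (v (p - z)) (v (p - z'))) \<le> b" if "z \<in> box" "z' \<in> box" for z z'
  proof -
    obtain s y s' y' where z: "z = (s, y)" "z' = (s', y')" by (cases z; cases z')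
    have sy: "\<bar>s\<bar> \<le> d" "\<bar>y\<bar> \<le> e" "\<bar>s'\<bar> \<le> d" "\<bar>y'\<bar> \<le> e" using that by (auto simp: z mem_box)
    have "(LINT p|local_lebesgue K. Delta a (v (p - (s, y))) (v (p - (s', y'))))
      \<le> (LINT p|local_lebesgue K'. Delta a (v p) (v (p + (0, y - y'))))
        + L * (LINT p|local_lebesgue K'. \<bar>v (p - (s' - s, 0)) - v p\<bar>)"
    proof (rule Delta_two_point_estimate[OF convex_flux_axioms v_meas v_R L(1) L' compact K'])
      have "norm (s, y) \<le> r0" "norm (s, y') \<le> r0"
        using norm_le_box[of "(s, y)" d e] norm_le_box[of "(s, y')" d e] sy d(3) e(3) by auto
      then show "p - (s, y) \<in> K'" "p - (s, y') \<in> K'" if "p \<in> K" for p using r0(2)[OF that] by auto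
    qed
    also have "\<dots> \<le> \<Lambda> * (e + e) + L * (e * e)"
    proof (intro add_mono mult_left_mono L(1))
      show "(LINT p|local_lebesgue K'. Delta a (v p) (v (p + (0, y - y')))) \<le> \<Lambda> * (e + e)"
      \<comment> \<open>The bound by \<open>\<Lambda>\<close> is assumed for nonzero
        \<open>h\<close> only; for \<open>y = y'\<close> the cost vanishes.\<close>
      proof (cases "y = y'")
        case True
        then show ?thesis using \<Lambda> e(1) by (simp add: Delta_self zero_prod_def[symmetric])
      next
        case False
        have "\<bar>y - y'\<bar> \<le> e + e" using sy by linarith
        moreover have "(LINT p|local_lebesgue K'. Delta a (v p) (v (p + (0, y - y')))) \<le> \<Lambda> * \<bar>y - y'\<bar>"
          using False calculation e(4) by (intro h0(2)) auto
        ultimately show ?thesis using \<Lambda> by (meson mult_left_mono order_trans)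
      qed
      have "norm (s' - s, 0::real) \<le> r2" using sy d(4) by (simp add: norm_Pair)
      then show "(LINT p|local_lebesgue K'. \<bar>v (p - (s' - s, 0)) - v p\<bar>) \<le> e * e" by (rule r2(2))
    qed
    finally show ?thesis by (simp add: z b_def)
  qed
  have iD: "integrable Q (\<lambda>z'. Delta a (v (p - z)) (v (p - z')))" for p z
    using DR by (intro Q.bounded_integrable[of _ "L * (2 * R)"]) auto
  have LR: "0 \<le> L * (2 * R)" using DR abs_ge_zero order_trans by blast
  have inner_bd: "\<bar>LINT z'|Q. Delta a (v (p - z)) (v (p - z'))\<bar> \<le> L * (2 * R)" for p z
    using abs_integral_le[OF iD _ DR, of "p" z] Q.measure_space_1 by simp
  have iDD: "integrable Q (\<lambda>z. LINT z'|Q. Delta a (v (p - z)) (v (p - z')))" for p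
    using inner_bd by (intro Q.bounded_integrable[of _ "L * (2 * R)"]) auto
  have double_bd: "\<bar>LINT z|Q. LINT z'|Q. Delta a (v (p - z)) (v (p - z'))\<bar> \<le> L * (2 * R)" for p
    using abs_integral_le[OF iDD _ inner_bd, of p] Q.measure_space_1 by simp
  have iK: "integrable (local_lebesgue K) (\<lambda>p. LINT z|Q. LINT z'|Q. Delta a (v (p - z)) (v (p - z')))"
    using double_bd by (intro KM.integrable_const_bound[of _ "L * (2 * R)"]) auto
  have avg: "(LINT p|local_lebesgue K. LINT z|Q. LINT z'|Q. Delta a (v (p - z)) (v (p - z'))) \<le> b"
  proof (rule integral_average_le[OF finite_K unit_measure_Q, where K="L * (2 * R)"])
    show "(\<lambda>(p, z). LINT z'|Q. Delta a (v (p - z)) (v (p - z'))) \<in> borel_measurable (local_lebesgue K \<Otimes>\<^sub>M Q)"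
      by measurable
    show "AE z in Q. (LINT p|local_lebesgue K. LINT z'|Q. Delta a (v (p - z)) (v (p - z'))) \<le> b"
      using AE_Q
    proof eventually_elim
      case (elim z)
      show ?case
      proof (rule integral_average_le[OF finite_K unit_measure_Q, where K="L * (2 * R)"])
        show "(\<lambda>(p, z'). Delta a (v (p - z)) (v (p - z'))) \<in> borel_measurable (local_lebesgue K \<Otimes>\<^sub>M Q)"
          by measurable
        show "AE z' in Q. (LINT p|local_lebesgue K. Delta a (v (p - z)) (v (p - z'))) \<le> b"
          using AE_Q by eventually_elim (rule two[OF elim])
      qed (rule DR)
    qed
  qed (rule inner_bd)
  have "(LINT p|local_lebesgue K. \<bar>conv v kx p\<bar> * (conv (\<lambda>z. a (v z)) k p - a (conv v k p)))
      \<le> (LINT p|local_lebesgue K. C / e * C * (LINT z|Q. LINT z'|Q. Delta a (v (p - z)) (v (p - z'))))"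
  proof (rule integral_mono')
    show "\<bar>conv v kx p\<bar> * (conv (\<lambda>z. a (v z)) k p - a (conv v k p))
      \<le> C / e * C * (LINT z|Q. LINT z'|Q. Delta a (v (p - z)) (v (p - z')))" for p
      by (rule commutator_pointwise(2)[OF convex_flux_axioms v_meas v_R])
    show "0 \<le> C / e * C * (LINT z|Q. LINT z'|Q. Delta a (v (p - z)) (v (p - z')))" for p
      using C e(1) Delta_nonneg by (intro mult_nonneg_nonneg integral_nonneg_AE AE_I2) auto
  qed (use iK in simp)
  also have "\<dots> = C / e * C * (LINT p|local_lebesgue K. LINT z|Q. LINT z'|Q. Delta a (v (p - z)) (v (p - z')))"
    by simp
  also have "\<dots> \<le> C / e * C * b" using C e(1) avg by (intro mult_left_mono) auto
  \<comment> \<open>The \<open>1 / e\<close> cancels one power of \<open>e\<close> in each summand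
    of \<open>b\<close>.\<close>
  also have "\<dots> = 2 * C * C * \<Lambda> + C * C * L * e" using e(1) by (simp add: b_def field_simps)
  finally have comm: "(LINT p|local_lebesgue K. \<bar>conv v kx p\<bar> * (conv (\<lambda>z. a (v z)) k p - a (conv v k p)))
      \<le> 2 * C * C * \<Lambda> + C * C * L * e" .
  have "production \<le> M * C * \<omega>
       + S * (LINT p|local_lebesgue K. \<bar>conv v kx p\<bar> * (conv (\<lambda>z. a (v z)) k p - a (conv v k p)))"
  proof (rule M(2)[OF m])
    show "\<forall>p\<in>K. d < fst p \<and> fst p < T - d" using d0(2) d(2) by blast
    show "\<forall>z. \<bar>fst z\<bar> \<le> d \<longrightarrow> \<bar>snd z\<bar> \<le> e \<longrightarrow> (LINT p|local_lebesgue K. \<bar>v (p - z) - v p\<bar>) \<le> \<omega>"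
    proof (intro allI impI r(2))
      fix z :: "real \<times> real" assume "\<bar>fst z\<bar> \<le> d" "\<bar>snd z\<bar> \<le> e"
      then show "norm z \<le> r" using norm_le_box[of z d e] d(3) e(2) by linarith
    qed
  qed
  also have "\<dots> \<le> \<epsilon> / 2 + S * (2 * C * C * \<Lambda> + C * C * L * e)"
    using comm \<omega>(2) S(1) by (intro add_mono mult_left_mono)
  also have "\<dots> = S * (2 * C * C * \<Lambda>) + \<epsilon> / 2 + N * e" by (simp add: N_def algebra_simps)
  finally show "production \<le> S * (2 * C * C * \<Lambda>) + \<epsilon>" using e(5) by linarith
qed

end

section \<open>From test functions to the total variation\<close>

text \<open>Inner regularity of finite measures is applied to the restrictions to the balls of
  integer radius, and these exhaust the set from below.\<close>

lemma locally_finite_inner_regular: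
  fixes \<mu> :: "(real \<times> real) measure"
  assumes sets: "sets \<mu> = sets borel" and fin: "\<And>K. compact K \<Longrightarrow> emeasure \<mu> K < \<infinity>"
    and B: "B \<in> sets borel"
  shows "emeasure \<mu> B \<le> (SUP K\<in>{K. K \<subseteq> B \<and> compact K}. emeasure \<mu> K)"
proof -
  note [measurable_cong] = sets
  have B' [measurable]: "B \<in> sets \<mu>" using B sets by simp
  have cb [measurable]: "cball (0::real\<times>real) r \<in> sets \<mu>" for r using sets by simp
  define \<nu> where "\<nu> n = density \<mu> (indicator (cball 0 (real n)))" for n :: nat
  have \<nu>: "emeasure (\<nu> n) A = emeasure \<mu> (cball 0 (real n) \<inter> A)" if "A \<in> sets borel" for n A
    unfolding \<nu>_def using that sets by (subst emeasure_density)
      (auto simp: indicator_inter_arith[symmetric] simp flip: nn_integral_indicator)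
  have reg: "emeasure (\<nu> n) B \<le> (SUP K\<in>{K. K \<subseteq> B \<and> compact K}. emeasure \<mu> K)" for n
  proof -
    have "emeasure (\<nu> n) (space (\<nu> n)) \<noteq> \<infinity>"
      using \<nu>[of UNIV n] fin[of "cball 0 (real n)"] sets_eq_imp_space_eq[OF sets] by (simp add: \<nu>_def)
    then have "emeasure (\<nu> n) B = (SUP K\<in>{K. K \<subseteq> B \<and> compact K}. emeasure (\<nu> n) K)"
      using sets B by (intro inner_regular) (auto simp: \<nu>_def)
    also have "\<dots> \<le> (SUP K\<in>{K. K \<subseteq> B \<and> compact K}. emeasure \<mu> K)"
    proof (rule SUP_mono)
      fix K assume K: "K \<in> {K. K \<subseteq> B \<and> compact K}"
      then have "emeasure (\<nu> n) K \<le> emeasure \<mu> K"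
        using sets by (subst \<nu>) (auto intro!: emeasure_mono simp: borel_compact)
      then show "\<exists>K'\<in>{K. K \<subseteq> B \<and> compact K}. emeasure (\<nu> n) K \<le> emeasure \<mu> K'" using K by blast
    qed
    finally show ?thesis .
  qed
  have "(SUP n. emeasure \<mu> (cball 0 (real n) \<inter> B)) = emeasure \<mu> (\<Union>n. cball 0 (real n) \<inter> B)"
    by (rule SUP_emeasure_incseq) (auto simp: incseq_def)
  also have "(\<Union>n. cball 0 (real n) \<inter> B) = B"
    using real_arch_simple by auto
  finally have "emeasure \<mu> B = (SUP n. emeasure (\<nu> n) B)" by (simp add: \<nu>[OF B])
  also have "\<dots> \<le> (SUP K\<in>{K. K \<subseteq> B \<and> compact K}. emeasure \<mu> K)" by (rule SUP_least) (rule reg)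
  finally show ?thesis .
qed

(* The case split is needed because infdist p {} = 0. *)
definition tent :: "real \<Rightarrow> (real \<times> real) set \<Rightarrow> real \<times> real \<Rightarrow> real" where
  "tent n K p = (if K = {} then 0 else max 0 (1 - n * infdist p K))"

section \<open>Lipschitz cutoffs of compact sets and recovery of the total variation\<close>

lemma tent_range: "n \<ge> 0 \<Longrightarrow> 0 \<le> tent n K p" "n \<ge> 0 \<Longrightarrow> tent n K p \<le> 1"
  by (auto simp: tent_def infdist_nonneg)

lemma tent_lipschitz: "n \<ge> 0 \<Longrightarrow> \<bar>tent n K p - tent n K p'\<bar> \<le> n * dist p p'"
proof -
  assume n: "n \<ge> 0"
  have "n * \<bar>infdist p K - infdist p' K\<bar> \<le> n * dist p p'"
    by (intro mult_left_mono infdist_triangle_abs n)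
  moreover have "n * \<bar>infdist p K - infdist p' K\<bar> = \<bar>n * infdist p K - n * infdist p' K\<bar>"
    using n by (simp add: abs_mult flip: right_diff_distrib)
  ultimately show ?thesis using n by (auto simp: tent_def)
qed

lemma continuous_on_tent: "continuous_on UNIV (tent n K)"
  unfolding tent_def by (cases "K = {}") (auto intro!: continuous_intros)

lemma tent_nonzero:
  assumes "tent n K p \<noteq> 0" "n > 0" "compact K"
  shows "\<exists>x\<in>K. dist p x < 1 / n"
proof -
  have K: "K \<noteq> {}" using assms by (auto simp: tent_def)
  obtain x where x: "x \<in> K" "infdist p K = dist p x"
    using infdist_attains_inf[OF compact_imp_closed[OF assms(3)] K] by metis
  have "n * infdist p K < 1" using assms K by (auto simp: tent_def split: if_splits)
  then show ?thesis using x assms(2) by (auto simp: field_simps)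
qed

lemma tent_tendsto:
  assumes "compact K"
  shows "(\<lambda>n. tent (real (n + m)) K p) \<longlonglongrightarrow> indicator K p"
proof (cases "p \<in> K")
  case True
  then have "K \<noteq> {}" "infdist p K = 0" by auto
  then show ?thesis using True by (simp add: tent_def)
next
  case False
  show ?thesis
  proof (cases "K = {}")
    case False
    define r where "r = infdist p K"
    have r: "r > 0" using in_closed_iff_infdist_zero[OF compact_imp_closed[OF assms] False, of p] \<open>p \<notin> K\<close>
      infdist_nonneg[of p K] by (auto simp: r_def)
    obtain N where N: "1 / r < real N" using reals_Archimedean2 by blast
    have "eventually (\<lambda>n. tent (real (n + m)) K p = 0) sequentially"
      using eventually_ge_at_top[of N]
    proof eventually_elim
      case (elim n)
      then have "1 / r < real (n + m)" using N by linarith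
      then have "1 < real (n + m) * r" using r by (simp add: field_simps)
      then show ?case by (simp add: tent_def r_def)
    qed
    then show ?thesis using \<open>p \<notin> K\<close> by (simp add: tendsto_eventually)
  qed (simp add: tent_def)
qed

text \<open>\<open>\<mu>p\<close> lives off \<open>S\<close> and \<open>\<mu>n\<close> on
  \<open>S\<close>. Test functions converging to \<open>1\<close> on a compact \<open>K1\<close> off
  \<open>S\<close> and to \<open>-1\<close> on a compact \<open>K2\<close> inside \<open>S\<close>
  thus turn the one-sided bound into a bound for \<open>\<mu>p K1 + \<mu>n K2\<close>; inner
  regularity of both measures does the rest.\<close>

lemma total_variation_le:
  fixes \<mu>p \<mu>n :: "(real \<times> real) measure"
  assumes sets: "sets \<mu>p = sets borel" "sets \<mu>n = sets borel"
    and fin: "\<And>K. compact K \<Longrightarrow> emeasure \<mu>p K < \<infinity>" "\<And>K. compact K \<Longrightarrow> emeasure \<mu>n K < \<infinity>"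
    and S: "S \<in> sets borel" "emeasure \<mu>p S = 0" "emeasure \<mu>n (- S) = 0"
    and U: "open U" "U \<subseteq> {0<..<T} \<times> UNIV"
    and moll: "\<And>d e. d > 0 \<Longrightarrow> e > 0 \<Longrightarrow> \<exists>k kt kx. mollifier C d e k kt kx"
    and bound: "\<And>\<phi> K. test_fun T \<phi> \<Longrightarrow> compact K \<Longrightarrow> K \<subseteq> U \<Longrightarrow> (\<And>p. p \<notin> K \<Longrightarrow> \<phi> (fst p) (snd p) = 0) \<Longrightarrow>
      (\<And>t x. \<bar>\<phi> t x\<bar> \<le> 1) \<Longrightarrow> (LINT p|\<mu>p. \<phi> (fst p) (snd p)) - (LINT p|\<mu>n. \<phi> (fst p) (snd p)) \<le> b"
  shows "emeasure \<mu>p U + emeasure \<mu>n U \<le> ennreal b"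
proof -
  note [measurable_cong] = sets
  have space: "space \<mu>p = UNIV" "space \<mu>n = UNIV"
    using sets_eq_imp_space_eq[OF sets(1)] sets_eq_imp_space_eq[OF sets(2)] by auto
  have compact_case: "emeasure \<mu>p K1 + emeasure \<mu>n K2 \<le> ennreal b"
    if K1: "compact K1" "K1 \<subseteq> U - S" and K2: "compact K2" "K2 \<subseteq> U \<inter> S" for K1 K2
  proof -
    have Kb [measurable]: "K1 \<in> sets borel" "K2 \<in> sets borel" using K1 K2 by (simp_all add: borel_compact)
    define K12 where "K12 = K1 \<union> K2"
    have "compact K12" "K12 \<subseteq> U" using K1 K2 by (auto simp: K12_def)
    then obtain r where r: "r > 0" "(\<Union>x\<in>K12. cball x r) \<subseteq> U"
      using compact_subset_open_imp_cball_epsilon_subset[OF _ U(1)] by blast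
    define K' where "K' = (\<Union>x\<in>K12. cball x r)"
    have K': "compact K'" "K' \<subseteq> U"
      using compact_minkowski_sum_cball[OF \<open>compact K12\<close>] r by (auto simp: K'_def)
    have K'b [measurable]: "K' \<in> sets borel" using K' by (simp add: borel_compact)
    \<comment> \<open>The part \<open>4 / r\<close> keeps the tents within \<open>r / 4\<close> of
      the compact sets; the added 1 gives \<open>N n \<ge> 1\<close>, hence
      \<open>dl n \<le> 1 / N n\<close>. Together with a kernel radius of at most
      \<open>r / 2\<close>, supports stay in \<open>K'\<close>.\<close>
    obtain m :: nat where m: "4 / r + 1 < real m" using reals_Archimedean2 by blast
    define N where "N n = real (n + m)" for n :: nat
    have N: "N n \<ge> 1" "N n > 0" "1 / N n < r / 4" for n
    proof -
      have "4 / r + 1 < N n" using m by (simp add: N_def)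
      moreover have "4 / r > 0" using r by simp
      ultimately show "N n \<ge> 1" "N n > 0" by linarith+
      have "4 / r < N n" using \<open>4 / r + 1 < N n\<close> by linarith
      then show "1 / N n < r / 4" using r \<open>N n > 0\<close> by (simp add: field_simps)
    qed
    \<comment> \<open>The tents have slope \<open>N n\<close>, so mollifying at scale
      \<open>1 / N^2\<close> changes their difference by only a multiple of \<open>1 / N\<close>,
      uniformly.\<close>
    define dl where "dl n = 1 / (N n * N n)" for n
    have dl: "dl n > 0" "dl n + dl n \<le> r / 2" "N n * dl n = 1 / N n" for n
    proof -
      show "dl n > 0" using N(2)[of n] by (simp add: dl_def)
      show "N n * dl n = 1 / N n" using N(2)[of n] by (simp add: dl_def)
      have "dl n \<le> 1 / N n" unfolding dl_def using N[of n] by (intro divide_left_mono) auto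
      then show "dl n + dl n \<le> r / 2" using N(3)[of n] by linarith
    qed
    have "\<forall>n. \<exists>k kt kx. mollifier C (dl n) (dl n) k kt kx" using moll dl(1) by blast
    then obtain k kt kx where mol: "\<And>n. mollifier C (dl n) (dl n) (k n) (kt n) (kx n)" by metis
    define f where "f n p = tent (N n) K1 p - tent (N n) K2 p" for n p
    have f_range: "- 1 \<le> f n p" "f n p \<le> 1" for n p
      using tent_range[of "N n" K1 p] tent_range[of "N n" K2 p] N(2)[of n] by (auto simp: f_def)
    have f_abs: "\<bar>f n p\<bar> \<le> 1" for n p using f_range[of n p] by (simp add: abs_le_iff)
    have cf: "continuous_on UNIV (f n)" for n
      unfolding f_def by (intro continuous_intros continuous_on_tent)
    have f_meas [measurable]: "f n \<in> borel_measurable borel" for n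
      by (rule borel_measurable_continuous_onI[OF cf])
    have f_lip: "\<bar>f n p - f n p'\<bar> \<le> 2 * N n * dist p p'" for n p p'
      using tent_lipschitz[of "N n" K1 p p'] tent_lipschitz[of "N n" K2 p p'] N(2)[of n] by (simp add: f_def)
    define \<phi> where "\<phi> n p = conv (f n) (k n) p" for n p
    have c\<phi>: "continuous_on UNIV (\<phi> n)" for n
    proof -
      interpret mollifier C "dl n" "dl n" "k n" "kt n" "kx n" by (rule mol)
      show ?thesis unfolding \<phi>_def by (rule k.continuous_on_conv[OF f_meas f_abs])
    qed
    have [measurable]: "\<phi> n \<in> borel_measurable borel" for n
      by (rule borel_measurable_continuous_onI[OF c\<phi>])
    have \<phi>_abs: "\<bar>\<phi> n p\<bar> \<le> 1" for n p
      unfolding \<phi>_def using mollifier.mean_bounds[OF mol[of n] f_meas[of n] f_range(1)[of n] f_range(2)[of n], of p] by (simp add: abs_le_iff)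
    have \<phi>_supp: "\<phi> n p = 0" if p: "p \<notin> K'" for n p
    proof -
      have "f n z * k n (p - z) = 0" for z
      proof (rule ccontr)
        assume nz: "f n z * k n (p - z) \<noteq> 0"
        then have "tent (N n) K1 z \<noteq> 0 \<or> tent (N n) K2 z \<noteq> 0" by (auto simp: f_def)
        then obtain x where x: "x \<in> K12" "dist z x < 1 / N n"
          using tent_nonzero[OF _ N(2) K1(1)] tent_nonzero[OF _ N(2) K2(1)] unfolding K12_def by blast
        interpret mollifier C "dl n" "dl n" "k n" "kt n" "kx n" by (rule mol)
        have "norm (p - z) \<le> dl n + dl n" using k.supp[of "p - z"] nz by fastforce
        then have "dist z p \<le> dl n + dl n" by (simp add: dist_norm norm_minus_commute)
        then have "dist x p \<le> r"
          using dist_triangle3[of x p z] x(2) dl(2)[of n] N(3)[of n] r(1) by linarith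
        then show False using p x(1) by (auto simp: K'_def)
      qed
      then have "(\<lambda>z. f n z * k n (p - z)) = (\<lambda>z. 0)" by (rule ext)
      then show ?thesis unfolding \<phi>_def conv_def by simp
    qed
    have \<phi>_test: "test_fun T (\<lambda>t x. \<phi> n (t, x))" for n
    proof -
      interpret mollifier C "dl n" "dl n" "k n" "kt n" "kx n" by (rule mol)
      have "smooth2 (\<lambda>t x. \<phi> n (t, x))"
        unfolding \<phi>_def by (rule smooth2_conv[OF kernels(1) pos(2,3) f_meas f_abs])
      then show ?thesis unfolding test_fun_def using K' U(2) \<phi>_supp by (intro conjI exI[of _ K']) auto
    qed
    have ineq: "(LINT p|\<mu>p. \<phi> n p) - (LINT p|\<mu>n. \<phi> n p) \<le> b" for n
      using bound[OF \<phi>_test K', of n] \<phi>_supp \<phi>_abs by simp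
    have \<phi>_f: "\<bar>\<phi> n p - f n p\<bar> \<le> \<bar>C\<bar> * (4 / N n)" for n p
    proof -
      interpret mollifier C "dl n" "dl n" "k n" "kt n" "kx n" by (rule mol)
      interpret Q: unit_measure Q by (rule unit_measure_Q)
      have f2: "\<bar>f n (p - z) - f n p\<bar> \<le> 2" for z using f_abs[of n "p - z"] f_abs[of n p] by linarith
      have "(LINT z|Q. \<bar>f n (p - z) - f n p\<bar>) \<le> (LINT z|Q. 4 / N n)"
      proof (rule integral_mono_AE)
        show "integrable Q (\<lambda>z. \<bar>f n (p - z) - f n p\<bar>)"
          using f2 by (intro Q.bounded_integrable[of _ 2]) auto
        show "AE z in Q. \<bar>f n (p - z) - f n p\<bar> \<le> 4 / N n"
          using AE_Q
        proof eventually_elim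
          case (elim z)
          have "norm z \<le> dl n + dl n"
            using elim norm_Pair_le[of "fst z" "snd z"] by (simp add: mem_box)
          then have "2 * N n * dist (p - z) p \<le> 2 * N n * (dl n + dl n)"
            using N(2)[of n] by (intro mult_left_mono) (auto simp: dist_norm)
          also have "\<dots> = 4 * (N n * dl n)" by (simp add: algebra_simps)
          also have "\<dots> = 4 / N n" by (simp add: dl(3))
          finally show ?case using f_lip[of n "p - z" p] by linarith
        qed
      qed simp
      then have "C * (LINT z|Q. \<bar>f n (p - z) - f n p\<bar>) \<le> C * (4 / N n)"
        using pos Q.measure_space_1 by (intro mult_left_mono) auto
      moreover have "\<bar>\<phi> n p - f n p\<bar> \<le> C * (LINT z|Q. \<bar>f n (p - z) - f n p\<bar>)"
        unfolding \<phi>_def by (rule mean_deviation[OF f_meas f_abs])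
      ultimately show ?thesis using pos by simp
    qed
    have N_lim: "(\<lambda>n. 4 / N n) \<longlonglongrightarrow> 0"
    proof -
      have "(\<lambda>n. 4 / real (n + m)) \<longlonglongrightarrow> 0"
        using LIMSEQ_ignore_initial_segment[OF lim_const_over_n[of 4], of m] by simp
      then show ?thesis by (simp add: N_def)
    qed
    have \<phi>_lim: "(\<lambda>n. \<phi> n p) \<longlonglongrightarrow> indicator K1 p - indicator K2 p" for p
    proof -
      have "(\<lambda>n. \<phi> n p - f n p) \<longlonglongrightarrow> 0"
      proof (rule Lim_null_comparison)
        show "eventually (\<lambda>n. norm (\<phi> n p - f n p) \<le> \<bar>C\<bar> * (4 / N n)) sequentially"
          using \<phi>_f by simp
        show "(\<lambda>n. \<bar>C\<bar> * (4 / N n)) \<longlonglongrightarrow> 0" using tendsto_mult_right_zero[OF N_lim] .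
      qed
      moreover have "(\<lambda>n. f n p) \<longlonglongrightarrow> indicator K1 p - indicator K2 p"
        unfolding f_def N_def by (intro tendsto_diff tent_tendsto K1 K2)
      ultimately have "(\<lambda>n. (\<phi> n p - f n p) + f n p) \<longlonglongrightarrow> 0 + (indicator K1 p - indicator K2 p)"
        by (rule tendsto_add)
      then show ?thesis by simp
    qed
    \<comment> \<open>All test functions are bounded by the indicator of the fixed compact
      \<open>K'\<close>, which has finite measure.\<close>
    have conv_int: "(\<lambda>n. LINT p|\<mu>. \<phi> n p) \<longlonglongrightarrow> measure \<mu> K1 - measure \<mu> K2"
      if sets\<mu>: "sets \<mu> = sets borel" and fin\<mu>: "\<And>K. compact K \<Longrightarrow> emeasure \<mu> K < \<infinity>" for \<mu> :: "(real \<times> real) measure"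
    proof -
      note [measurable_cong] = sets\<mu>
      have ind: "integrable \<mu> (indicat_real K)" if "compact K" for K
        using fin\<mu>[OF that] that sets\<mu> by (intro integrable_real_indicator) (auto simp: borel_compact)
      have "(\<lambda>n. LINT p|\<mu>. \<phi> n p) \<longlonglongrightarrow> (LINT p|\<mu>. indicat_real K1 p - indicator K2 p)"
      proof (rule integral_dominated_convergence[where w="indicat_real K'"])
        show "integrable \<mu> (indicat_real K')" by (rule ind[OF K'(1)])
        show "AE p in \<mu>. (\<lambda>n. \<phi> n p) \<longlonglongrightarrow> indicat_real K1 p - indicator K2 p"
          by (intro AE_I2 \<phi>_lim)
        show "AE p in \<mu>. norm (\<phi> n p) \<le> indicat_real K' p" for n
        proof (rule AE_I2)
          fix p show "norm (\<phi> n p) \<le> indicat_real K' p"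
            using \<phi>_abs[of n p] \<phi>_supp[of p n] by (cases "p \<in> K'") auto
        qed
      qed measurable
      also have "(LINT p|\<mu>. indicat_real K1 p - indicator K2 p) = measure \<mu> K1 - measure \<mu> K2"
        using ind[OF K1(1)] ind[OF K2(1)] sets\<mu> sets_eq_imp_space_eq[OF sets\<mu>] by simp
      finally show ?thesis .
    qed
    \<comment> \<open>Mutual singularity removes the two terms with the wrong sign from the
      limit.\<close>
    have "emeasure \<mu>p K2 \<le> emeasure \<mu>p S" using K2 S sets by (intro emeasure_mono) auto
    then have z1: "measure \<mu>p K2 = 0" using S by (simp add: measure_def)
    have "emeasure \<mu>n K1 \<le> emeasure \<mu>n (- S)" using K1 S sets by (intro emeasure_mono) auto
    then have z2: "measure \<mu>n K1 = 0" using S by (simp add: measure_def)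
    have "(\<lambda>n. (LINT p|\<mu>p. \<phi> n p) - (LINT p|\<mu>n. \<phi> n p)) \<longlonglongrightarrow>
        (measure \<mu>p K1 - measure \<mu>p K2) - (measure \<mu>n K1 - measure \<mu>n K2)"
      by (intro tendsto_diff conv_int sets fin)
    then have "measure \<mu>p K1 + measure \<mu>n K2 \<le> b"
      using LIMSEQ_le_const2[of _ _ b] ineq z1 z2 by fastforce
    moreover have "emeasure \<mu>p K1 = ennreal (measure \<mu>p K1)" "emeasure \<mu>n K2 = ennreal (measure \<mu>n K2)"
      using fin(1)[OF K1(1)] fin(2)[OF K2(1)] by (auto intro: emeasure_eq_ennreal_measure)
    ultimately show ?thesis by (simp add: ennreal_leI flip: ennreal_plus)
  qed
  have Ub: "U \<in> sets borel" using U by simp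
  have "emeasure \<mu>p U \<le> emeasure \<mu>p (U - S) + emeasure \<mu>p S"
    using emeasure_subadditive[of "U - S" \<mu>p S] emeasure_mono[of U "(U - S) \<union> S" \<mu>p] Ub S sets by force
  then have 1: "emeasure \<mu>p U \<le> (SUP K\<in>{K. K \<subseteq> U - S \<and> compact K}. emeasure \<mu>p K)"
    using locally_finite_inner_regular[OF sets(1) fin(1), of "U - S"] Ub S by (auto intro: order_trans)
  have "emeasure \<mu>n U \<le> emeasure \<mu>n (U \<inter> S) + emeasure \<mu>n (- S)"
    using emeasure_subadditive[of "U \<inter> S" \<mu>n "- S"] emeasure_mono[of U "(U \<inter> S) \<union> (- S)" \<mu>n] Ub S sets by force
  then have 2: "emeasure \<mu>n U \<le> (SUP K\<in>{K. K \<subseteq> U \<inter> S \<and> compact K}. emeasure \<mu>n K)"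
    using locally_finite_inner_regular[OF sets(2) fin(2), of "U \<inter> S"] Ub S by (auto intro: order_trans)
  \<comment> \<open>The empty set is compact; nonempty index sets are what lets a constant be moved
    into a supremum.\<close>
  have ne: "{K. K \<subseteq> U - S \<and> compact K} \<noteq> {}" "{K. K \<subseteq> U \<inter> S \<and> compact K} \<noteq> {}" by (auto intro!: exI[of _ "{}"])
  have "(SUP K\<in>{K. K \<subseteq> U - S \<and> compact K}. emeasure \<mu>p K) + (SUP K\<in>{K. K \<subseteq> U \<inter> S \<and> compact K}. emeasure \<mu>n K) \<le> ennreal b"
    unfolding ennreal_SUP_add_right[OF ne(2)] ennreal_SUP_add_left[OF ne(1), symmetric]
    by (intro SUP_least) (auto intro: compact_case)
  then show ?thesis using add_mono[OF 1 2] by (rule order_trans[rotated])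
qed

section \<open>Clipping to the essential range\<close>

text \<open>Adding the tangent inequalities at \<open>x\<close> and at \<open>y\<close> shows that
  the derivative is monotone; continuity of \<open>a\<close> on the whole line yields the
  primitive.\<close>

lemma convex_flux_of_strictly_convex:
  assumes C2: "C2 a" and sc: "strictly_convex a"
  obtains B where "convex_flux a B"
proof -
  have d: "(a has_real_derivative deriv a x) (at x)" for x
    using C2 by (simp add: C2_def DERIV_deriv_iff_real_differentiable)
  have cont': "continuous_on UNIV (deriv a)"
    using C2 by (intro continuous_at_imp_continuous_on) (simp add: C2_def differentiable_imp_continuous_within)
  have conv: "convex_on UNIV a"
  proof (rule convex_onI)
    fix t x y :: real assume t: "0 < t" "t < 1"
    show "a ((1 - t) *\<^sub>R x + t *\<^sub>R y) \<le> (1 - t) * a x + t * a y"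
    proof (cases "x = y")
      case True
      then show ?thesis by (simp add: algebra_simps)
    next
      case False
      then show ?thesis using sc t unfolding strictly_convex_def by (simp add: less_imp_le)
    qed
  qed simp
  have tangent: "deriv a x * (y - x) \<le> a y - a x" for x y
    using convex_on_imp_above_tangent[OF conv, of x y "deriv a x"] d by simp
  have mono: "mono (deriv a)"
  proof (rule monoI)
    fix x y :: real assume "x \<le> y"
    show "deriv a x \<le> deriv a y"
    proof (cases "x = y")
      case False
      have "(deriv a y - deriv a x) * (y - x) \<ge> 0"
        using tangent[of x y] tangent[of y x] by (simp add: algebra_simps)
      then show ?thesis using False \<open>x \<le> y\<close> by (simp add: zero_le_mult_iff)
    qed simp
  qed
  obtain B where B: "\<forall>x::real. - \<infinity> < ereal x \<longrightarrow> ereal x < \<infinity> \<longrightarrow> (B has_vector_derivative a x) (at x)"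
    using einterval_antiderivative[of "-\<infinity>" "\<infinity>" a] DERIV_isCont[OF d] by auto
  then have "(B has_real_derivative a x) (at x)" for x
    by (simp add: has_real_derivative_iff_has_vector_derivative)
  then have "convex_flux a B" using d cont' mono by unfold_locales
  then show ?thesis by (rule that)
qed

lemma AE_lborel_shift:
  fixes c :: "'a::euclidean_space"
  assumes "AE p in lborel. P p"
  shows "AE p in lborel. P (p + c)"
proof -
  have "AE p in distr lborel borel (\<lambda>z. z - (- c)). P p"
    unfolding distr_lborel_shift by (rule assms)
  then have "AE p in lborel. P (p - (- c))" by (rule AE_distrD[rotated]) measurable
  then show ?thesis by simp
qed

lemma strip_sets [measurable]: "{0..T::real} \<times> (UNIV :: real set) \<in> sets borel"
  by (intro borel_closed closed_Times) auto

text \<open>The strip has positive measure, as it contains a box of area \<open>T\<close>. Used with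
  predicates between constants, this extracts their truth from an almost-everywhere
  statement.\<close>

lemma AE_strip_ex:
  fixes T :: real
  assumes "T > 0" "AE p in lborel. p \<in> {0..T} \<times> (UNIV :: real set) \<longrightarrow> P p"
  shows "\<exists>p. P p"
proof (rule ccontr)
  assume "\<nexists>p. P p"
  have "AE p in lborel. p \<notin> {0..T} \<times> (UNIV :: real set)"
    using assms(2) by (rule eventually_mono) (use \<open>\<nexists>p. P p\<close> in blast)
  then have "emeasure lborel ({0..T} \<times> (UNIV :: real set)) = 0"
    by (subst (asm) AE_iff_measurable[OF _ refl]) (auto simp: strip_sets)
  moreover have "emeasure lborel (cbox (0, 0 :: real) (T, 1)) \<le> emeasure lborel ({0..T} \<times> (UNIV :: real set))"
    by (intro emeasure_mono) (auto simp: cbox_Pair_eq strip_sets)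
  ultimately have "measure lborel (cbox (0::real, 0::real) (T, 1)) = 0" by (simp add: measure_def)
  then show False using assms(1) by (simp add: content_Pair)
qed

text \<open>The infimum of the essential upper bounds is itself one: it is approached within
  \<open>1 / Suc n\<close> for every \<open>n\<close>, and a countable union of null sets is
  null.\<close>

lemma ess_sup_strip_bound:
  assumes T: "T > 0" and M: "AE p in lborel. p \<in> {0..T} \<times> UNIV \<longrightarrow> \<bar>u (fst p) (snd p)\<bar> \<le> M"
  shows "AE p in lborel. p \<in> {0..T} \<times> UNIV \<longrightarrow> u (fst p) (snd p) \<le> ess_sup_strip T u"
proof -
  define W where "W = {M. AE p in lborel. p \<in> {0..T} \<times> UNIV \<longrightarrow> u (fst p) (snd p) \<le> M}"
  have "M \<in> W" unfolding W_def using M by (auto elim!: eventually_mono)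
  have bdd: "- M \<le> m" if "m \<in> W" for m
  proof -
    have "AE p in lborel. p \<in> {0..T} \<times> (UNIV :: real set) \<longrightarrow> - M \<le> m"
      using eventually_conj[OF M that[unfolded W_def mem_Collect_eq]] by (rule eventually_mono) auto
    then show ?thesis using AE_strip_ex[OF T, of "\<lambda>_. - M \<le> m"] by blast
  qed
  have "AE p in lborel. p \<in> {0..T} \<times> UNIV \<longrightarrow> u (fst p) (snd p) \<le> Inf W + 1 / real (Suc n)" for n
  proof -
    obtain m where m: "m \<in> W" "m < Inf W + 1 / real (Suc n)"
      using cInf_lessD[of W "Inf W + 1 / real (Suc n)"] \<open>M \<in> W\<close> by auto
    then show ?thesis unfolding W_def by (auto elim!: eventually_mono)
  qed
  then have "AE p in lborel. \<forall>n. p \<in> {0..T} \<times> UNIV \<longrightarrow> u (fst p) (snd p) \<le> Inf W + 1 / real (Suc n)"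
    unfolding AE_all_countable by blast
  then show ?thesis
  proof eventually_elim
    case (elim p)
    show ?case
    proof
      assume p: "p \<in> {0..T} \<times> UNIV"
      show "u (fst p) (snd p) \<le> ess_sup_strip T u"
        unfolding ess_sup_strip_def W_def[symmetric]
      proof (rule field_le_epsilon)
        fix \<epsilon> :: real assume "\<epsilon> > 0"
        then obtain n where "1 / real (Suc n) < \<epsilon>" using nat_approx_posE by (metis inverse_eq_divide)
        then show "u (fst p) (snd p) \<le> Inf W + \<epsilon>" using elim[rule_format, of n] p by linarith
      qed
    qed
  qed
qed

lemma ess_inf_strip_eq: "ess_inf_strip T u = - ess_sup_strip T (\<lambda>t x. - u t x)"
proof -
  have "uminus ` {M. AE p in lborel. p \<in> {0..T} \<times> UNIV \<longrightarrow> - u (fst p) (snd p) \<le> M}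
      = {m. AE p in lborel. p \<in> {0..T} \<times> UNIV \<longrightarrow> m \<le> u (fst p) (snd p)}" (is "uminus ` ?A = ?B")
  proof (rule set_eqI)
    fix m
    have "m \<in> uminus ` ?A \<longleftrightarrow> - m \<in> ?A" by (metis (no_types, lifting) add.inverse_inverse image_iff)
    also have "\<dots> \<longleftrightarrow> m \<in> ?B" by simp
    finally show "m \<in> uminus ` ?A \<longleftrightarrow> m \<in> ?B" .
  qed
  then show ?thesis unfolding ess_inf_strip_def ess_sup_strip_def by (simp add: Inf_real_def)
qed

lemma ess_inf_strip_bound:
  assumes T: "T > 0" and M: "AE p in lborel. p \<in> {0..T} \<times> UNIV \<longrightarrow> \<bar>u (fst p) (snd p)\<bar> \<le> M"
  shows "AE p in lborel. p \<in> {0..T} \<times> UNIV \<longrightarrow> ess_inf_strip T u \<le> u (fst p) (snd p)"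
  using ess_sup_strip_bound[OF T, of "\<lambda>t x. - u t x" M] M
  unfolding ess_inf_strip_eq by (auto elim!: eventually_mono)

text \<open>An everywhere defined Borel representative with values in the essential range. Outside
  the strip \<open>u\<close> is arbitrary, so a constant from that range is taken; the test
  functions never see it.\<close>

definition clip :: "real \<Rightarrow> (real \<Rightarrow> real \<Rightarrow> real) \<Rightarrow> real \<times> real \<Rightarrow> real" where
  "clip T u p = (if p \<in> {0..T} \<times> UNIV
     then max (ess_inf_strip T u) (min (ess_sup_strip T u) (u (fst p) (snd p))) else ess_inf_strip T u)"

context
  fixes T :: real and u :: "real \<Rightarrow> real \<Rightarrow> real"
  assumes T: "T > 0" and u: "Linf_strip T u"
begin

lemma ess_bounds: "AE p in lborel. p \<in> {0..T} \<times> UNIV \<longrightarrow>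
    ess_inf_strip T u \<le> u (fst p) (snd p) \<and> u (fst p) (snd p) \<le> ess_sup_strip T u"
proof -
  obtain M where "AE p in lborel. p \<in> {0..T} \<times> UNIV \<longrightarrow> \<bar>u (fst p) (snd p)\<bar> \<le> M"
    using u by (auto simp: Linf_strip_def)
  from ess_sup_strip_bound[OF T this] ess_inf_strip_bound[OF T this]
  show ?thesis by eventually_elim auto
qed

lemma ess_inf_le_ess_sup: "ess_inf_strip T u \<le> ess_sup_strip T u"
  using AE_strip_ex[OF T ess_bounds] by force

lemma clip_range: "ess_inf_strip T u \<le> clip T u p" "clip T u p \<le> ess_sup_strip T u"
  using ess_inf_le_ess_sup by (auto simp: clip_def)

lemma strip_measurable: "(\<lambda>p. indicat_real ({0..T} \<times> UNIV) p * u (fst p) (snd p)) \<in> borel_measurable borel"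
  using u by (simp add: Linf_strip_def set_borel_measurable_def)

lemma clip_measurable [measurable]: "clip T u \<in> borel_measurable borel"
proof -
  have "clip T u = (\<lambda>p. if p \<in> {0..T} \<times> UNIV then max (ess_inf_strip T u) (min (ess_sup_strip T u)
      (indicat_real ({0..T} \<times> UNIV) p * u (fst p) (snd p))) else ess_inf_strip T u)"
    by (auto simp: clip_def)
  then show ?thesis using strip_measurable by simp
qed

lemma clip_AE: "AE p in lborel. p \<in> {0..T} \<times> UNIV \<longrightarrow> clip T u p = u (fst p) (snd p)"
  using ess_bounds by eventually_elim (auto simp: clip_def)

lemma test_integral_clip:
  assumes \<phi>: "test_fun T \<phi>" and g: "continuous_on UNIV g1" "continuous_on UNIV g2"
  shows "(LINT p|lborel. g1 (u (fst p) (snd p)) * dt \<phi> (fst p) (snd p) + g2 (u (fst p) (snd p)) * dx \<phi> (fst p) (snd p))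
    = (LINT p|lborel. g1 (clip T u p) * dt \<phi> (fst p) (snd p) + g2 (clip T u p) * dx \<phi> (fst p) (snd p))"
proof -
  obtain K where K: "compact K" "K \<subseteq> {0<..<T} \<times> UNIV" "\<And>t x. (t, x) \<notin> K \<Longrightarrow> \<phi> t x = 0"
    using \<phi> by (auto simp: test_fun_def)
  interpret test_function "\<lambda>p. \<phi> (fst p) (snd p)" "\<lambda>p. dt \<phi> (fst p) (snd p)" "\<lambda>p. dx \<phi> (fst p) (snd p)" K
    by (rule test_fun_test_function[OF \<phi> K(1)]) (use K(3) in auto)
  \<comment> \<open>\<open>u\<close> is known to be measurable only after multiplication by the
    indicator of the strip, while the almost-everywhere congruence needs measurable integrands. So
    \<open>u\<close> is first replaced, pointwise, by this cutoff.\<close>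
  define w where "w p = indicat_real ({0..T} \<times> UNIV) p * u (fst p) (snd p)" for p
  have w [measurable]: "w \<in> borel_measurable borel" unfolding w_def[abs_def] by (rule strip_measurable)
  note [measurable] = borel_measurable_continuous_onI[OF g(1)] borel_measurable_continuous_onI[OF g(2)]
  have "g1 (u (fst p) (snd p)) * dt \<phi> (fst p) (snd p) + g2 (u (fst p) (snd p)) * dx \<phi> (fst p) (snd p)
      = g1 (w p) * dt \<phi> (fst p) (snd p) + g2 (w p) * dx \<phi> (fst p) (snd p)" for p
  proof (cases "p \<in> K")
    case True
    then have "p \<in> {0..T} \<times> UNIV" using K(2) by auto
    then show ?thesis by (simp add: w_def)
  qed (simp add: supp)
  moreover have "(LINT p|lborel. g1 (w p) * dt \<phi> (fst p) (snd p) + g2 (w p) * dx \<phi> (fst p) (snd p))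
    = (LINT p|lborel. g1 (clip T u p) * dt \<phi> (fst p) (snd p) + g2 (clip T u p) * dx \<phi> (fst p) (snd p))"
  proof (rule integral_cong_AE)
    show "(\<lambda>p. g1 (w p) * dt \<phi> (fst p) (snd p) + g2 (w p) * dx \<phi> (fst p) (snd p)) \<in> borel_measurable lborel"
      using meas by measurable
    show "(\<lambda>p. g1 (clip T u p) * dt \<phi> (fst p) (snd p) + g2 (clip T u p) * dx \<phi> (fst p) (snd p)) \<in> borel_measurable lborel"
      using meas by measurable
    show "AE p in lborel. g1 (w p) * dt \<phi> (fst p) (snd p) + g2 (w p) * dx \<phi> (fst p) (snd p)
        = g1 (clip T u p) * dt \<phi> (fst p) (snd p) + g2 (clip T u p) * dx \<phi> (fst p) (snd p)"
      using clip_AE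
    proof eventually_elim
      case (elim p)
      show ?case
      proof (cases "p \<in> K")
        case True
        then have "p \<in> {0..T} \<times> UNIV" using K(2) by auto
        then show ?thesis using elim by (simp add: w_def)
      qed (simp add: supp)
    qed
  qed
  ultimately show ?thesis by simp
qed

text \<open>A shift in \<open>x\<close> preserves the strip, and a translated null set is null, so
  clipping is invisible at both points for almost every \<open>p\<close>.\<close>

lemma Delta_integral_clip:
  assumes U: "U \<subseteq> {0..T} \<times> UNIV"
  shows "(\<integral>\<^sup>+ p\<in>U. ennreal (Delta a (u (fst p) (snd p)) (u (fst p) (snd p + h))) \<partial>lborel)
    = (\<integral>\<^sup>+ p\<in>U. ennreal (Delta a (clip T u p) (clip T u (p + (0, h)))) \<partial>lborel)"
proof (rule nn_integral_cong_AE)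
  show "AE p in lborel. ennreal (Delta a (u (fst p) (snd p)) (u (fst p) (snd p + h))) * indicator U p
      = ennreal (Delta a (clip T u p) (clip T u (p + (0, h)))) * indicator U p"
    using clip_AE AE_lborel_shift[OF clip_AE, of "(0, h)"]
  proof eventually_elim
    case (elim p)
    show ?case
    proof (cases "p \<in> U")
      case True
      then have "p \<in> {0..T} \<times> UNIV" "p + (0, h) \<in> {0..T} \<times> UNIV" using U by (auto simp: mem_Times_iff)
      then show ?thesis using elim by simp
    qed simp
  qed
qed

end

theorem theorem1:
  "\<exists>C0::real. C0 > 0 \<and>
    (\<forall>T a u. T > 0 \<longrightarrow> C2 a \<longrightarrow> strictly_convex a \<longrightarrow>
       Linf_strip T u \<longrightarrow> weak_solution T a u \<longrightarrow>
       (\<forall>\<eta> q. C2 \<eta> \<longrightarrow> entropy_flux a \<eta> q \<longrightarrow>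
          (\<exists>\<mu>p \<mu>n. entropy_production_repr T u \<eta> q \<mu>p \<mu>n)) \<longrightarrow>
       (\<forall>\<eta> q U \<mu>p \<mu>n. C2 \<eta> \<longrightarrow> entropy_flux a \<eta> q \<longrightarrow>
          open U \<longrightarrow> U \<subseteq> {0..T} \<times> UNIV \<longrightarrow>
          entropy_production_repr T u \<eta> q \<mu>p \<mu>n \<longrightarrow>
          emeasure \<mu>p U + emeasure \<mu>n U
            \<le> ennreal C0
              * (SUP v\<in>{ess_inf_strip T u..ess_sup_strip T u}. ennreal \<bar>deriv (deriv \<eta>) v\<bar>)
              * Limsup (at_right 0) (\<lambda>\<epsilon>::real.
                  SUP h\<in>{h::real. h \<noteq> 0 \<and> \<bar>h\<bar> < \<epsilon>}.
                    ennreal (1 / \<bar>h\<bar>) *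
                    (\<integral>\<^sup>+ p\<in>U. ennreal (Delta a (u (fst p) (snd p)) (u (fst p) (snd p + h))) \<partial>lborel))))"
proof -
  obtain C where C: "C > 0" "\<And>d e. d > 0 \<Longrightarrow> e > 0 \<Longrightarrow> \<exists>k kt kx. mollifier C d e k kt kx"
    using mollifier_exists by blast
  show ?thesis
  proof (intro exI[of _ "2 * C * C"] conjI allI impI)
    show "2 * C * C > 0" using C by simp
  next
    fix T :: real and a :: "real \<Rightarrow> real" and u :: "real \<Rightarrow> real \<Rightarrow> real"
      and \<eta> q :: "real \<Rightarrow> real" and U :: "(real \<times> real) set" and \<mu>p \<mu>n
    assume T: "T > 0" and a: "C2 a" "strictly_convex a" and u: "Linf_strip T u" and weak: "weak_solution T a u"
      and C2\<eta>: "C2 \<eta>" and flux: "entropy_flux a \<eta> q" and U: "open U" "U \<subseteq> {0..T} \<times> UNIV"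
      and repr: "entropy_production_repr T u \<eta> q \<mu>p \<mu>n"
    let ?I = "{ess_inf_strip T u..ess_sup_strip T u}"
    let ?\<eta>'' = "deriv (deriv \<eta>)"
    let ?D = "\<lambda>h. \<integral>\<^sup>+ p\<in>U. ennreal (Delta a (u (fst p) (snd p)) (u (fst p) (snd p + h))) \<partial>lborel"
    let ?lim = "Limsup (at_right 0) (\<lambda>\<epsilon>::real. SUP h\<in>{h::real. h \<noteq> 0 \<and> \<bar>h\<bar> < \<epsilon>}. ennreal (1 / \<bar>h\<bar>) * ?D h)"
    obtain B where B: "convex_flux a B" using convex_flux_of_strictly_convex[OF a] by blast
    interpret convex_flux a B by fact
    have \<eta>: "(\<eta> has_real_derivative deriv \<eta> x) (at x)" "(deriv \<eta> has_real_derivative ?\<eta>'' x) (at x)"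
        "continuous_on UNIV ?\<eta>''" for x
      using C2\<eta> by (auto simp: C2_def DERIV_deriv_iff_real_differentiable)
    have q: "(q has_real_derivative deriv \<eta> x * deriv a x) (at x)" for x
      using flux by (simp add: entropy_flux_def)
    have cont: "continuous_on UNIV \<eta>" "continuous_on UNIV q"
      using \<eta>(1) q by (meson DERIV_isCont continuous_at_imp_continuous_on)+
    \<comment> \<open>The essential range is a nonempty compact interval, so the supremum of
      \<open>|\<eta>''|\<close> is attained and is a real number.\<close>
    obtain x0 where x0: "x0 \<in> ?I" "\<And>x. x \<in> ?I \<Longrightarrow> \<bar>?\<eta>'' x\<bar> \<le> \<bar>?\<eta>'' x0\<bar>"
    proof -
      have "continuous_on ?I (\<lambda>x. \<bar>?\<eta>'' x\<bar>)"
        by (intro continuous_intros continuous_on_subset[OF \<eta>(3)]) auto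
      from continuous_attains_sup[OF _ _ this] show ?thesis
        using that ess_inf_le_ess_sup[OF T u] by force
    qed
    define S where "S = \<bar>?\<eta>'' x0\<bar>"
    have S: "S \<ge> 0" "\<And>x. ess_inf_strip T u \<le> x \<Longrightarrow> x \<le> ess_sup_strip T u \<Longrightarrow> \<bar>?\<eta>'' x\<bar> \<le> S"
      using x0(2) by (auto simp: S_def)
    have sup: "(SUP v\<in>?I. ennreal \<bar>?\<eta>'' v\<bar>) = ennreal S"
      by (intro antisym SUP_least SUP_upper2[OF x0(1)]) (auto simp: S_def intro!: ennreal_leI x0(2))
    \<comment> \<open>An open subset of the closed strip lies in its interior, so functions
      supported in \<open>U\<close> are admissible as test functions.\<close>
    have U': "U \<subseteq> {0<..<T} \<times> UNIV"
      using interior_maximal[OF U(2,1)] by (simp add: interior_Times)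
    have sets: "sets \<mu>p = sets borel" "sets \<mu>n = sets borel"
      and fin: "\<And>K. compact K \<Longrightarrow> emeasure \<mu>p K < \<infinity>" "\<And>K. compact K \<Longrightarrow> emeasure \<mu>n K < \<infinity>"
      and eq: "\<And>\<phi>. test_fun T \<phi> \<Longrightarrow> - (LINT p|lborel. \<eta> (u (fst p) (snd p)) * dt \<phi> (fst p) (snd p)
                          + q (u (fst p) (snd p)) * dx \<phi> (fst p) (snd p))
        = (LINT p|\<mu>p. \<phi> (fst p) (snd p)) - (LINT p|\<mu>n. \<phi> (fst p) (snd p))"
      using repr unfolding entropy_production_repr_def by blast+
    obtain N where N: "N \<in> sets borel" "emeasure \<mu>p N = 0" "emeasure \<mu>n (- N) = 0"
      using repr unfolding entropy_production_repr_def by blast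
    note tv = total_variation_le[OF sets fin N U(1) U' C(2)]
    have esetup: "entropy_setup a B (\<lambda>p. \<phi> (fst p) (snd p)) (\<lambda>p. dt \<phi> (fst p) (snd p)) (\<lambda>p. dx \<phi> (fst p) (snd p)) K
        T S (ess_inf_strip T u) (ess_sup_strip T u) (clip T u) \<eta> (deriv \<eta>) ?\<eta>'' q"
      if "test_fun T \<phi>" "compact K" "K \<subseteq> U" "\<And>p. p \<notin> K \<Longrightarrow> \<phi> (fst p) (snd p) = 0" "\<And>t x. \<bar>\<phi> t x\<bar> \<le> 1" for \<phi> K
    proof (intro entropy_setup.intro entropy_setup_axioms.intro)
      show "convex_flux a B" by fact
      show "test_function (\<lambda>p. \<phi> (fst p) (snd p)) (\<lambda>p. dt \<phi> (fst p) (snd p)) (\<lambda>p. dx \<phi> (fst p) (snd p)) K"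
        by (rule test_fun_test_function[OF that(1,2,4)])
      show "clip T u \<in> borel_measurable borel" by (rule clip_measurable[OF T u])
      show "ess_inf_strip T u \<le> clip T u p" "clip T u p \<le> ess_sup_strip T u" for p
        by (rule clip_range[OF T u])+
      show "(LINT p|lborel. clip T u p * dt \<psi> (fst p) (snd p) + a (clip T u p) * dx \<psi> (fst p) (snd p)) = 0"
        if "test_fun T \<psi>" for \<psi>
        using test_integral_clip[OF T u that continuous_on_id cont_a] weak that by (simp add: weak_solution_def)
      show "K \<subseteq> {0<..<T} \<times> UNIV" using that(3) U' by blast
    qed (use \<eta> q S that(5) in auto)
    have production: "entropy_setup.production (\<lambda>p. dt \<phi> (fst p) (snd p)) (\<lambda>p. dx \<phi> (fst p) (snd p)) (clip T u) \<eta> q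
        = (LINT p|\<mu>p. \<phi> (fst p) (snd p)) - (LINT p|\<mu>n. \<phi> (fst p) (snd p))"
      if "test_fun T \<phi>" "compact K" "K \<subseteq> U" "\<And>p. p \<notin> K \<Longrightarrow> \<phi> (fst p) (snd p) = 0" "\<And>t x. \<bar>\<phi> t x\<bar> \<le> 1" for \<phi> K
      using entropy_setup.production_def[OF esetup[OF that]] eq[OF that(1)]
        test_integral_clip[OF T u that(1) cont] by simp
    show "emeasure \<mu>p U + emeasure \<mu>n U \<le> ennreal (2 * C * C) * (SUP v\<in>?I. ennreal \<bar>?\<eta>'' v\<bar>) * ?lim"
    \<comment> \<open>With \<open>S = 0\<close> the right hand side is 0 whatever the limit superior
      is, infinite included.\<close>
    proof (cases "S = 0")
      case True
      have "emeasure \<mu>p U + emeasure \<mu>n U \<le> ennreal 0"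
      proof (rule tv)
        fix \<phi> K assume *: "test_fun T \<phi>" "compact K" "K \<subseteq> U" "\<And>p. p \<notin> K \<Longrightarrow> \<phi> (fst p) (snd p) = 0" "\<And>t x. \<bar>\<phi> t x\<bar> \<le> 1"
        show "(LINT p|\<mu>p. \<phi> (fst p) (snd p)) - (LINT p|\<mu>n. \<phi> (fst p) (snd p)) \<le> 0"
          using entropy_setup.production_nonpos[OF esetup[OF *] C(2) C(1) True] production[OF *] by simp
      qed
      then show ?thesis by simp
    next
      case False
      then have S0: "S > 0" using S(1) by simp
      show ?thesis
      \<comment> \<open>The other factors are positive here, so an infinite limit superior makes the
        bound trivial.\<close>
      proof (cases "?lim = \<infinity>")
        case True
        have "ennreal (2 * C * C) * ennreal S \<noteq> 0" using C(1) S0 by simp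
        then have "ennreal (2 * C * C) * ennreal S * ?lim = \<infinity>" unfolding True by (simp add: ennreal_mult_top)
        then show ?thesis unfolding sup by simp
      next
        case False
        have "\<exists>l\<ge>0. X = ennreal l" if "X \<noteq> \<infinity>" for X :: ennreal
          using that by (cases X rule: ennreal_cases) auto
        from this[OF False] obtain l where l: "?lim = ennreal l" "l \<ge> 0" by blast
        \<comment> \<open>The difference quotients need not be below \<open>l\<close> for any small
          \<open>h\<close>, but they are eventually below every larger \<open>\<Lambda>\<close>;
          \<open>l\<close> is recovered at the end.\<close>
        have main: "emeasure \<mu>p U + emeasure \<mu>n U \<le> ennreal (S * (2 * C * C * \<Lambda>))" if \<Lambda>: "\<Lambda> > l" for \<Lambda>
        proof (rule tv)
          have "?lim < ennreal \<Lambda>" using \<Lambda> l by (simp add: ennreal_lessI)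
          then have "eventually (\<lambda>\<epsilon>. (SUP h\<in>{h::real. h \<noteq> 0 \<and> \<bar>h\<bar> < \<epsilon>}. ennreal (1 / \<bar>h\<bar>) * ?D h) < ennreal \<Lambda>) (at_right 0)"
            by (rule Limsup_lessD)
          then obtain h1 where h1: "h1 > 0" "\<And>\<epsilon>. 0 < \<epsilon> \<Longrightarrow> \<epsilon> < h1 \<Longrightarrow>
              (SUP h\<in>{h::real. h \<noteq> 0 \<and> \<bar>h\<bar> < \<epsilon>}. ennreal (1 / \<bar>h\<bar>) * ?D h) < ennreal \<Lambda>"
            unfolding eventually_at_right_field by auto
          \<comment> \<open>Halved because \<open>h1\<close> itself is not among the admissible
            values of \<open>\<epsilon>\<close>.\<close>
          define h0 where "h0 = h1 / 2"
          have h0: "h0 > 0" using h1 by (simp add: h0_def)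
          have D: "?D h \<le> ennreal (\<Lambda> * \<bar>h\<bar>)" if h: "h \<noteq> 0" "\<bar>h\<bar> < h0" for h
          proof -
            have "ennreal (1 / \<bar>h\<bar>) * ?D h \<le> (SUP h\<in>{h::real. h \<noteq> 0 \<and> \<bar>h\<bar> < h0}. ennreal (1 / \<bar>h\<bar>) * ?D h)"
              by (rule SUP_upper) (use h in simp)
            also have "\<dots> < ennreal \<Lambda>" using h1 by (intro h1(2)) (auto simp: h0_def)
            finally have "ennreal \<bar>h\<bar> * (ennreal (1 / \<bar>h\<bar>) * ?D h) \<le> ennreal \<bar>h\<bar> * ennreal \<Lambda>"
              by (intro mult_left_mono) auto
            moreover have "ennreal \<bar>h\<bar> * (ennreal (1 / \<bar>h\<bar>) * ?D h) = ?D h"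
              using h(1) by (simp add: mult.assoc[symmetric] ennreal_mult[symmetric])
            ultimately show ?thesis using \<Lambda> l(2) by (simp add: ennreal_mult[symmetric] mult.commute)
          qed
          fix \<phi> K assume *: "test_fun T \<phi>" "compact K" "K \<subseteq> U" "\<And>p. p \<notin> K \<Longrightarrow> \<phi> (fst p) (snd p) = 0" "\<And>t x. \<bar>\<phi> t x\<bar> \<le> 1"
          \<comment> \<open>The hypothesis controls the cost only on \<open>U\<close>; this radius
            leaves room to shift \<open>K\<close> by the offsets of the mollifier without leaving
            it.\<close>
          obtain r where r: "r > 0" "(\<Union>x\<in>K. cball x r) \<subseteq> U"
            using compact_subset_open_imp_cball_epsilon_subset[OF *(2) U(1) *(3)] by blast
          define K' where "K' = (\<Union>x\<in>K. cball x r)"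
          have K': "compact K'" "K' \<subseteq> U" "K' \<in> sets borel"
            using compact_minkowski_sum_cball[OF *(2)] r by (auto simp: K'_def borel_compact)
          have "(LINT p|local_lebesgue K'. Delta a (clip T u p) (clip T u (p + (0, h)))) \<le> \<Lambda> * \<bar>h\<bar>"
            if h: "h \<noteq> 0" "\<bar>h\<bar> < h0" for h
          proof (rule integral_real_bounded)
            note [measurable] = clip_measurable[OF T u]
            show "0 \<le> \<Lambda> * \<bar>h\<bar>" using \<Lambda> l by simp
            have "(\<integral>\<^sup>+ p. ennreal (Delta a (clip T u p) (clip T u (p + (0, h)))) \<partial>local_lebesgue K')
                = (\<integral>\<^sup>+ p\<in>K'. ennreal (Delta a (clip T u p) (clip T u (p + (0, h)))) \<partial>lborel)"
              unfolding local_lebesgue_def using K'(3)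
              by (subst nn_integral_density) (auto simp: ennreal_indicator mult.commute)
            also have "\<dots> \<le> (\<integral>\<^sup>+ p\<in>U. ennreal (Delta a (clip T u p) (clip T u (p + (0, h)))) \<partial>lborel)"
              using K'(2) by (intro nn_integral_mono) (auto simp: indicator_def)
            also have "\<dots> = ?D h" using Delta_integral_clip[OF T u U(2)] by simp
            also have "\<dots> \<le> ennreal (\<Lambda> * \<bar>h\<bar>)" by (rule D[OF h])
            finally show "(\<integral>\<^sup>+ p. ennreal (Delta a (clip T u p) (clip T u (p + (0, h)))) \<partial>local_lebesgue K')
              \<le> ennreal (\<Lambda> * \<bar>h\<bar>)" .
          qed
          moreover have "p - z \<in> K'" if "p \<in> K" "norm z \<le> r" for p z
            unfolding K'_def using that by (intro UN_I[of p]) (auto simp: dist_norm)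
          ultimately show "(LINT p|\<mu>p. \<phi> (fst p) (snd p)) - (LINT p|\<mu>n. \<phi> (fst p) (snd p)) \<le> S * (2 * C * C * \<Lambda>)"
            using entropy_setup.production_le[OF esetup[OF *] C(2) C(1) K'(1) r(1) _ h0, of \<Lambda>] \<Lambda> l(2) production[OF *] by simp
        qed
        define P where "P = S * (2 * C * C)"
        have P: "P > 0" using S0 C by (simp add: P_def)
        have "emeasure \<mu>p U + emeasure \<mu>n U \<le> ennreal (P * l)"
        proof (rule ennreal_le_epsilon)
          fix e :: real assume e: "0 < e"
          \<comment> \<open>The excess \<open>e / P\<close> of \<open>\<Lambda>\<close> over
            \<open>l\<close> becomes exactly \<open>e\<close> after multiplication by
            \<open>P\<close>.\<close>
          have "emeasure \<mu>p U + emeasure \<mu>n U \<le> ennreal (S * (2 * C * C * (l + e / P)))"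
            using e P by (intro main) simp
          also have "S * (2 * C * C * (l + e / P)) = P * (l + e / P)" by (simp add: P_def)
          also have "\<dots> = P * l + e" using P by (simp add: field_simps)
          also have "ennreal (P * l + e) = ennreal (P * l) + ennreal e"
            using P l e by (intro ennreal_plus) auto
          finally show "emeasure \<mu>p U + emeasure \<mu>n U \<le> ennreal (P * l) + ennreal e" .
        qed
        also have "ennreal (P * l) = ennreal (2 * C * C) * ennreal S * ennreal l"
          using C S0 l by (simp add: P_def ennreal_mult[symmetric] mult_ac)
        finally show ?thesis unfolding sup l(1) .
      qed
    qed
  qed
qed

end
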